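(* Let $d\ge 1$ and let $\Omega\subset\mathbb{R}^d$ be a bounded open set. Let $H^1_0(\Omega)$ be the closure of $C^\infty_c(\Omega)$ in $H^1(\Omega)$, let $\widetilde H^1(\Omega)$ be the closure of $H^1(\Omega)\cap C^0(\overline\Omega)$ in $H^1(\Omega)$, and let $H^1_{{\rm tr},0}(\Omega)=\{u\in H^1_{\rm tr}(\Omega):{\rm tr}(u)=0\}$. Then $$H^1_0(\Omega)\subset H^1_{{\rm tr},0}(\Omega)\subset\widetilde H^1(\Omega)\subset H^1_{\rm tr}(\Omega).$$
   Context: $\partial\Omega=\overline{\Omega}\setminus\Omega$; $\mathbb{S}^{d-1}$ is the Euclidean unit sphere; $]a,b[$ denotes the open real interval. For $\theta\in\mathbb{S}^{d-1}$, $W_\theta(\Omega)$ is the set of $u\in L^2(\Omega)$ whose weak derivative $\partial_\theta u$ in direction $\theta$ is in $L^2(\Omega)$; $H^1(\Omega)\subset W_\theta(\Omega)$. $H_\theta=\{y\in\mathbb{R}^d: y\cdot\theta=0\}$; $\mathcal{P}_\theta(x)=x-(x\cdot\theta)\theta$; $\lambda^{d-1}$ is the $(d-1)$-dimensional Lebesgue measure on $H_\theta$ (identified isometrically with $\mathbb{R}^{d-1}$). For $y\in H_\theta$, $\omega_\theta(y)=\{s\in\mathbb{R}: s\theta+y\in\Omega\}$, and $\mathcal{I}_\theta(y)$ is the countable set of disjoint bounded open intervals (the connected components) whose union is $\omega_\theta(y)$. Directional trace: a function $g:\partial\Omega\to\mathbb{R}$ is a directional trace of $u\in W_\theta(\Omega)$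 in the direction $\theta$ if there exist a representative of $u$ (still denoted $u$) and a set $A\subset\mathcal{P}_\theta(\Omega)$ such that (1) $\mathcal{P}_\theta(\Omega)\setminus A$ is $\lambda^{d-1}$-negligible; (2) for all $y\in A$, $u_{\theta,y}:s\mapsto u(s\theta+y)$ is an element of $H^1(\omega_\theta(y))$ and, for all $]\alpha,\beta[\,\in\mathcal{I}_\theta(y)$, taking the representative of $u_{\theta,y}$ which is continuous on $]\alpha,\beta]$, one has $g(\beta\theta+y)=u_{\theta,y}(\beta)$. Directional measure: for $x\in\Omega$, $\delta_\theta(x)=\sup\{s\ge 0:\forall t\in[0,s[,\ x+t\theta\in\Omega\}$ and $\Phi_\theta(x)=x+\delta_\theta(x)\theta\in\partial\Omega$. The finite Borel measure $\mu_\theta$ on $\partial\Omega$ is $\mu_\theta(A)=\int_\Omega\chi_A(\Phi_\theta(x))\,dx$ for Borel $A\subset\partial\Omega$. $\gamma_\theta u$ is the set of all directional traces of $u$ in direction $\theta$, an equivalence class for equality $\mu_\theta$-a.e. $\mathcal{L}^2(\partial\Omega,(\mu_\theta)_{\theta\in\mathbb{S}^{d-1}})$ is the set of functions $f:\partial\Omega\to\mathbb{R}$ for which there is $M\ge 0$ such that for every $\theta\in\mathbb{S}^{d-1}$ there is $g_\theta\in\mathcal{L}^2(\partial\Omega,\mu_\theta)$ with $f=g_\theta$ $\mu_\theta$-a.e. and $\int|g_\theta|^2d\mu_\theta\le M$. $L^2(\partial\Omega,(\mu_\theta)_{\theta\in\mathbb{S}^{d-1}})$ is its quotient by the relation "$f=g$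 $\mu_\theta$-a.e. for every $\theta\in\mathbb{S}^{d-1}$". Omnidirectional trace: $u\in H^1(\Omega)$ belongs to $H^1_{\rm tr}(\Omega)$ if there is $g\in L^2(\partial\Omega,(\mu_\theta)_{\theta\in\mathbb{S}^{d-1}})$ such that for all $\theta\in\mathbb{S}^{d-1}$, $\gamma_\theta u(z)=g(z)$ for $\mu_\theta$-a.e. $z\in\partial\Omega$; then ${\rm tr}(u):=g$. *)

theory Defs
  imports "HOL-Analysis.Analysis"
begin

text \<open>
  Elements of a function space over \<open>\<Omega>\<close> (or over its boundary) are represented by total functions
  whose values outside \<open>\<Omega>\<close> (resp. outside \<open>frontier \<Omega>\<close>) are irrelevant. Instead of passing to
  quotients, every function space below is the set of all representatives of its classes, i.e. it
  is saturated under the a.e. equality in question.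

  For open \<open>\<Omega>\<close> the boundary \<open>closure \<Omega> - \<Omega>\<close> is \<open>frontier \<Omega>\<close>. The unit sphere is \<open>sphere 0 1\<close>.
\<close>

section \<open>Square integrable functions, weak derivatives and Sobolev spaces\<close>

definition L2 :: "'a measure \<Rightarrow> ('a \<Rightarrow> real) set" where
  "L2 M = {f \<in> borel_measurable M. integrable M (\<lambda>x. (f x)\<^sup>2)}"

primrec C_k :: "nat \<Rightarrow> ('a::euclidean_space \<Rightarrow> real) \<Rightarrow> bool" where
  "C_k 0 f \<longleftrightarrow> continuous_on UNIV f"
| "C_k (Suc k) f \<longleftrightarrow>
     (\<forall>x. f differentiable (at x)) \<and> (\<forall>b\<in>Basis. C_k k (\<lambda>x. frechet_derivative f (at x) b))"

definition Cc_infinity :: "'a::euclidean_space set \<Rightarrow> ('a \<Rightarrow> real) set" where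
  "Cc_infinity \<Omega> =
     {\<phi>. (\<forall>k. C_k k \<phi>) \<and> compact (closure {x. \<phi> x \<noteq> 0}) \<and> closure {x. \<phi> x \<noteq> 0} \<subseteq> \<Omega>}"

text \<open>\<open>v\<close> is a weak derivative of \<open>u\<close> in direction \<open>\<theta>\<close>; only used for \<open>u, v \<in> L2 (lebesgue_on \<Omega>)\<close>,
  so that both integrals exist.\<close>
definition has_weak_deriv ::
    "'a::euclidean_space set \<Rightarrow> 'a \<Rightarrow> ('a \<Rightarrow> real) \<Rightarrow> ('a \<Rightarrow> real) \<Rightarrow> bool" where
  "has_weak_deriv \<Omega> \<theta> u v \<longleftrightarrow>
     (\<forall>\<phi>\<in>Cc_infinity \<Omega>.
        (\<integral>x. u x * frechet_derivative \<phi> (at x) \<theta> \<partial>lebesgue_on \<Omega>)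
          = - (\<integral>x. v x * \<phi> x \<partial>lebesgue_on \<Omega>))"

definition W_dir :: "'a::euclidean_space set \<Rightarrow> 'a \<Rightarrow> ('a \<Rightarrow> real) set" where
  "W_dir \<Omega> \<theta> = {u \<in> L2 (lebesgue_on \<Omega>). \<exists>v \<in> L2 (lebesgue_on \<Omega>). has_weak_deriv \<Omega> \<theta> u v}"

definition H1 :: "'a::euclidean_space set \<Rightarrow> ('a \<Rightarrow> real) set" where
  "H1 \<Omega> = {u \<in> L2 (lebesgue_on \<Omega>). \<forall>b\<in>Basis. u \<in> W_dir \<Omega> b}"

definition weak_deriv :: "'a::euclidean_space set \<Rightarrow> 'a \<Rightarrow> ('a \<Rightarrow> real) \<Rightarrow> 'a \<Rightarrow> real" where
  "weak_deriv \<Omega> \<theta> u = (SOME v. v \<in> L2 (lebesgue_on \<Omega>) \<and> has_weak_deriv \<Omega> \<theta> u v)"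

definition H1_norm :: "'a::euclidean_space set \<Rightarrow> ('a \<Rightarrow> real) \<Rightarrow> real" where
  "H1_norm \<Omega> u =
     sqrt ((\<integral>x. (u x)\<^sup>2 \<partial>lebesgue_on \<Omega>)
           + (\<Sum>b\<in>Basis. \<integral>x. (weak_deriv \<Omega> b u x)\<^sup>2 \<partial>lebesgue_on \<Omega>))"

definition H1_closure :: "'a::euclidean_space set \<Rightarrow> ('a \<Rightarrow> real) set \<Rightarrow> ('a \<Rightarrow> real) set" where
  "H1_closure \<Omega> S = {u \<in> H1 \<Omega>. \<forall>e>0. \<exists>v\<in>S. H1_norm \<Omega> (\<lambda>x. u x - v x) < e}"

definition H1_0 :: "'a::euclidean_space set \<Rightarrow> ('a \<Rightarrow> real) set" where
  "H1_0 \<Omega> = H1_closure \<Omega> (Cc_infinity \<Omega>)"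

definition H1_tilde :: "'a::euclidean_space set \<Rightarrow> ('a \<Rightarrow> real) set" where
  "H1_tilde \<Omega> = H1_closure \<Omega> {v \<in> H1 \<Omega>. continuous_on (closure \<Omega>) v}"

section \<open>Directional traces\<close>

definition hyperplane :: "'a::euclidean_space \<Rightarrow> 'a set" where
  "hyperplane \<theta> = {y. y \<bullet> \<theta> = 0}"

definition proj_dir :: "'a::euclidean_space \<Rightarrow> 'a \<Rightarrow> 'a" where
  "proj_dir \<theta> x = x - (x \<bullet> \<theta>) *\<^sub>R \<theta>"

definition orthonormal_basis_of :: "'a::euclidean_space set \<Rightarrow> 'a set \<Rightarrow> bool" where
  "orthonormal_basis_of V B \<longleftrightarrow> pairwise orthogonal B \<and> (\<forall>b\<in>B. norm b = 1) \<and> span B = V"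

text \<open>Lebesgue measure on the hyperplane, as a Borel measure on the ambient space: the image of the
  product measure under the isometry given by an orthonormal basis of the hyperplane, just as
  \<open>lborel\<close> is built from \<open>Basis\<close>. It does not depend on the choice of that basis. In dimension 1 it
  is the unit point mass at \<open>0\<close>.\<close>
definition lborel_hyperplane :: "'a::euclidean_space \<Rightarrow> 'a measure" where
  "lborel_hyperplane \<theta> =
     (let B = (SOME B. orthonormal_basis_of (hyperplane \<theta>) B)
      in distr (\<Pi>\<^sub>M b\<in>B. lborel) borel (\<lambda>f. \<Sum>b\<in>B. f b *\<^sub>R b))"

definition line_slice :: "'a::euclidean_space set \<Rightarrow> 'a \<Rightarrow> 'a \<Rightarrow> real set" where
  "line_slice \<Omega> \<theta> y = {s. s *\<^sub>R \<theta> + y \<in> \<Omega>}"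

text \<open>The connected components of a slice of a bounded open set are nonempty bounded open
  intervals. The continuous representative on \<open>{\<alpha><..\<beta>}\<close> required in the last clause is unique.\<close>
definition directional_trace ::
    "'a::euclidean_space set \<Rightarrow> 'a \<Rightarrow> ('a \<Rightarrow> real) \<Rightarrow> ('a \<Rightarrow> real) \<Rightarrow> bool" where
  "directional_trace \<Omega> \<theta> u g \<longleftrightarrow>
     u \<in> W_dir \<Omega> \<theta> \<and>
     (\<exists>w A. (AE x in lebesgue_on \<Omega>. w x = u x) \<and>
        A \<subseteq> proj_dir \<theta> ` \<Omega> \<and>
        proj_dir \<theta> ` \<Omega> - A \<in> null_sets (completion (lborel_hyperplane \<theta>)) \<and>
        (\<forall>y\<in>A. (\<lambda>s. w (s *\<^sub>R \<theta> + y)) \<in> H1 (line_slice \<Omega> \<theta> y) \<and>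
           (\<forall>\<alpha> \<beta>. {\<alpha><..<\<beta>} \<in> components (line_slice \<Omega> \<theta> y) \<longrightarrow>
              (\<exists>v. (AE s in lebesgue_on {\<alpha><..<\<beta>}. v s = w (s *\<^sub>R \<theta> + y)) \<and>
                   continuous_on {\<alpha><..\<beta>} v \<and>
                   g (\<beta> *\<^sub>R \<theta> + y) = v \<beta>))))"

definition gamma_dir :: "'a::euclidean_space set \<Rightarrow> 'a \<Rightarrow> ('a \<Rightarrow> real) \<Rightarrow> ('a \<Rightarrow> real) set" where
  "gamma_dir \<Omega> \<theta> u = {g. directional_trace \<Omega> \<theta> u g}"

section \<open>Directional measures and omnidirectional traces\<close>

definition delta_dir :: "'a::euclidean_space set \<Rightarrow> 'a \<Rightarrow> 'a \<Rightarrow> real" where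
  "delta_dir \<Omega> \<theta> x = Sup {s. 0 \<le> s \<and> (\<forall>t\<in>{0..<s}. x + t *\<^sub>R \<theta> \<in> \<Omega>)}"

definition Phi_dir :: "'a::euclidean_space set \<Rightarrow> 'a \<Rightarrow> 'a \<Rightarrow> 'a" where
  "Phi_dir \<Omega> \<theta> x = x + delta_dir \<Omega> \<theta> x *\<^sub>R \<theta>"

definition mu_dir :: "'a::euclidean_space set \<Rightarrow> 'a \<Rightarrow> 'a measure" where
  "mu_dir \<Omega> \<theta> = distr (lebesgue_on \<Omega>) (restrict_space borel (frontier \<Omega>)) (Phi_dir \<Omega> \<theta>)"

definition L2_omni :: "'a::euclidean_space set \<Rightarrow> ('a \<Rightarrow> real) set" where
  "L2_omni \<Omega> =
     {f. \<exists>M\<ge>0. \<forall>\<theta>\<in>sphere 0 1. \<exists>g \<in> L2 (mu_dir \<Omega> \<theta>).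
           (AE z in mu_dir \<Omega> \<theta>. f z = g z) \<and> (\<integral>z. (g z)\<^sup>2 \<partial>mu_dir \<Omega> \<theta>) \<le> M}"

definition eq_omni :: "'a::euclidean_space set \<Rightarrow> ('a \<Rightarrow> real) \<Rightarrow> ('a \<Rightarrow> real) \<Rightarrow> bool" where
  "eq_omni \<Omega> f g \<longleftrightarrow> (\<forall>\<theta>\<in>sphere 0 1. AE z in mu_dir \<Omega> \<theta>. f z = g z)"

definition omni_trace :: "'a::euclidean_space set \<Rightarrow> ('a \<Rightarrow> real) \<Rightarrow> ('a \<Rightarrow> real) \<Rightarrow> bool" where
  "omni_trace \<Omega> u g \<longleftrightarrow>
     g \<in> L2_omni \<Omega> \<and>
     (\<forall>\<theta>\<in>sphere 0 1. \<exists>h \<in> gamma_dir \<Omega> \<theta> u. AE z in mu_dir \<Omega> \<theta>. h z = g z)"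

definition H1_tr :: "'a::euclidean_space set \<Rightarrow> ('a \<Rightarrow> real) set" where
  "H1_tr \<Omega> = {u \<in> H1 \<Omega>. \<exists>g. omni_trace \<Omega> u g}"

text \<open>A representative of the trace, which is unique up to \<open>eq_omni \<Omega>\<close>.\<close>
definition tr :: "'a::euclidean_space set \<Rightarrow> ('a \<Rightarrow> real) \<Rightarrow> 'a \<Rightarrow> real" where
  "tr \<Omega> u = (SOME g. omni_trace \<Omega> u g)"

definition H1_tr_0 :: "'a::euclidean_space set \<Rightarrow> ('a \<Rightarrow> real) set" where
  "H1_tr_0 \<Omega> = {u \<in> H1_tr \<Omega>. eq_omni \<Omega> (tr \<Omega> u) (\<lambda>_. 0)}"

end

theory Submission
  imports Defs "HOL-Computational_Algebra.Polynomial"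
begin

text \<open>
  The trace of a Sobolev function is controlled by a single formula that does not mention lines. Let
  \<open>V\<close> be the weak derivative of \<open>U\<close> in the unit direction \<open>\<theta>\<close>, and let \<open>\<delta>(x)\<close> be the time at which
  the ray from \<open>x\<close> in direction \<open>\<theta>\<close> leaves \<open>\<Omega>\<close>. A function \<open>g\<close> on the boundary is a directional trace
  of \<open>U\<close> exactly if, for almost every \<open>x\<close> in \<open>\<Omega>\<close>, its value at the exit point of \<open>x\<close> is the
  \<^emph>\<open>exit value\<close>, namely \<open>U(x)\<close> plus the integral of \<open>V\<close> over the segment from \<open>x\<close> to the exit point
  (\<open>directional_trace_imp_exit_value\<close>, \<open>exit_value_imp_directional_trace\<close>). The exit value is linear
  in the pair \<open>U, V\<close>, and by the Cauchy-Schwarz inequality its norm in \<open>L2\<close> of \<open>\<Omega>\<close> is bounded by the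
  Sobolev norm of \<open>U\<close>, uniformly in \<open>\<theta>\<close> (\<open>exit_value_square_bound\<close>). The integral of \<open>g\<^sup>2\<close> against the
  directional measure is, by definition, the integral over \<open>\<Omega>\<close> of the square of the exit value.

  The first and the last inclusion rest on these facts as follows. If continuous functions \<open>v n\<close>
  converge to \<open>u\<close> in the Sobolev norm with geometric speed, then at the exit points \<open>v n\<close> converges
  almost everywhere to the exit value of \<open>u\<close>, for each direction
  (\<open>approximation_converges_at_exit\<close>). So the pointwise limit of \<open>v n\<close> on the boundary is an
  omnidirectional trace of \<open>u\<close>. If the \<open>v n\<close> are test functions, this limit is \<open>0\<close>; this gives the
  first inclusion, because for each direction any two traces of \<open>u\<close> agree almost everywhere.

  For the remaining inclusion let the trace of \<open>u\<close> be zero. In the directions \<open>b\<close> and \<open>-b\<close> this says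
  that on almost every line parallel to \<open>b\<close> the continuous representative vanishes at both ends of
  each component of the slice. Consequently the extension of \<open>u\<close> by zero is, on the whole line, a
  primitive of the extension by zero of the derivative (\<open>vanishing_trace_increment\<close>). Averages of the
  extension over small cubes are continuous, inherit this property, and converge to \<open>u\<close> in the Sobolev
  norm.

  Weak derivatives enter all these arguments through increments: \<open>V\<close> is the weak derivative of \<open>U\<close> in
  direction \<open>\<theta>\<close> if and only if \<open>U(x + h \<theta>) - U(x)\<close> is the integral of \<open>V\<close> over the segment from \<open>x\<close>
  to \<open>x + h \<theta>\<close>, for almost every \<open>x\<close> such that the segment lies in \<open>\<Omega>\<close>, and for all small steps
  \<open>h\<close> (\<open>weak_derivative_imp_increment\<close>, \<open>increment_imp_weak_derivative\<close>). This form passes to almost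
  every line by Fubini's theorem, and to averages by translation invariance.
\<close>

section \<open>Smooth bump functions\<close>

text \<open>
  The functions \<open>p(1/t) exp(-c/t)\<close>, extended by \<open>0\<close> to \<open>t \<le> 0\<close>. Letting \<open>p\<close> run through all
  polynomials makes the family closed under differentiation, so that smoothness follows
  from the computation of one derivative. The parameter \<open>c\<close> later tends to \<open>0\<close>, which turns products of
  these functions into indicators.
\<close>

definition exp_poly :: "real \<Rightarrow> real poly \<Rightarrow> real \<Rightarrow> real" where
  "exp_poly c p t = (if t > 0 then poly p (1 / t) * exp (- c / t) else 0)"

lemma poly_times_exp_tendsto_0:
  fixes c :: real
  assumes "c > 0"
  shows "((\<lambda>x. poly p x * exp (- c * x)) \<longlongrightarrow> 0) at_top"
proof -
  have lim: "((\<lambda>x. x ^ i * exp (- c * x)) \<longlongrightarrow> 0) at_top" for i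
  proof -
    have "filterlim (\<lambda>x. c * x) at_top at_top"
      using assms by (intro filterlim_tendsto_pos_mult_at_top[OF tendsto_const]) (auto simp: filterlim_ident)
    then have "((\<lambda>x. (c * x) ^ i / exp (c * x)) \<longlongrightarrow> 0) at_top"
      by (rule filterlim_compose[OF tendsto_power_div_exp_0])
    then have "((\<lambda>x. (1 / c ^ i) * ((c * x) ^ i / exp (c * x))) \<longlongrightarrow> (1 / c ^ i) * 0) at_top"
      by (intro tendsto_mult tendsto_const)
    moreover have "(1 / c ^ i) * ((c * x) ^ i / exp (c * x)) = x ^ i * exp (- c * x)" for x
      using assms by (simp add: power_mult_distrib exp_minus field_simps)
    ultimately show ?thesis by simp
  qed
  have "((\<lambda>x. \<Sum>i\<le>degree p. coeff p i * (x ^ i * exp (- c * x))) \<longlongrightarrow> (\<Sum>i\<le>degree p. coeff p i * 0)) at_top"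
    by (intro tendsto_sum tendsto_mult tendsto_const lim)
  then show ?thesis
    by (simp add: poly_altdef sum_distrib_right mult.assoc)
qed

lemma exp_poly_has_derivative:
  assumes "c > 0"
  shows "(exp_poly c p has_real_derivative exp_poly c (monom 1 2 * (smult c p - pderiv p)) t) (at t)"
proof -
  consider "t > 0" | "t < 0" | "t = 0" by linarith
  then show ?thesis
  proof cases
    case 1
    have "((\<lambda>t. poly p (1 / t) * exp (- c / t)) has_real_derivative
        exp_poly c (monom 1 2 * (smult c p - pderiv p)) t) (at t)"
      using 1 unfolding exp_poly_def
      by (auto intro!: derivative_eq_intros DERIV_chain2[OF poly_DERIV]
          simp: poly_monom field_simps power2_eq_square)
    then show ?thesis
      by (rule has_field_derivative_transform_within_open[where S="{0<..}"])
        (use 1 in \<open>auto simp: exp_poly_def\<close>)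
  next
    case 2
    have "((\<lambda>t. 0) has_real_derivative 0) (at t)" by simp
    then have "(exp_poly c p has_real_derivative 0) (at t)"
      by (rule has_field_derivative_transform_within_open[where S="{..<0}"])
        (use 2 in \<open>auto simp: exp_poly_def\<close>)
    with 2 show ?thesis by (simp add: exp_poly_def)
  next
    case 3
    have "((\<lambda>x. poly (pCons 0 p) x * exp (- c * x)) \<longlongrightarrow> 0) at_top"
      by (rule poly_times_exp_tendsto_0[OF assms])
    then have "((\<lambda>h. poly (pCons 0 p) (inverse h) * exp (- c * inverse h)) \<longlongrightarrow> 0) (at_right 0)"
      by (rule filterlim_compose[OF _ filterlim_inverse_at_top_right])
    then have "((\<lambda>h. exp_poly c p h / h) \<longlongrightarrow> 0) (at_right 0)"
      by (rule Lim_transform_eventually)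
        (auto simp: exp_poly_def eventually_at_right_less field_simps
          intro!: eventually_at_rightI[of 0 1])
    moreover have "((\<lambda>h. exp_poly c p h / h) \<longlongrightarrow> 0) (at_left 0)"
      by (rule Lim_transform_eventually[OF tendsto_const])
        (auto simp: exp_poly_def intro!: eventually_at_leftI[of "-1" 0])
    ultimately have "((\<lambda>h. exp_poly c p h / h) \<longlongrightarrow> 0) (at 0)"
      by (simp add: filterlim_at_split)
    then show ?thesis
      using 3 by (simp add: DERIV_def exp_poly_def)
  qed
qed

text \<open>
  A family of functions of several variables that contains the bumps and is closed under partial
  derivatives; every member is therefore smooth.
\<close>

inductive bump_algebra :: "real \<Rightarrow> ('a::euclidean_space \<Rightarrow> real) \<Rightarrow> bool" for c :: real where
  const: "bump_algebra c (\<lambda>x. r)"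
| gen: "bump_algebra c (\<lambda>x. exp_poly c p (x \<bullet> l + m))"
| add: "bump_algebra c f \<Longrightarrow> bump_algebra c g \<Longrightarrow> bump_algebra c (\<lambda>x. f x + g x)"
| mult: "bump_algebra c f \<Longrightarrow> bump_algebra c g \<Longrightarrow> bump_algebra c (\<lambda>x. f x * g x)"

lemma bump_algebra_derivative:
  assumes "bump_algebra c f" "c > 0"
  shows "\<exists>f'. (\<forall>x. (f has_derivative f' x) (at x)) \<and> (\<forall>b. bump_algebra c (\<lambda>x. f' x b))"
  using assms(1)
proof induction
  case (const r)
  then show ?case
    by (intro exI[of _ "\<lambda>x h. 0"]) (auto intro: bump_algebra.const)
next
  case (gen p l m)
  let ?q = "monom 1 2 * (smult c p - pderiv p)"
  have "((\<lambda>x. exp_poly c p (x \<bullet> l + m)) has_derivative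
      (\<lambda>h. (h \<bullet> l) * exp_poly c ?q (x \<bullet> l + m))) (at x)" for x
  proof -
    have "((\<lambda>x. x \<bullet> l + m) has_derivative (\<lambda>h. h \<bullet> l)) (at x)"
      by (auto intro!: derivative_eq_intros)
    from DERIV_compose_FDERIV[OF exp_poly_has_derivative[OF assms(2)] this]
    show ?thesis .
  qed
  then show ?case
    by (intro exI[of _ "\<lambda>x h. (h \<bullet> l) * exp_poly c ?q (x \<bullet> l + m)"])
      (auto intro: bump_algebra.intros)
next
  case (add f g)
  then obtain f' g' where "\<And>x. (f has_derivative f' x) (at x)" "\<And>b. bump_algebra c (\<lambda>x. f' x b)"
    "\<And>x. (g has_derivative g' x) (at x)" "\<And>b. bump_algebra c (\<lambda>x. g' x b)" by auto
  then show ?case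
    by (intro exI[of _ "\<lambda>x h. f' x h + g' x h"]) (auto intro!: has_derivative_add bump_algebra.add)
next
  case (mult f g)
  then obtain f' g' where "\<And>x. (f has_derivative f' x) (at x)" "\<And>b. bump_algebra c (\<lambda>x. f' x b)"
    "\<And>x. (g has_derivative g' x) (at x)" "\<And>b. bump_algebra c (\<lambda>x. g' x b)" by auto
  then show ?case using mult
    by (intro exI[of _ "\<lambda>x h. f x * g' x h + f' x h * g x"])
      (auto intro!: has_derivative_mult bump_algebra.intros)
qed

lemma bump_algebra_C_k:
  assumes "bump_algebra c f" "c > 0"
  shows "C_k k f"
  using assms(1)
proof (induction k arbitrary: f)
  case 0
  obtain f' where "\<And>x. (f has_derivative f' x) (at x)"
    using bump_algebra_derivative[OF 0 assms(2)] by auto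
  then show ?case
    by (auto intro!: continuous_at_imp_continuous_on has_derivative_continuous)
next
  case (Suc k)
  obtain f' where f': "\<And>x. (f has_derivative f' x) (at x)" "\<And>b. bump_algebra c (\<lambda>x. f' x b)"
    using bump_algebra_derivative[OF Suc.prems assms(2)] by auto
  then have "frechet_derivative f (at x) = f' x" for x
    by (metis frechet_derivative_at)
  with f' show ?case
    by (auto simp: differentiable_def intro!: Suc.IH)
qed

definition bump :: "real \<Rightarrow> 'a::euclidean_space \<Rightarrow> 'a \<Rightarrow> 'a \<Rightarrow> real" where
  "bump c a b x = (\<Prod>i\<in>Basis. exp_poly c 1 (x \<bullet> i - a \<bullet> i) * exp_poly c 1 (b \<bullet> i - x \<bullet> i))"

lemma bump_bounds: "c > 0 \<Longrightarrow> 0 \<le> bump c a b x \<and> bump c a b x \<le> 1"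
  unfolding bump_def exp_poly_def
  by (auto intro!: prod_nonneg prod_le_1 mult_le_one simp: divide_nonpos_pos)

lemma bump_nonzero_iff: "c > 0 \<Longrightarrow> bump c a b x \<noteq> 0 \<longleftrightarrow> x \<in> box a b"
  by (auto simp: bump_def exp_poly_def box_def)

text \<open>
  Since \<open>exp(-c/t)\<close> tends to \<open>1\<close> for \<open>t > 0\<close> as \<open>c\<close> tends to \<open>0\<close>, the indicator of a box is a
  bounded pointwise limit of test functions. This replaces mollification of the indicator.
\<close>

lemma bump_tendsto_indicator:
  "(\<lambda>n. bump (1 / real (Suc n)) a b x) \<longlonglongrightarrow> indicator (box a b) x"
proof (cases "x \<in> box a b")
  case False
  then have "bump (1 / real (Suc n)) a b x = 0" for n
    using bump_nonzero_iff[of "1 / real (Suc n)" a b x] by simp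
  then show ?thesis using False by simp
next
  case True
  then have pos: "x \<bullet> i - a \<bullet> i > 0" "b \<bullet> i - x \<bullet> i > 0" if "i \<in> Basis" for i
    using that by (auto simp: box_def)
  have lim: "(\<lambda>n. exp_poly (1 / real (Suc n)) 1 t) \<longlonglongrightarrow> 1" if "t > 0" for t
  proof -
    have "(\<lambda>n. exp (- ((1 / real (Suc n))) / t)) \<longlonglongrightarrow> exp (- 0 / t)"
      using LIMSEQ_inverse_real_of_nat that by (intro tendsto_intros) (auto simp: inverse_eq_divide)
    then show ?thesis using that by (simp add: exp_poly_def)
  qed
  have "(\<lambda>n. bump (1 / real (Suc n)) a b x) \<longlonglongrightarrow> (\<Prod>i\<in>(Basis::'a set). 1 * 1)"
    unfolding bump_def by (intro tendsto_prod tendsto_mult lim pos)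
  then show ?thesis using True by simp
qed

lemma bump_in_Cc_infinity:
  assumes "c > 0" "cbox a b \<subseteq> \<Omega>"
  shows "bump c a b \<in> Cc_infinity \<Omega>"
proof -
  have "bump_algebra c (\<lambda>x. \<Prod>i\<in>I. exp_poly c 1 (x \<bullet> i - a \<bullet> i) * exp_poly c 1 (b \<bullet> i - x \<bullet> i))"
    if "finite I" for I :: "'a set"
    using that
  proof induction
    case empty
    then show ?case by (simp add: bump_algebra.const)
  next
    case (insert i I)
    have "bump_algebra c (\<lambda>x. exp_poly c 1 (x \<bullet> i - a \<bullet> i))"
      using bump_algebra.gen[of c 1 i "- (a \<bullet> i)"] by simp
    moreover have "bump_algebra c (\<lambda>x. exp_poly c 1 (b \<bullet> i - x \<bullet> i))"
      using bump_algebra.gen[of c 1 "- i" "b \<bullet> i"] by (simp add: algebra_simps)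
    ultimately show ?case using insert
      by (auto intro!: bump_algebra.mult)
  qed
  from this[OF finite_Basis] have "bump_algebra c (bump c a b)"
    by (simp add: bump_def[abs_def])
  moreover have "{x. bump c a b x \<noteq> 0} \<subseteq> cbox a b"
    using bump_nonzero_iff[OF assms(1), of a b] box_subset_cbox by auto
  then have "closure {x. bump c a b x \<noteq> 0} \<subseteq> cbox a b"
    by (rule closure_minimal) (rule closed_cbox)
  moreover from this have "compact (closure {x. bump c a b x \<noteq> 0})"
    using bounded_subset[OF bounded_cbox] by (simp add: compact_eq_bounded_closed)
  ultimately show ?thesis
    using assms(2) bump_algebra_C_k[OF _ assms(1)] unfolding Cc_infinity_def by blast
qed

section \<open>Test functions and the fundamental lemma\<close>

lemma Cc_infinity_differentiable:
  "\<phi> \<in> Cc_infinity \<Omega> \<Longrightarrow> (\<phi> has_derivative frechet_derivative \<phi> (at x)) (at x)"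
  unfolding Cc_infinity_def using frechet_derivative_works
  by (metis (mono_tags, lifting) C_k.simps(2) mem_Collect_eq)

lemma Cc_infinity_continuous: "\<phi> \<in> Cc_infinity \<Omega> \<Longrightarrow> continuous_on S \<phi>"
  using has_derivative_continuous[OF Cc_infinity_differentiable]
  by (metis continuous_at_imp_continuous_on)

lemma Cc_infinity_derivative_sum:
  assumes "\<phi> \<in> Cc_infinity \<Omega>"
  shows "frechet_derivative \<phi> (at x) \<theta> = (\<Sum>b\<in>Basis. (\<theta> \<bullet> b) * frechet_derivative \<phi> (at x) b)"
proof -
  have lin: "linear (frechet_derivative \<phi> (at x))"
    using Cc_infinity_differentiable[OF assms] has_derivative_linear by blast
  have "frechet_derivative \<phi> (at x) (\<Sum>b\<in>Basis. (\<theta> \<bullet> b) *\<^sub>R b)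
    = (\<Sum>b\<in>Basis. (\<theta> \<bullet> b) * frechet_derivative \<phi> (at x) b)"
    by (simp add: linear_sum[OF lin] linear_cmul[OF lin])
  then show ?thesis by (simp add: euclidean_representation)
qed

lemma Cc_infinity_derivative_continuous:
  assumes "\<phi> \<in> Cc_infinity \<Omega>"
  shows "continuous_on S (\<lambda>x. frechet_derivative \<phi> (at x) \<theta>)"
proof -
  have "C_k (Suc 0) \<phi>" using assms by (simp only: Cc_infinity_def mem_Collect_eq)
  then have cont: "continuous_on UNIV (\<lambda>x. frechet_derivative \<phi> (at x) b)" if "b \<in> Basis" for b
    using that by auto
  then have "continuous_on S (\<lambda>x. \<Sum>b\<in>Basis. (\<theta> \<bullet> b) * frechet_derivative \<phi> (at x) b)"
    by (intro continuous_on_sum continuous_on_mult continuous_on_const continuous_on_subset[OF cont]) auto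
  then show ?thesis
    by (simp only: Cc_infinity_derivative_sum[OF assms, of _ \<theta>])
qed

lemma Cc_infinity_derivative_eq_0:
  assumes "\<phi> \<in> Cc_infinity \<Omega>" "x \<notin> closure {x. \<phi> x \<noteq> 0}"
  shows "frechet_derivative \<phi> (at x) \<theta> = 0"
proof -
  have "((\<lambda>x. 0) has_derivative (\<lambda>h. 0)) (at x)" by simp
  then have "(\<phi> has_derivative (\<lambda>h. 0)) (at x)"
    by (rule has_derivative_transform_within_open[where s="- closure {x. \<phi> x \<noteq> 0}"])
      (use assms(2) closure_subset[of "{x. \<phi> x \<noteq> 0}"] in auto)
  then show ?thesis by (metis frechet_derivative_at)
qed

lemma continuous_compact_support_bounded:
  fixes f :: "'a::euclidean_space \<Rightarrow> real"
  assumes "continuous_on UNIV f" "compact K" "\<And>x. x \<notin> K \<Longrightarrow> f x = 0"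
  obtains B where "B > 0" "\<And>x. \<bar>f x\<bar> \<le> B"
proof -
  have "bounded (f ` K)"
    using assms by (meson compact_continuous_image compact_imp_bounded continuous_on_subset top_greatest)
  then obtain B where B: "B > 0" "\<And>x. x \<in> K \<Longrightarrow> \<bar>f x\<bar> \<le> B"
    by (auto simp: bounded_pos)
  show ?thesis
  proof (rule that[OF B(1)])
    show "\<bar>f x\<bar> \<le> B" for x using B assms(3)[of x] by (cases "x \<in> K") auto
  qed
qed

lemma Cc_infinity_bounded:
  assumes "\<phi> \<in> Cc_infinity \<Omega>"
  obtains B where "B > 0" "\<And>x. \<bar>\<phi> x\<bar> \<le> B" "\<And>x. \<bar>frechet_derivative \<phi> (at x) \<theta>\<bar> \<le> B"
proof -
  let ?K = "closure {x. \<phi> x \<noteq> 0}"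
  have K: "compact ?K" using assms by (simp add: Cc_infinity_def)
  obtain B1 where B1: "B1 > 0" "\<And>x. \<bar>\<phi> x\<bar> \<le> B1"
    using continuous_compact_support_bounded[OF Cc_infinity_continuous[OF assms] K] closure_subset
    by (metis (mono_tags, lifting) mem_Collect_eq subset_eq)
  obtain B2 where B2: "B2 > 0" "\<And>x. \<bar>frechet_derivative \<phi> (at x) \<theta>\<bar> \<le> B2"
    using continuous_compact_support_bounded[OF Cc_infinity_derivative_continuous[OF assms] K]
      Cc_infinity_derivative_eq_0[OF assms] by metis
  show ?thesis
    by (rule that[of "max B1 B2"]) (use B1 B2 in \<open>auto simp: le_max_iff_disj\<close>)
qed

lemma Cc_infinity_borel:
  assumes "\<phi> \<in> Cc_infinity \<Omega>"
  shows "\<phi> \<in> borel_measurable borel" "(\<lambda>x. frechet_derivative \<phi> (at x) \<theta>) \<in> borel_measurable borel"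
  using Cc_infinity_continuous[OF assms] Cc_infinity_derivative_continuous[OF assms]
  by (auto intro: borel_measurable_continuous_onI)

lemma integrable_mult_bounded:
  fixes F g :: "'b \<Rightarrow> real"
  assumes "integrable M F" "g \<in> borel_measurable M" "\<And>x. \<bar>g x\<bar> \<le> B"
  shows "integrable M (\<lambda>x. F x * g x)"
proof (rule Bochner_Integration.integrable_bound[OF integrable_mult_right[OF assms(1), of B]])
  have "\<bar>F x\<bar> * \<bar>g x\<bar> \<le> \<bar>F x\<bar> * \<bar>B\<bar>" for x
    using assms(3)[of x] by (intro mult_left_mono) auto
  then show "AE x in M. norm (F x * g x) \<le> norm (B * F x)"
    by (intro AE_I2) (simp add: abs_mult mult.commute)
qed (use assms in auto)

lemma Cc_infinity_integrable_mult:
  assumes "\<phi> \<in> Cc_infinity \<Omega>" "integrable lborel F"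
  shows "integrable lborel (\<lambda>x. F x * \<phi> x)" "integrable lborel (\<lambda>x. F x * frechet_derivative \<phi> (at x) \<theta>)"
proof -
  obtain B where B: "\<And>x. \<bar>\<phi> x\<bar> \<le> B" "\<And>x. \<bar>frechet_derivative \<phi> (at x) \<theta>\<bar> \<le> B"
    using Cc_infinity_bounded[OF assms(1)] by metis
  show "integrable lborel (\<lambda>x. F x * \<phi> x)"
    by (rule integrable_mult_bounded[OF assms(2) _ B(1)]) (simp add: Cc_infinity_borel[OF assms(1)])
  show "integrable lborel (\<lambda>x. F x * frechet_derivative \<phi> (at x) \<theta>)"
    by (rule integrable_mult_bounded[OF assms(2) _ B(2)]) (simp add: Cc_infinity_borel[OF assms(1)])
qed

lemma Cc_infinity_eq_0: "\<phi> \<in> Cc_infinity \<Omega> \<Longrightarrow> x \<notin> \<Omega> \<Longrightarrow> \<phi> x = 0"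
  using closure_subset[of "{x. \<phi> x \<noteq> 0}"] by (auto simp: Cc_infinity_def)

lemma frechet_derivative_shift:
  fixes f :: "'a::euclidean_space \<Rightarrow> real"
  assumes "\<And>x. f differentiable (at x)"
  shows "((\<lambda>x. f (x + c)) has_derivative frechet_derivative f (at (x + c))) (at x)"
    and "frechet_derivative (\<lambda>x. f (x + c)) (at x) = frechet_derivative f (at (x + c))"
proof -
  have "(f has_derivative frechet_derivative f (at (x + c))) (at (x + c))"
    using assms frechet_derivative_works by blast
  then show *: "((\<lambda>x. f (x + c)) has_derivative frechet_derivative f (at (x + c))) (at x)"
    by (rule has_derivative_compose[of "\<lambda>x. x + c" "\<lambda>h. h", rotated])
      (auto intro!: derivative_eq_intros)
  then show "frechet_derivative (\<lambda>x. f (x + c)) (at x) = frechet_derivative f (at (x + c))"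
    by (metis frechet_derivative_at)
qed

lemma C_k_shift: "C_k k f \<Longrightarrow> C_k k (\<lambda>x. f (x + c))"
proof (induction k arbitrary: f)
  case 0
  then show ?case by (auto intro!: continuous_on_compose2[of UNIV f] continuous_intros)
next
  case (Suc k)
  then show ?case
    using frechet_derivative_shift[of f c] Suc.IH[of "\<lambda>x. frechet_derivative f (at x) b" for b]
    by (auto simp: differentiable_def)
qed

lemma Cc_infinity_shift:
  assumes \<phi>: "\<phi> \<in> Cc_infinity S" and sub: "\<And>x. x \<in> S \<Longrightarrow> x - c \<in> \<Omega>"
  shows "(\<lambda>x. \<phi> (x + c)) \<in> Cc_infinity \<Omega>"
    and "frechet_derivative (\<lambda>x. \<phi> (x + c)) (at x) = frechet_derivative \<phi> (at (x + c))"
proof -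
  let ?K = "closure {x. \<phi> x \<noteq> 0}"
  have K: "compact ?K" "?K \<subseteq> S" using \<phi> by (auto simp: Cc_infinity_def)
  have "{x. \<phi> (x + c) \<noteq> 0} = (\<lambda>x. x - c) ` {x. \<phi> x \<noteq> 0}"
    by (auto simp: image_iff, rule_tac x="x + c" in exI, simp)
  then have "closure {x. \<phi> (x + c) \<noteq> 0} = (\<lambda>x. x - c) ` ?K"
    using closure_translation[of "-c" "{x. \<phi> x \<noteq> 0}"] by simp
  moreover have "compact ((\<lambda>x. x - c) ` ?K)"
    using compact_translation[OF K(1), of "-c"] by simp
  moreover have "C_k k (\<lambda>x. \<phi> (x + c))" for k
    using \<phi> by (intro C_k_shift) (simp add: Cc_infinity_def)
  ultimately show "(\<lambda>x. \<phi> (x + c)) \<in> Cc_infinity \<Omega>"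
    using K sub unfolding Cc_infinity_def mem_Collect_eq by (metis image_subset_iff subset_iff)
  show "frechet_derivative (\<lambda>x. \<phi> (x + c)) (at x) = frechet_derivative \<phi> (at (x + c))"
    using Cc_infinity_differentiable[OF \<phi>]
    by (intro frechet_derivative_shift) (auto simp: differentiable_def)
qed

text \<open>
  The chain rule along a line: it reduces facts about test functions on the Euclidean space to
  calculus in one real variable.
\<close>

lemma Cc_infinity_derivative_along_line:
  assumes "\<phi> \<in> Cc_infinity \<Omega>"
  shows "((\<lambda>t. \<phi> (x + t *\<^sub>R \<theta>)) has_real_derivative frechet_derivative \<phi> (at (x + t *\<^sub>R \<theta>)) \<theta>) (at t)"
proof -
  let ?D = "frechet_derivative \<phi> (at (x + t *\<^sub>R \<theta>))"
  have lin: "linear ?D"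
    using Cc_infinity_differentiable[OF assms] has_derivative_linear by blast
  have "((\<lambda>t. \<phi> (x + t *\<^sub>R \<theta>)) has_derivative (\<lambda>h. ?D (h *\<^sub>R \<theta>))) (at t)"
    by (rule has_derivative_compose[OF _ Cc_infinity_differentiable[OF assms]])
      (auto intro!: derivative_eq_intros)
  moreover have "(\<lambda>h. ?D (h *\<^sub>R \<theta>)) = (*) (?D \<theta>)"
    by (simp add: fun_eq_iff linear_cmul[OF lin] mult.commute)
  ultimately show ?thesis
    by (simp add: has_field_derivative_def)
qed

text \<open>
  Test the function with bumps that converge to the indicator of the box, by dominated convergence.
\<close>

lemma fundamental_lemma_box:
  fixes F :: "'a::euclidean_space \<Rightarrow> real"
  assumes F: "integrable lborel F"
    and test: "\<And>\<psi>. \<psi> \<in> Cc_infinity S \<Longrightarrow> (\<integral>x. F x * \<psi> x \<partial>lborel) = 0"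
    and sub: "cbox a b \<subseteq> S"
  shows "integral (cbox a b) F = 0"
proof -
  have [measurable]: "F \<in> borel_measurable borel" using F by auto
  have bm[measurable]: "bump (1 / real (Suc n)) a b \<in> borel_measurable borel" for n
    using Cc_infinity_continuous[OF bump_in_Cc_infinity[of "1 / real (Suc n)" a b UNIV]]
    by (intro borel_measurable_continuous_onI) auto
  have "(\<lambda>n. \<integral>x. F x * bump (1 / real (Suc n)) a b x \<partial>lborel)
      \<longlonglongrightarrow> (\<integral>x. F x * indicator (box a b) x \<partial>lborel)"
  proof (rule integral_dominated_convergence[where w="\<lambda>x. \<bar>F x\<bar>"])
    show "AE x in lborel. (\<lambda>n. F x * bump (1 / real (Suc n)) a b x) \<longlonglongrightarrow> F x * indicator (box a b) x"
      by (intro AE_I2 tendsto_mult tendsto_const bump_tendsto_indicator)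
    show "AE x in lborel. norm (F x * bump (1 / real (Suc n)) a b x) \<le> \<bar>F x\<bar>" for n
      using bump_bounds[of "1 / real (Suc n)" a b]
      by (intro AE_I2) (auto simp: abs_mult intro!: mult_left_le)
    show "(\<lambda>x. F x * bump (1 / real (Suc n)) a b x) \<in> borel_measurable lborel" for n
      using bm[of n] by measurable
  qed (use F in auto)
  moreover have "(\<integral>x. F x * bump (1 / real (Suc n)) a b x \<partial>lborel) = 0" for n
    by (intro test bump_in_Cc_infinity sub) auto
  ultimately have "(\<lambda>n::nat. 0) \<longlonglongrightarrow> (\<integral>x. F x * indicator (box a b) x \<partial>lborel)"
    by simp
  then have "(\<integral>x. F x * indicator (box a b) x \<partial>lborel) = 0"
    by (simp add: LIMSEQ_const_iff)
  moreover have "set_integrable lborel (box a b) F"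
    unfolding set_integrable_def by (intro integrable_mult_indicator F) simp
  then have "integral (box a b) F = (LINT x : box a b | lborel. F x)"
    using set_borel_integral_eq_integral(2) by metis
  ultimately have "integral (box a b) F = 0"
    by (simp add: set_lebesgue_integral_def mult.commute)
  then show ?thesis
    by (simp add: integral_open_interval)
qed

text \<open>
  The fundamental lemma of the calculus of variations. All integrals over small boxes vanish, and by
  Lebesgue's differentiation theorem the value at almost every point is a limit of averages over
  such boxes.
\<close>

lemma fundamental_lemma:
  fixes F :: "'a::euclidean_space \<Rightarrow> real"
  assumes F: "integrable lborel F" and S: "open S"
    and test: "\<And>\<psi>. \<psi> \<in> Cc_infinity S \<Longrightarrow> (\<integral>x. F x * \<psi> x \<partial>lborel) = 0"
  shows "AE x in lborel. x \<in> S \<longrightarrow> F x = 0"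
proof -
  have "F integrable_on cbox a b" for a b
    using integrable_on_lborel[OF F] by (rule integrable_on_subcbox) simp
  then obtain N where N: "negligible N" "\<And>x e. \<lbrakk>x \<notin> N; 0 < e\<rbrakk> \<Longrightarrow>
      \<exists>d>0. \<forall>h. 0 < h \<and> h < d \<longrightarrow>
        norm (integral (cbox x (x + h *\<^sub>R One)) F /\<^sub>R h ^ DIM('a) - F x) < e"
    using integrable_ccontinuous_explicit[of F] by blast
  have "F x = 0" if x: "x \<in> S" "x \<notin> N" for x
  proof (rule ccontr)
    assume "F x \<noteq> 0"
    then obtain d where d: "d > 0" "\<And>h. 0 < h \<Longrightarrow> h < d \<Longrightarrow>
        norm (integral (cbox x (x + h *\<^sub>R One)) F /\<^sub>R h ^ DIM('a) - F x) < \<bar>F x\<bar>"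
      using N(2)[OF x(2), of "\<bar>F x\<bar>"] by auto
    obtain e where e: "e > 0" "cball x e \<subseteq> S"
      using S x(1) open_contains_cball by blast
    \<comment> \<open>The cube of side \<open>h\<close> with corner \<open>x\<close> has \<open>l1\<close>-radius \<open>h * DIM\<close>, so it stays in \<open>cball x e\<close>.\<close>
    define h where "h = min (d / 2) (e / DIM('a))"
    have h: "0 < h" "h < d" "h * DIM('a) \<le> e"
      using d e by (auto simp: h_def min_def field_simps)
    have "cbox x (x + h *\<^sub>R One) \<subseteq> cball x e"
    proof
      fix z assume z: "z \<in> cbox x (x + h *\<^sub>R One)"
      have "norm (z - x) \<le> (\<Sum>b\<in>Basis. \<bar>(z - x) \<bullet> b\<bar>)" by (rule norm_le_l1)
      also have "\<dots> \<le> (\<Sum>b\<in>(Basis::'a set). h)"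
        using z by (intro sum_mono) (auto simp: mem_box inner_simps)
      also have "\<dots> \<le> e" using h by (simp add: mult.commute)
      finally show "z \<in> cball x e" by (simp add: dist_norm norm_minus_commute)
    qed
    then have "integral (cbox x (x + h *\<^sub>R One)) F = 0"
      using e by (intro fundamental_lemma_box[OF F test, of S]) auto
    then show False using d(2)[OF h(1,2)] by simp
  qed
  moreover have "AE x in lborel. x \<notin> N"
    using N(1) by (metis AE_completion_iff AE_not_in negligible_iff_null_sets)
  ultimately show ?thesis by (auto elim!: eventually_mono)
qed

section \<open>Integrals over segments\<close>

lemma AE_lborel_shift:
  fixes c :: "'a::euclidean_space"
  assumes "AE x in lborel. P x"
  shows "AE x in lborel. P (x + c)"
proof -
  have "AE x in distr lborel borel ((+) c). P x"
    using assms by (subst lborel_distr_plus)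
  from AE_distrD[OF _ this] show ?thesis by (simp add: add.commute)
qed

lemma integrable_lborel_shift:
  fixes F :: "'a::euclidean_space \<Rightarrow> real"
  assumes "integrable lborel F"
  shows "integrable lborel (\<lambda>x. F (x + c))"
proof -
  have "integrable (distr lborel borel ((+) c)) F"
    using assms by (simp add: lborel_distr_plus)
  from integrable_distr[OF _ this] show ?thesis by (simp add: add.commute)
qed

lemma integral_lborel_shift:
  fixes F :: "'a::euclidean_space \<Rightarrow> real"
  assumes [measurable]: "F \<in> borel_measurable borel"
  shows "(\<integral>x. F (x + c) \<partial>lborel) = (\<integral>x. F x \<partial>lborel)"
proof -
  have "(\<integral>x. F x \<partial>lborel) = (\<integral>x. F x \<partial>distr lborel borel ((+) c))"
    by (simp add: lborel_distr_plus)
  also have "\<dots> = (\<integral>x. F (c + x) \<partial>lborel)"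
    by (rule integral_distr) auto
  finally show ?thesis by (simp add: add.commute)
qed

lemma nn_integral_lborel_shift:
  fixes F :: "'a::euclidean_space \<Rightarrow> ennreal"
  assumes [measurable]: "F \<in> borel_measurable borel"
  shows "(\<integral>\<^sup>+x. F (x + c) \<partial>lborel) = (\<integral>\<^sup>+x. F x \<partial>lborel)"
proof -
  have "(\<integral>\<^sup>+x. F x \<partial>lborel) = (\<integral>\<^sup>+x. F x \<partial>distr lborel borel ((+) c))"
    by (simp add: lborel_distr_plus)
  also have "\<dots> = (\<integral>\<^sup>+x. F (c + x) \<partial>lborel)"
    by (rule nn_integral_distr) auto
  finally show ?thesis by (simp add: add.commute)
qed

text \<open>
  The integral of \<open>V\<close> over the segment from \<open>x\<close> to \<open>x + h \<theta>\<close>, for \<open>h \<ge> 0\<close>. It is written with an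
  indicator on the whole line, which suits both the measurability prover and Fubini's theorem.
\<close>

definition seg_integral :: "'a::euclidean_space \<Rightarrow> ('a \<Rightarrow> real) \<Rightarrow> real \<Rightarrow> 'a \<Rightarrow> real" where
  "seg_integral \<theta> V h x = (\<integral>t. (if 0 \<le> t \<and> t \<le> h then V (x + t *\<^sub>R \<theta>) else 0) \<partial>lborel)"

lemma borel_measurable_seg_integral [measurable (raw)]:
  assumes [measurable]: "V \<in> borel_measurable borel" "h \<in> borel_measurable M" "g \<in> M \<rightarrow>\<^sub>M borel"
  shows "(\<lambda>x. seg_integral \<theta> V (h x) (g x)) \<in> borel_measurable M"
  unfolding seg_integral_def by measurable

text \<open>
  Translations preserve Lebesgue measure, so the integral over \<open>x\<close> is the same for every \<open>t\<close> in
  \<open>{0..h}\<close>, and the double integral is at most \<open>h\<close> times the norm of \<open>V\<close>. The bounded weight \<open>g\<close>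
  serves as test function.
\<close>

lemma integrable_segment_family:
  fixes V :: "'a::euclidean_space \<Rightarrow> real"
  assumes V: "integrable lborel V"
    and g[measurable]: "case_prod g \<in> borel_measurable borel" and B: "\<And>x t. \<bar>g x t\<bar> \<le> B"
  shows "integrable (lborel \<Otimes>\<^sub>M lborel)
           (\<lambda>(x, t). if 0 \<le> t \<and> t \<le> h then V (x + t *\<^sub>R \<theta>) * g x t else 0)"
proof -
  have [measurable]: "V \<in> borel_measurable borel" using V by auto
  have g'[measurable]: "case_prod g \<in> borel_measurable (borel \<Otimes>\<^sub>M borel)"
    using g by (simp add: borel_prod)
  have [measurable]: "(\<lambda>(x, t). if 0 \<le> t \<and> t \<le> h then V (x + t *\<^sub>R \<theta>) else 0) \<in> borel_measurable (lborel \<Otimes>\<^sub>M lborel)"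
    by measurable
  have "integrable (lborel \<Otimes>\<^sub>M lborel) (\<lambda>(x, t). if 0 \<le> t \<and> t \<le> h then V (x + t *\<^sub>R \<theta>) else 0)"
  proof (rule integrableI_bounded)
    have "(\<integral>\<^sup>+p. ennreal (norm (case p of (x, t) \<Rightarrow> if 0 \<le> t \<and> t \<le> h then V (x + t *\<^sub>R \<theta>) else 0)) \<partial>(lborel \<Otimes>\<^sub>M lborel))
      = (\<integral>\<^sup>+t. \<integral>\<^sup>+x. ennreal (norm (if 0 \<le> t \<and> t \<le> h then V (x + t *\<^sub>R \<theta>) else 0)) \<partial>lborel \<partial>lborel)"
      by (subst lborel_pair.nn_integral_snd[symmetric]) (simp_all add: split_beta' cong: if_cong)
    also have "\<dots> = (\<integral>\<^sup>+t. (\<integral>\<^sup>+x. ennreal (norm (V x)) \<partial>lborel) * indicator {0..h} t \<partial>lborel)"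
    proof (intro nn_integral_cong)
      fix t :: real
      have "(\<integral>\<^sup>+x. ennreal (norm (V (x + t *\<^sub>R \<theta>))) \<partial>lborel) = (\<integral>\<^sup>+x. ennreal (norm (V x)) \<partial>lborel)"
        by (rule nn_integral_lborel_shift) simp
      then show "(\<integral>\<^sup>+x. ennreal (norm (if 0 \<le> t \<and> t \<le> h then V (x + t *\<^sub>R \<theta>) else 0)) \<partial>lborel)
        = (\<integral>\<^sup>+x. ennreal (norm (V x)) \<partial>lborel) * indicator {0..h} t"
        by (auto simp: indicator_def)
    qed
    also have "\<dots> < \<infinity>"
      using V by (auto simp: nn_integral_cmult integrable_iff_bounded emeasure_lborel_Icc_eq ennreal_mult_less_top)
    finally show "(\<integral>\<^sup>+p. ennreal (norm (case p of (x, t) \<Rightarrow> if 0 \<le> t \<and> t \<le> h then V (x + t *\<^sub>R \<theta>) else 0)) \<partial>(lborel \<Otimes>\<^sub>M lborel)) < \<infinity>" .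
  qed measurable
  then have "integrable (lborel \<Otimes>\<^sub>M lborel)
      (\<lambda>p. B * (case p of (x, t) \<Rightarrow> if 0 \<le> t \<and> t \<le> h then V (x + t *\<^sub>R \<theta>) else 0))"
    by (rule integrable_mult_right)
  then show ?thesis
  proof (rule Bochner_Integration.integrable_bound)
    have "0 \<le> B" using B[of undefined undefined] by linarith
    then show "AE p in lborel \<Otimes>\<^sub>M lborel. norm (case p of (x, t) \<Rightarrow> if 0 \<le> t \<and> t \<le> h then V (x + t *\<^sub>R \<theta>) * g x t else 0)
      \<le> norm (B * (case p of (x, t) \<Rightarrow> if 0 \<le> t \<and> t \<le> h then V (x + t *\<^sub>R \<theta>) else 0))"
      using B by (intro AE_I2) (auto simp: abs_mult mult.commute[of B] intro!: mult_left_mono split: prod.splits)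
  qed measurable
qed

text \<open>
  Fubini, and a translation in the inner integral, move the segment from the integrand to the test
  function.
\<close>

lemma integrable_weighted_segment:
  fixes V :: "'a::euclidean_space \<Rightarrow> real"
  assumes V: "integrable lborel V" and \<phi>[measurable]: "\<phi> \<in> borel_measurable borel" and B: "\<And>x. \<bar>\<phi> x\<bar> \<le> B"
  shows "integrable lborel (\<lambda>x. seg_integral \<theta> V h x * \<phi> x)"
    and "integrable lborel (\<lambda>t. if 0 \<le> t \<and> t \<le> h then (\<integral>x. V x * \<phi> (x - t *\<^sub>R \<theta>) \<partial>lborel) else 0)"
    and "(\<integral>x. seg_integral \<theta> V h x * \<phi> x \<partial>lborel)
      = (\<integral>t. (if 0 \<le> t \<and> t \<le> h then (\<integral>x. V x * \<phi> (x - t *\<^sub>R \<theta>) \<partial>lborel) else 0) \<partial>lborel)"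
proof -
  have [measurable]: "V \<in> borel_measurable borel" using V by auto
  have int: "integrable (lborel \<Otimes>\<^sub>M lborel)
           (\<lambda>(x, t). if 0 \<le> t \<and> t \<le> h then V (x + t *\<^sub>R \<theta>) * \<phi> x else 0)"
    by (rule integrable_segment_family[OF V _ B, of "\<lambda>x t. x"]) (simp add: borel_prod[symmetric])
  have eq: "(\<integral>t. (if 0 \<le> t \<and> t \<le> h then V (x + t *\<^sub>R \<theta>) * \<phi> x else 0) \<partial>lborel) = seg_integral \<theta> V h x * \<phi> x" for x
  proof -
    have "(\<lambda>t. if 0 \<le> t \<and> t \<le> h then V (x + t *\<^sub>R \<theta>) * \<phi> x else 0)
      = (\<lambda>t. (if 0 \<le> t \<and> t \<le> h then V (x + t *\<^sub>R \<theta>) else 0) * \<phi> x)" by auto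
    then show ?thesis by (simp only: seg_integral_def integral_mult_left_zero)
  qed
  show "integrable lborel (\<lambda>x. seg_integral \<theta> V h x * \<phi> x)"
    using lborel_pair.integrable_fst[OF int] by (simp add: eq)
  have inner: "(\<integral>x. (if 0 \<le> t \<and> t \<le> h then V (x + t *\<^sub>R \<theta>) * \<phi> x else 0) \<partial>lborel)
      = (if 0 \<le> t \<and> t \<le> h then (\<integral>x. V x * \<phi> (x - t *\<^sub>R \<theta>) \<partial>lborel) else 0)" for t :: real
  proof -
    have "(\<integral>x. V (x + t *\<^sub>R \<theta>) * \<phi> x \<partial>lborel) = (\<integral>x. V x * \<phi> (x - t *\<^sub>R \<theta>) \<partial>lborel)"
      using integral_lborel_shift[of "\<lambda>x. V x * \<phi> (x - t *\<^sub>R \<theta>)" "t *\<^sub>R \<theta>"] by simp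
    then show ?thesis by auto
  qed
  show "integrable lborel (\<lambda>t. if 0 \<le> t \<and> t \<le> h then (\<integral>x. V x * \<phi> (x - t *\<^sub>R \<theta>) \<partial>lborel) else 0)"
    using lborel_pair.integrable_snd[OF int] by (simp only: inner)
  show "(\<integral>x. seg_integral \<theta> V h x * \<phi> x \<partial>lborel)
    = (\<integral>t. (if 0 \<le> t \<and> t \<le> h then (\<integral>x. V x * \<phi> (x - t *\<^sub>R \<theta>) \<partial>lborel) else 0) \<partial>lborel)"
    using lborel_pair.Fubini_integral[OF int] by (simp only: eq inner)
qed

lemma integrable_seg_integral:
  assumes "integrable lborel V"
  shows "integrable lborel (\<lambda>x. seg_integral \<theta> V h x)" "AE x in lborel. integrable lborel (\<lambda>t. if 0 \<le> t \<and> t \<le> h then V (x + t *\<^sub>R \<theta>) else 0)"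
    "0 \<le> h \<Longrightarrow> (\<integral>x. seg_integral \<theta> V h x \<partial>lborel) = h * (\<integral>x. V x \<partial>lborel)"
proof -
  show "integrable lborel (\<lambda>x. seg_integral \<theta> V h x)"
    using integrable_weighted_segment(1)[OF assms, of "\<lambda>_. 1" 1] by simp
  have "integrable (lborel \<Otimes>\<^sub>M lborel) (\<lambda>(x, t). if 0 \<le> t \<and> t \<le> h then V (x + t *\<^sub>R \<theta>) * 1 else 0)"
    by (rule integrable_segment_family[OF assms, of "\<lambda>_ _. 1" 1]) auto
  from lborel_pair.AE_integrable_fst[OF this]
  show "AE x in lborel. integrable lborel (\<lambda>t. if 0 \<le> t \<and> t \<le> h then V (x + t *\<^sub>R \<theta>) else 0)"
    by (elim eventually_mono) (simp cong: if_cong)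
  have *: "(\<lambda>t::real. if 0 \<le> t \<and> t \<le> h then (\<integral>x. V x \<partial>lborel) else 0)
      = (\<lambda>t. indicator {0..h} t * (\<integral>x. V x \<partial>lborel))" by (auto simp: indicator_def)
  show "(\<integral>x. seg_integral \<theta> V h x \<partial>lborel) = h * (\<integral>x. V x \<partial>lborel)" if "0 \<le> h"
    using integrable_weighted_segment(3)[OF assms, of "\<lambda>_. 1" 1 \<theta> h] that
    unfolding mult_1_right * by simp
qed

section \<open>Weak derivatives and increments\<close>

text \<open>
  The complement is the sum of a closed set and a compact segment.
\<close>

lemma open_segments_inside:
  fixes \<Omega> :: "'a::euclidean_space set"
  assumes "open \<Omega>"
  shows "open {x. \<forall>t\<in>{0..h}. x + t *\<^sub>R \<theta> \<in> \<Omega>}"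
proof -
  have "compact ((\<lambda>t. t *\<^sub>R \<theta>) ` {0..h})"
    by (intro compact_continuous_image continuous_intros) simp
  moreover have "closed (- \<Omega>)" using assms by auto
  ultimately have "closed (\<Union>x\<in>- \<Omega>. \<Union>y\<in>(\<lambda>t. t *\<^sub>R \<theta>) ` {0..h}. {x - y})"
    by (intro closed_compact_differences)
  moreover have "(\<Union>x\<in>- \<Omega>. \<Union>y\<in>(\<lambda>t. t *\<^sub>R \<theta>) ` {0..h}. {x - y}) = - {x. \<forall>t\<in>{0..h}. x + t *\<^sub>R \<theta> \<in> \<Omega>}"
    by (force simp: image_iff)
  ultimately show ?thesis by (simp only: closed_def double_complement)
qed

text \<open>
  The fundamental theorem of calculus, in the backward direction in which test functions are shifted.
\<close>

lemma Cc_infinity_increment: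
  assumes "\<phi> \<in> Cc_infinity \<Omega>" "0 \<le> h"
  shows "seg_integral (- \<theta>) (\<lambda>x. frechet_derivative \<phi> (at x) \<theta>) h x = \<phi> x - \<phi> (x - h *\<^sub>R \<theta>)"
proof -
  let ?D = "\<lambda>x. frechet_derivative \<phi> (at x) \<theta>"
  have der: "((\<lambda>t. - \<phi> (x - t *\<^sub>R \<theta>)) has_real_derivative ?D (x - t *\<^sub>R \<theta>)) (at t)" for t
  proof -
    have "((\<lambda>t. \<phi> (x + t *\<^sub>R \<theta>)) has_real_derivative ?D (x + (- t) *\<^sub>R \<theta>)) (at (- t))"
      by (rule Cc_infinity_derivative_along_line[OF assms(1)])
    then have "((\<lambda>t. \<phi> (x + (- t) *\<^sub>R \<theta>)) has_real_derivative ?D (x + (- t) *\<^sub>R \<theta>) * (- 1)) (at t)"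
      by (rule DERIV_chain2) (auto intro!: derivative_eq_intros)
    then have "((\<lambda>t. - \<phi> (x + (- t) *\<^sub>R \<theta>)) has_real_derivative - (?D (x + (- t) *\<^sub>R \<theta>) * (- 1))) (at t)"
      by (rule DERIV_minus)
    then show ?thesis by simp
  qed
  have "continuous_on UNIV (\<lambda>t. ?D (x - t *\<^sub>R \<theta>))"
    by (rule continuous_on_compose2[OF Cc_infinity_derivative_continuous[OF assms(1), of UNIV]])
      (auto intro!: continuous_intros)
  then have cont: "isCont (\<lambda>t. ?D (x - t *\<^sub>R \<theta>)) t" for t
    by (simp add: continuous_on_eq_continuous_at)
  have "(\<integral>t. ?D (x - t *\<^sub>R \<theta>) * indicator {0 .. h} t \<partial>lborel) = (- \<phi> (x - h *\<^sub>R \<theta>)) - (- \<phi> (x - 0 *\<^sub>R \<theta>))"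
    using der cont by (intro integral_FTC_Icc_real assms(2)) auto
  moreover have "(\<lambda>t. ?D (x - t *\<^sub>R \<theta>) * indicator {0 .. h} t) = (\<lambda>t. if 0 \<le> t \<and> t \<le> h then ?D (x + t *\<^sub>R (- \<theta>)) else 0)"
    by (auto simp: indicator_def)
  ultimately show ?thesis by (simp add: seg_integral_def)
qed

text \<open>
  A weak derivative in direction \<open>\<theta>\<close> gives the fundamental theorem of calculus for the step \<open>h\<close>, at
  almost every \<open>x\<close> whose segment lies in \<open>\<Omega>\<close>. Indeed a test function \<open>\<psi>\<close> on the set of such
  \<open>x\<close> can be shifted along the whole segment without leaving \<open>\<Omega>\<close>; testing the definition of the weak
  derivative with the shifted functions and integrating over the shift, one finds that the defect of
  the identity is orthogonal to \<open>\<psi>\<close>. The statement is free of test functions, and can be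
  restricted to lines.
\<close>

lemma weak_derivative_imp_increment:
  fixes U V :: "'a::euclidean_space \<Rightarrow> real"
  assumes \<Omega>: "open \<Omega>" and U: "integrable lborel U" and V: "integrable lborel V"
    and wd: "\<And>\<phi>. \<phi> \<in> Cc_infinity \<Omega> \<Longrightarrow>
      (\<integral>x. U x * frechet_derivative \<phi> (at x) \<theta> \<partial>lborel) = - (\<integral>x. V x * \<phi> x \<partial>lborel)"
    and h: "0 \<le> h"
  shows "AE x in lborel. (\<forall>t\<in>{0..h}. x + t *\<^sub>R \<theta> \<in> \<Omega>) \<longrightarrow> U (x + h *\<^sub>R \<theta>) - U x = seg_integral \<theta> V h x"
proof -
  have [measurable]: "U \<in> borel_measurable borel" "V \<in> borel_measurable borel" using U V by auto
  let ?S = "{x. \<forall>t\<in>{0..h}. x + t *\<^sub>R \<theta> \<in> \<Omega>}"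
  have "AE x in lborel. x \<in> ?S \<longrightarrow> U (x + h *\<^sub>R \<theta>) - U x - seg_integral \<theta> V h x = 0"
  proof (rule fundamental_lemma[OF _ open_segments_inside[OF \<Omega>]])
    show "integrable lborel (\<lambda>x. U (x + h *\<^sub>R \<theta>) - U x - seg_integral \<theta> V h x)"
      using U V by (intro Bochner_Integration.integrable_diff integrable_lborel_shift integrable_seg_integral)
    fix \<psi> assume \<psi>: "\<psi> \<in> Cc_infinity ?S"
    let ?D = "\<lambda>x. frechet_derivative \<psi> (at x) \<theta>"
    obtain B where B: "B > 0" "\<And>x. \<bar>\<psi> x\<bar> \<le> B" "\<And>x. \<bar>?D x\<bar> \<le> B"
      using Cc_infinity_bounded[OF \<psi>] by metis
    have [measurable]: "\<psi> \<in> borel_measurable borel" "?D \<in> borel_measurable borel"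
      using Cc_infinity_continuous[OF \<psi>] Cc_infinity_derivative_continuous[OF \<psi>]
      by (auto intro: borel_measurable_continuous_onI)
    \<comment> \<open>The translate is a test function on \<open>\<Omega>\<close>: segments that start in the support of \<open>\<psi>\<close> stay in \<open>\<Omega>\<close>.\<close>
    have shifted: "(\<integral>x. V x * \<psi> (x - t *\<^sub>R \<theta>) \<partial>lborel) = - (\<integral>x. U x * ?D (x - t *\<^sub>R \<theta>) \<partial>lborel)"
      if "0 \<le> t" "t \<le> h" for t
    proof -
      have *: "(\<lambda>x. \<psi> (x + (- (t *\<^sub>R \<theta>)))) \<in> Cc_infinity \<Omega>"
        "\<And>x. frechet_derivative (\<lambda>x. \<psi> (x + (- (t *\<^sub>R \<theta>)))) (at x) = frechet_derivative \<psi> (at (x + (- (t *\<^sub>R \<theta>))))"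
        by (rule Cc_infinity_shift[OF \<psi>]; use that in auto)+
      show ?thesis using wd[OF *(1)] unfolding *(2) by simp
    qed
    have "(\<integral>x. seg_integral \<theta> V h x * \<psi> x \<partial>lborel)
      = (\<integral>t. (if 0 \<le> t \<and> t \<le> h then (\<integral>x. V x * \<psi> (x - t *\<^sub>R \<theta>) \<partial>lborel) else 0) \<partial>lborel)"
      by (rule integrable_weighted_segment(3)[OF V _ B(2)]) simp
    also have "(\<lambda>t. if 0 \<le> t \<and> t \<le> h then (\<integral>x. V x * \<psi> (x - t *\<^sub>R \<theta>) \<partial>lborel) else 0)
      = (\<lambda>t. - (if 0 \<le> t \<and> t \<le> h then (\<integral>x. U x * ?D (x - t *\<^sub>R \<theta>) \<partial>lborel) else 0))"
      by (auto simp: shifted fun_eq_iff)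
    also have "(\<integral>t. - (if 0 \<le> t \<and> t \<le> h then (\<integral>x. U x * ?D (x - t *\<^sub>R \<theta>) \<partial>lborel) else 0) \<partial>lborel)
      = - (\<integral>t. (if 0 \<le> t \<and> t \<le> h then (\<integral>x. U x * ?D (x - t *\<^sub>R \<theta>) \<partial>lborel) else 0) \<partial>lborel)"
      by (rule Bochner_Integration.integral_minus)
    also have "(\<integral>t. (if 0 \<le> t \<and> t \<le> h then (\<integral>x. U x * ?D (x - t *\<^sub>R \<theta>) \<partial>lborel) else 0) \<partial>lborel)
      = (\<integral>t. (\<integral>x. (if 0 \<le> t \<and> t \<le> h then U x * ?D (x - t *\<^sub>R \<theta>) else 0) \<partial>lborel) \<partial>lborel)"
      by (intro Bochner_Integration.integral_cong) auto
    also have "\<dots> = (\<integral>x. (\<integral>t. (if 0 \<le> t \<and> t \<le> h then U x * ?D (x - t *\<^sub>R \<theta>) else 0) \<partial>lborel) \<partial>lborel)"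
    proof (rule lborel_pair.Fubini_integral)
      have "integrable (lborel \<Otimes>\<^sub>M lborel)
           (\<lambda>(x, t). if 0 \<le> t \<and> t \<le> h then U (x + t *\<^sub>R 0) * ?D (x - t *\<^sub>R \<theta>) else 0)"
        by (rule integrable_segment_family[OF U _ B(3), of "\<lambda>x t. x - t *\<^sub>R \<theta>"]) (simp add: borel_prod[symmetric])
      then show "integrable (lborel \<Otimes>\<^sub>M lborel) (\<lambda>(x, t). if 0 \<le> t \<and> t \<le> h then U x * ?D (x - t *\<^sub>R \<theta>) else 0)"
        by (simp cong: if_cong)
    qed
    also have "\<dots> = (\<integral>x. U x * (\<psi> x - \<psi> (x - h *\<^sub>R \<theta>)) \<partial>lborel)"
    proof (intro Bochner_Integration.integral_cong refl)
      fix x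
      have "(\<integral>t. (if 0 \<le> t \<and> t \<le> h then U x * ?D (x - t *\<^sub>R \<theta>) else 0) \<partial>lborel)
        = (\<integral>t. U x * (if 0 \<le> t \<and> t \<le> h then ?D (x + t *\<^sub>R (- \<theta>)) else 0) \<partial>lborel)"
        by (intro Bochner_Integration.integral_cong) auto
      also have "\<dots> = U x * (\<psi> x - \<psi> (x - h *\<^sub>R \<theta>))"
        using Cc_infinity_increment[OF \<psi> h, of \<theta> x] by (simp add: seg_integral_def)
      finally show "(\<integral>t. (if 0 \<le> t \<and> t \<le> h then U x * ?D (x - t *\<^sub>R \<theta>) else 0) \<partial>lborel)
        = U x * (\<psi> x - \<psi> (x - h *\<^sub>R \<theta>))" .
    qed
    also have "\<dots> = (\<integral>x. U x * \<psi> x - U x * \<psi> (x - h *\<^sub>R \<theta>) \<partial>lborel)"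
      by (simp add: right_diff_distrib)
    also have "\<dots> = (\<integral>x. U x * \<psi> x \<partial>lborel) - (\<integral>x. U x * \<psi> (x - h *\<^sub>R \<theta>) \<partial>lborel)"
      by (intro Bochner_Integration.integral_diff integrable_mult_bounded[where B=B] U B) auto
    also have "(\<integral>x. U x * \<psi> (x - h *\<^sub>R \<theta>) \<partial>lborel) = (\<integral>x. U (x + h *\<^sub>R \<theta>) * \<psi> x \<partial>lborel)"
      using integral_lborel_shift[of "\<lambda>x. U x * \<psi> (x - h *\<^sub>R \<theta>)" "h *\<^sub>R \<theta>"] by simp
    finally have eq: "(\<integral>x. seg_integral \<theta> V h x * \<psi> x \<partial>lborel)
      = (\<integral>x. U (x + h *\<^sub>R \<theta>) * \<psi> x \<partial>lborel) - (\<integral>x. U x * \<psi> x \<partial>lborel)" by simp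
    have "(\<integral>x. (U (x + h *\<^sub>R \<theta>) - U x - seg_integral \<theta> V h x) * \<psi> x \<partial>lborel)
      = (\<integral>x. U (x + h *\<^sub>R \<theta>) * \<psi> x - U x * \<psi> x - seg_integral \<theta> V h x * \<psi> x \<partial>lborel)"
      by (simp add: left_diff_distrib)
    also have "\<dots> = (\<integral>x. U (x + h *\<^sub>R \<theta>) * \<psi> x \<partial>lborel) - (\<integral>x. U x * \<psi> x \<partial>lborel) - (\<integral>x. seg_integral \<theta> V h x * \<psi> x \<partial>lborel)"
      by (subst Bochner_Integration.integral_diff Bochner_Integration.integral_diff;
          (intro Bochner_Integration.integrable_diff integrable_mult_bounded[where B=B] B U integrable_lborel_shift integrable_seg_integral V)?; simp?)+
    finally show "(\<integral>x. (U (x + h *\<^sub>R \<theta>) - U x - seg_integral \<theta> V h x) * \<psi> x \<partial>lborel) = 0"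
      using eq by simp
  qed
  then show ?thesis by (elim eventually_mono) auto
qed

lemma Cc_infinity_lipschitz:
  assumes "\<phi> \<in> Cc_infinity \<Omega>" "\<And>x. \<bar>frechet_derivative \<phi> (at x) \<theta>\<bar> \<le> B"
  shows "\<bar>\<phi> (x + t *\<^sub>R \<theta>) - \<phi> x\<bar> \<le> B * \<bar>t\<bar>"
proof -
  have "norm (\<phi> (x + t *\<^sub>R \<theta>) - \<phi> (x + 0 *\<^sub>R \<theta>)) \<le> B * norm (t - 0)"
    using assms(2) Cc_infinity_derivative_along_line[OF assms(1)]
    by (intro field_differentiable_bound[OF convex_UNIV, of "\<lambda>t. \<phi> (x + t *\<^sub>R \<theta>)"
          "\<lambda>t. frechet_derivative \<phi> (at (x + t *\<^sub>R \<theta>)) \<theta>"]) auto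
  then show ?thesis by simp
qed

text \<open>
  Conversely the increments determine the weak derivative. Multiplying by a test function and
  dividing by the step puts a difference quotient on the test function; as the step tends to \<open>0\<close> the
  two sides converge to the two sides of the definition. Countably many steps suffice, which matters
  when the increments are known only almost everywhere on almost every line.
\<close>

lemma increment_imp_weak_derivative:
  fixes U V :: "'a::euclidean_space \<Rightarrow> real"
  assumes \<Omega>: "open \<Omega>" and U: "integrable lborel U" and V: "integrable lborel V"
    and inc: "\<And>n. AE x in lborel. (\<forall>t\<in>{0..1 / real (Suc n)}. x + t *\<^sub>R \<theta> \<in> \<Omega>) \<longrightarrow>
      U (x + (1 / real (Suc n)) *\<^sub>R \<theta>) - U x = seg_integral \<theta> V (1 / real (Suc n)) x"
    and \<phi>: "\<phi> \<in> Cc_infinity \<Omega>"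
  shows "(\<integral>x. U x * frechet_derivative \<phi> (at x) \<theta> \<partial>lborel) = - (\<integral>x. V x * \<phi> x \<partial>lborel)"
proof -
  let ?D = "\<lambda>x. frechet_derivative \<phi> (at x) \<theta>"
  let ?h = "\<lambda>n. 1 / real (Suc n)"
  have h0: "?h \<longlonglongrightarrow> 0"
    using LIMSEQ_inverse_real_of_nat by (simp add: inverse_eq_divide)
  have [measurable]: "U \<in> borel_measurable borel" "V \<in> borel_measurable borel" using U V by auto
  obtain B where B: "B > 0" "\<And>x. \<bar>\<phi> x\<bar> \<le> B" "\<And>x. \<bar>?D x\<bar> \<le> B"
    using Cc_infinity_bounded[OF \<phi>] by metis
  have [measurable]: "\<phi> \<in> borel_measurable borel" "?D \<in> borel_measurable borel"
    using Cc_infinity_continuous[OF \<phi>] Cc_infinity_derivative_continuous[OF \<phi>]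
    by (auto intro: borel_measurable_continuous_onI)
  note Lip = Cc_infinity_lipschitz[OF \<phi> B(3)]
  have Lip': "\<bar>\<phi> (x - t *\<^sub>R \<theta>) - \<phi> x\<bar> \<le> B * \<bar>t\<bar>" for x t
    using Lip[of x "- t"] by simp
  let ?K = "closure {x. \<phi> x \<noteq> 0}"
  have K: "compact ?K" "?K \<subseteq> \<Omega>" using \<phi> by (auto simp: Cc_infinity_def)
  \<comment> \<open>For small steps all segments that start in the support of \<open>\<phi>\<close> lie in \<open>\<Omega>\<close>.\<close>
  obtain e where e: "e > 0" "(\<Union>x\<in>?K. ball x e) \<subseteq> \<Omega>"
    using compact_subset_open_imp_ball_epsilon_subset[OF K(1) \<Omega> K(2)] by metis
  have "(\<lambda>n. ?h n * norm \<theta>) \<longlonglongrightarrow> 0 * norm \<theta>"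
    by (intro tendsto_mult h0 tendsto_const)
  then have "eventually (\<lambda>n. ?h n * norm \<theta> < e) sequentially"
    using e(1) by (intro order_tendstoD(2)) auto
  then have ev: "eventually (\<lambda>n. (\<integral>x. U x * ((\<phi> (x - ?h n *\<^sub>R \<theta>) - \<phi> x) / ?h n) \<partial>lborel)
      = (\<integral>x. seg_integral \<theta> V (?h n) x * \<phi> x \<partial>lborel) / ?h n) sequentially"
  proof eventually_elim
    case (elim n)
    let ?H = "?h n"
    have "0 \<le> ?H" by simp
    have "AE x in lborel. seg_integral \<theta> V ?H x * \<phi> x = (U (x + ?H *\<^sub>R \<theta>) - U x) * \<phi> x"
      using inc[of n]
    proof eventually_elim
      fix x assume x: "(\<forall>t\<in>{0..?H}. x + t *\<^sub>R \<theta> \<in> \<Omega>) \<longrightarrow> U (x + ?H *\<^sub>R \<theta>) - U x = seg_integral \<theta> V ?H x"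
      show "seg_integral \<theta> V ?H x * \<phi> x = (U (x + ?H *\<^sub>R \<theta>) - U x) * \<phi> x"
      proof (cases "\<phi> x = 0")
        case False
        then have "x \<in> ?K" using closure_subset[of "{x. \<phi> x \<noteq> 0}"] by auto
        moreover have "x + t *\<^sub>R \<theta> \<in> ball x e" if "t \<in> {0..?H}" for t
        proof -
          have "norm (t *\<^sub>R \<theta>) \<le> ?H * norm \<theta>"
            unfolding norm_scaleR using that by (intro mult_right_mono) auto
          with elim show ?thesis by (simp add: dist_norm)
        qed
        ultimately have "\<forall>t\<in>{0..?H}. x + t *\<^sub>R \<theta> \<in> \<Omega>" using e(2) by blast
        with x show ?thesis by simp
      qed simp
    qed
    then have "(\<integral>x. seg_integral \<theta> V ?H x * \<phi> x \<partial>lborel) = (\<integral>x. (U (x + ?H *\<^sub>R \<theta>) - U x) * \<phi> x \<partial>lborel)"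
      by (intro integral_cong_AE) auto
    also have "\<dots> = (\<integral>x. U (x + ?H *\<^sub>R \<theta>) * \<phi> x - U x * \<phi> x \<partial>lborel)"
      by (simp only: left_diff_distrib)
    also have "\<dots> = (\<integral>x. U (x + ?H *\<^sub>R \<theta>) * \<phi> x \<partial>lborel) - (\<integral>x. U x * \<phi> x \<partial>lborel)"
      by (intro Bochner_Integration.integral_diff integrable_mult_bounded[where B=B] B U integrable_lborel_shift) auto
    also have "(\<integral>x. U (x + ?H *\<^sub>R \<theta>) * \<phi> x \<partial>lborel) = (\<integral>x. U x * \<phi> (x - ?H *\<^sub>R \<theta>) \<partial>lborel)"
      using integral_lborel_shift[of "\<lambda>x. U x * \<phi> (x - ?H *\<^sub>R \<theta>)" "?H *\<^sub>R \<theta>"] by simp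
    also have "\<dots> - (\<integral>x. U x * \<phi> x \<partial>lborel) = (\<integral>x. U x * \<phi> (x - ?H *\<^sub>R \<theta>) - U x * \<phi> x \<partial>lborel)"
      by (intro Bochner_Integration.integral_diff[symmetric] integrable_mult_bounded[where B=B] B U) auto
    finally have "(\<integral>x. seg_integral \<theta> V ?H x * \<phi> x \<partial>lborel) / ?H
      = (\<integral>x. (U x * \<phi> (x - ?H *\<^sub>R \<theta>) - U x * \<phi> x) / ?H \<partial>lborel)" by simp
    also have "\<dots> = (\<integral>x. U x * ((\<phi> (x - ?H *\<^sub>R \<theta>) - \<phi> x) / ?H) \<partial>lborel)"
      by (intro Bochner_Integration.integral_cong refl) (simp add: field_simps)
    finally show ?case by simp
  qed
  \<comment> \<open>The difference quotients of \<open>\<phi>\<close> are bounded by the Lipschitz constant, which gives domination.\<close>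
  have lim1: "(\<lambda>n. \<integral>x. U x * ((\<phi> (x - ?h n *\<^sub>R \<theta>) - \<phi> x) / ?h n) \<partial>lborel) \<longlonglongrightarrow> (\<integral>x. U x * (- ?D x) \<partial>lborel)"
  proof (rule integral_dominated_convergence[where w="\<lambda>x. B * \<bar>U x\<bar>"])
    show "AE x in lborel. (\<lambda>n. U x * ((\<phi> (x - ?h n *\<^sub>R \<theta>) - \<phi> x) / ?h n)) \<longlonglongrightarrow> U x * (- ?D x)"
    proof (intro AE_I2 tendsto_mult tendsto_const)
      fix x
      have "((\<lambda>t. \<phi> (x + t *\<^sub>R \<theta>)) has_real_derivative ?D x) (at 0)"
        using Cc_infinity_derivative_along_line[OF \<phi>, of x \<theta> 0] by simp
      then have "((\<lambda>h. (\<phi> (x + h *\<^sub>R \<theta>) - \<phi> x) / h) \<longlongrightarrow> ?D x) (at 0)"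
        by (simp add: DERIV_def)
      moreover have "filterlim (\<lambda>n. - ?h n) (at 0) sequentially"
        using tendsto_minus[OF h0] by (intro filterlim_atI) auto
      ultimately have "(\<lambda>n. (\<phi> (x + (- ?h n) *\<^sub>R \<theta>) - \<phi> x) / (- ?h n)) \<longlonglongrightarrow> ?D x"
        by (rule filterlim_compose)
      from tendsto_minus[OF this]
      show "(\<lambda>n. (\<phi> (x - ?h n *\<^sub>R \<theta>) - \<phi> x) / ?h n) \<longlonglongrightarrow> - ?D x" by simp
    qed
    show "AE x in lborel. norm (U x * ((\<phi> (x - ?h n *\<^sub>R \<theta>) - \<phi> x) / ?h n)) \<le> B * \<bar>U x\<bar>" for n
    proof (intro AE_I2)
      fix x
      have "\<bar>(\<phi> (x - ?h n *\<^sub>R \<theta>) - \<phi> x) / ?h n\<bar> \<le> B"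
        using Lip'[of x "?h n"] unfolding abs_divide by (subst pos_divide_le_eq) simp_all
      then show "norm (U x * ((\<phi> (x - ?h n *\<^sub>R \<theta>) - \<phi> x) / ?h n)) \<le> B * \<bar>U x\<bar>"
        unfolding real_norm_def abs_mult by (subst mult.commute) (rule mult_right_mono, auto)
    qed
  qed (use U in auto)
  have lim2: "(\<lambda>n. (\<integral>x. seg_integral \<theta> V (?h n) x * \<phi> x \<partial>lborel) / ?h n) \<longlonglongrightarrow> (\<integral>x. V x * \<phi> x \<partial>lborel)"
  proof -
    let ?J = "\<lambda>t. (\<integral>x. V x * \<phi> (x - t *\<^sub>R \<theta>) \<partial>lborel)"
    let ?C = "(\<integral>x. \<bar>V x\<bar> \<partial>lborel) * B"
    \<comment> \<open>\<open>?J\<close> is Lipschitz, so its mean over \<open>{0..h}\<close> differs from \<open>?J 0\<close> by at most \<open>?C * h\<close>.\<close>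
    have J: "\<bar>?J t - ?J 0\<bar> \<le> ?C * \<bar>t\<bar>" for t
    proof -
      have "?J t - ?J 0 = (\<integral>x. V x * \<phi> (x - t *\<^sub>R \<theta>) - V x * \<phi> (x - 0 *\<^sub>R \<theta>) \<partial>lborel)"
        by (intro Bochner_Integration.integral_diff[symmetric] integrable_mult_bounded[where B=B] B V) auto
      also have "\<bar>\<dots>\<bar> \<le> (\<integral>x. \<bar>V x * \<phi> (x - t *\<^sub>R \<theta>) - V x * \<phi> (x - 0 *\<^sub>R \<theta>)\<bar> \<partial>lborel)"
        by (rule integral_abs_bound)
      also have "\<dots> \<le> (\<integral>x. \<bar>V x\<bar> * (B * \<bar>t\<bar>) \<partial>lborel)"
      proof (rule integral_mono)
        show "integrable lborel (\<lambda>x. \<bar>V x * \<phi> (x - t *\<^sub>R \<theta>) - V x * \<phi> (x - 0 *\<^sub>R \<theta>)\<bar>)"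
          by (intro integrable_abs Bochner_Integration.integrable_diff integrable_mult_bounded[where B=B] B V) auto
        show "integrable lborel (\<lambda>x. \<bar>V x\<bar> * (B * \<bar>t\<bar>))"
          using V by auto
        show "\<bar>V x * \<phi> (x - t *\<^sub>R \<theta>) - V x * \<phi> (x - 0 *\<^sub>R \<theta>)\<bar> \<le> \<bar>V x\<bar> * (B * \<bar>t\<bar>)" for x
          using Lip'[of x t] unfolding right_diff_distrib[symmetric] abs_mult
          by (intro mult_left_mono) auto
      qed
      finally show ?thesis by simp
    qed
    have bd0: "\<bar>(\<integral>x. seg_integral \<theta> V h x * \<phi> x \<partial>lborel) / h - ?J 0\<bar> \<le> ?C * h" if h: "h > 0" for h
    proof -
      have i1: "integrable lborel (\<lambda>t. if 0 \<le> t \<and> t \<le> h then ?J t else 0)"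
        by (rule integrable_weighted_segment(2)[OF V _ B(2)]) simp
      have i2: "integrable lborel (\<lambda>t. indicator {0..h} t * c)" for c :: real
        by (intro integrable_mult_left) (use h in simp)
      have "(\<integral>x. seg_integral \<theta> V h x * \<phi> x \<partial>lborel) - h * ?J 0
        = (\<integral>t. (if 0 \<le> t \<and> t \<le> h then ?J t else 0) \<partial>lborel) - (\<integral>t. indicator {0..h} t * ?J 0 \<partial>lborel)"
        using h by (subst integrable_weighted_segment(3)[OF V _ B(2)]) auto
      also have "\<dots> = (\<integral>t. (if 0 \<le> t \<and> t \<le> h then ?J t else 0) - indicator {0..h} t * ?J 0 \<partial>lborel)"
        by (intro Bochner_Integration.integral_diff[symmetric] i1 i2)
      finally have "\<bar>(\<integral>x. seg_integral \<theta> V h x * \<phi> x \<partial>lborel) - h * ?J 0\<bar>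
        \<le> (\<integral>t. \<bar>(if 0 \<le> t \<and> t \<le> h then ?J t else 0) - indicator {0..h} t * ?J 0\<bar> \<partial>lborel)"
        by (simp only: integral_abs_bound)
      also have "\<dots> \<le> (\<integral>t. indicator {0..h} t * (?C * h) \<partial>lborel)"
      proof (rule integral_mono)
        show "\<bar>(if 0 \<le> t \<and> t \<le> h then ?J t else 0) - indicator {0..h} t * ?J 0\<bar> \<le> indicator {0..h} t * (?C * h)" for t
        proof (cases "t \<in> {0..h}")
          case True
          have "?C * \<bar>t\<bar> \<le> ?C * h"
            using True B(1) by (intro mult_left_mono mult_nonneg_nonneg Bochner_Integration.integral_nonneg) auto
          then show ?thesis using True J[of t] by simp
        qed auto
      qed (intro integrable_abs Bochner_Integration.integrable_diff i1 i2)+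
      also have "\<dots> = h * (?C * h)" using h by simp
      finally show ?thesis using h by (simp add: abs_le_iff field_simps)
    qed
    have bd: "\<bar>(\<integral>x. seg_integral \<theta> V (?h n) x * \<phi> x \<partial>lborel) / ?h n - ?J 0\<bar> \<le> ?C * ?h n" for n
      by (rule bd0) simp
    have "(\<lambda>n. ?C * ?h n) \<longlonglongrightarrow> ?C * 0" by (intro tendsto_mult tendsto_const h0)
    then have C0: "(\<lambda>n. ?C * ?h n) \<longlonglongrightarrow> 0" by (simp only: mult_zero_right)
    have "(\<lambda>n. (\<integral>x. seg_integral \<theta> V (?h n) x * \<phi> x \<partial>lborel) / ?h n - ?J 0) \<longlonglongrightarrow> 0"
      by (rule Lim_null_comparison[OF always_eventually C0]) (simp only: real_norm_def bd, simp)
    then have "(\<lambda>n. (\<integral>x. seg_integral \<theta> V (?h n) x * \<phi> x \<partial>lborel) / ?h n) \<longlonglongrightarrow> ?J 0"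
      by (rule LIM_zero_cancel)
    then show ?thesis by (simp only: scaleR_zero_left diff_zero)
  qed
  have "(\<lambda>n. (\<integral>x. seg_integral \<theta> V (?h n) x * \<phi> x \<partial>lborel) / ?h n) \<longlonglongrightarrow> (\<integral>x. U x * (- ?D x) \<partial>lborel)"
    by (rule Lim_transform_eventually[OF lim1 ev])
  from LIMSEQ_unique[OF this lim2] show ?thesis by simp
qed

section \<open>Borel representatives\<close>

text \<open>
  A class in \<open>L2\<close> over \<open>\<Omega>\<close> is represented by a Borel function on the whole space that vanishes
  outside \<open>\<Omega>\<close>. Borel measurability is what survives the passage to product spaces and to lines, and
  the extension by zero removes every restriction of measures to \<open>\<Omega>\<close>.
\<close>

definition L2_ext :: "'a::euclidean_space set \<Rightarrow> ('a \<Rightarrow> real) set" where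
  "L2_ext \<Omega> = {F \<in> borel_measurable borel. integrable lborel (\<lambda>x. (F x)\<^sup>2) \<and> (\<forall>x. x \<notin> \<Omega> \<longrightarrow> F x = 0)}"

lemma AE_lebesgue_on_iff:
  "\<Omega> \<in> sets borel \<Longrightarrow> (AE x in lebesgue_on \<Omega>. P x) \<longleftrightarrow> (AE x in lborel. x \<in> \<Omega> \<longrightarrow> P x)"
  by (subst AE_restrict_space_iff) (auto simp: AE_completion_iff)

lemma abs_le_1_plus_square: "\<bar>y\<bar> \<le> 1 + y\<^sup>2" for y :: real
  using zero_le_power2[of "2 * \<bar>y\<bar> - 1"] by (simp add: power2_eq_square algebra_simps)

lemma square_add_le: "(a + b)\<^sup>2 \<le> 2 * a\<^sup>2 + 2 * b\<^sup>2" for a b :: real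
  using zero_le_power2[of "a - b"] by (simp add: power2_eq_square algebra_simps)

lemma integrable_indicator_bounded:
  fixes A :: "'a::euclidean_space set"
  assumes "A \<in> sets borel" "bounded A"
  shows "integrable lborel (\<lambda>x. c * indicator A x :: real)"
  using assms emeasure_bounded_finite[OF assms(2)]
  by (intro integrable_mult_right integrable_real_indicator) (auto simp: less_top)

lemma square_integrable_bounded_support:
  fixes F :: "'a::euclidean_space \<Rightarrow> real"
  assumes "F \<in> borel_measurable borel" "integrable lborel (\<lambda>x. (F x)\<^sup>2)" "bounded \<Omega>" "\<And>x. x \<notin> \<Omega> \<Longrightarrow> F x = 0"
  shows "integrable lborel F"
proof -
  obtain R where R: "\<Omega> \<subseteq> cball 0 R" using assms(3) by (metis bounded_subset_ballD ball_subset_cball order_trans)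
  have "integrable lborel (\<lambda>x. 1 * indicator (cball 0 R) x + (F x)\<^sup>2)"
    by (intro Bochner_Integration.integrable_add assms integrable_indicator_bounded) auto
  then show ?thesis
  proof (rule Bochner_Integration.integrable_bound)
    from abs_le_1_plus_square show "AE x in lborel. norm (F x) \<le> norm (1 * indicator (cball 0 R) x + (F x)\<^sup>2)"
      using R assms(4) by (intro AE_I2) (force simp: indicator_def subset_iff)
  qed (use assms in auto)
qed

lemma bounded_imp_L2_ext:
  fixes F :: "'a::euclidean_space \<Rightarrow> real"
  assumes F: "F \<in> borel_measurable borel" "\<And>x. \<bar>F x\<bar> \<le> B" "\<And>x. x \<notin> \<Omega> \<Longrightarrow> F x = 0"
    and \<Omega>: "\<Omega> \<in> sets borel" "bounded \<Omega>"
  shows "F \<in> L2_ext \<Omega>"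
proof -
  have "integrable lborel (\<lambda>x. (F x)\<^sup>2)"
    using integrable_indicator_bounded[OF \<Omega>, of "B\<^sup>2"]
  proof (rule Bochner_Integration.integrable_bound)
    have "(F x)\<^sup>2 \<le> B\<^sup>2" for x using power_mono[OF F(2)[of x], of 2] by simp
    then show "AE x in lborel. norm ((F x)\<^sup>2) \<le> norm (B\<^sup>2 * indicator \<Omega> x)"
      using F(3) by (intro AE_I2) (auto simp: indicator_def)
  qed (use F in measurable)
  with F show ?thesis by (simp add: L2_ext_def)
qed

lemma L2_ext_integrable: "bounded \<Omega> \<Longrightarrow> F \<in> L2_ext \<Omega> \<Longrightarrow> integrable lborel F"
  by (rule square_integrable_bounded_support) (auto simp: L2_ext_def)

lemma L2_ext_exists:
  assumes \<Omega>: "open \<Omega>" and f: "f \<in> L2 (lebesgue_on \<Omega>)"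
  shows "\<exists>F\<in>L2_ext \<Omega>. AE x in lborel. x \<in> \<Omega> \<longrightarrow> f x = F x"
proof -
  have [measurable]: "\<Omega> \<in> sets borel" using \<Omega> by auto
  have f1: "f \<in> borel_measurable (lebesgue_on \<Omega>)" and f2: "integrable (lebesgue_on \<Omega>) (\<lambda>x. (f x)\<^sup>2)"
    using f by (auto simp: L2_def)
  have "(\<lambda>x. indicator \<Omega> x *\<^sub>R f x) \<in> borel_measurable lebesgue"
    using f1 by (subst (asm) borel_measurable_restrict_space_iff) auto
  then obtain f' where f': "f' \<in> borel_measurable lborel" "AE x in lborel. indicator \<Omega> x *\<^sub>R f x = f' x"
    using completion_ex_borel_measurable_real by blast
  define F where "F x = indicator \<Omega> x * f' x" for x
  have [measurable]: "f' \<in> borel_measurable borel" "F \<in> borel_measurable borel"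
    using f'(1) by (auto simp: F_def[abs_def])
  have ae: "AE x in lborel. indicator \<Omega> x *\<^sub>R f x = F x"
    using f'(2) by eventually_elim (auto simp: F_def indicator_def)
  have "integrable lebesgue (\<lambda>x. indicator \<Omega> x *\<^sub>R (f x)\<^sup>2)"
    using f2 by (subst (asm) integrable_restrict_space) auto
  moreover have "(\<lambda>x. (F x)\<^sup>2) \<in> borel_measurable lebesgue"
    by (rule measurable_completion) simp
  moreover have "AE x in lebesgue. indicator \<Omega> x *\<^sub>R (f x)\<^sup>2 = (F x)\<^sup>2"
    using AE_completion[OF ae] by eventually_elim (auto simp: F_def indicator_def)
  ultimately have "integrable lebesgue (\<lambda>x. (F x)\<^sup>2)"
    by (rule integrable_cong_AE_imp)
  then have "integrable lborel (\<lambda>x. (F x)\<^sup>2)"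
    by (subst integrable_completion[symmetric]) simp_all
  then have "F \<in> L2_ext \<Omega>" by (auto simp: L2_ext_def F_def)
  moreover have "AE x in lborel. x \<in> \<Omega> \<longrightarrow> f x = F x"
    using ae by eventually_elim auto
  ultimately show ?thesis by blast
qed

lemma borel_imp_lebesgue_on: "F \<in> borel_measurable borel \<Longrightarrow> F \<in> borel_measurable (lebesgue_on \<Omega>)"
  by (rule measurable_restrict_space1, rule measurable_completion, simp)

lemma integral_lebesgue_on_borel:
  fixes F :: "'a::euclidean_space \<Rightarrow> real"
  assumes "F \<in> borel_measurable borel" "\<Omega> \<in> sets borel" "\<And>x. x \<notin> \<Omega> \<Longrightarrow> F x = 0"
  shows "integrable (lebesgue_on \<Omega>) F \<longleftrightarrow> integrable lborel F"
    and "(\<integral>x. F x \<partial>lebesgue_on \<Omega>) = (\<integral>x. F x \<partial>lborel)"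
proof -
  have *: "(\<lambda>x. indicator \<Omega> x *\<^sub>R F x) = F" using assms(3) by (auto simp: indicator_def fun_eq_iff)
  show "integrable (lebesgue_on \<Omega>) F \<longleftrightarrow> integrable lborel F"
  proof (subst integrable_restrict_space)
    show "\<Omega> \<inter> space lebesgue \<in> sets lebesgue" using assms(2) by auto
    show "integrable lebesgue (\<lambda>x. indicator \<Omega> x *\<^sub>R F x) \<longleftrightarrow> integrable lborel F"
      unfolding * by (rule integrable_completion) (simp add: assms(1))
  qed
  show "(\<integral>x. F x \<partial>lebesgue_on \<Omega>) = (\<integral>x. F x \<partial>lborel)"
  proof (subst integral_restrict_space)
    show "\<Omega> \<inter> space lebesgue \<in> sets lebesgue" using assms(2) by auto
    show "(\<integral>x. indicator \<Omega> x *\<^sub>R F x \<partial>lebesgue) = (\<integral>x. F x \<partial>lborel)"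
      unfolding * by (rule integral_completion) (simp add: assms(1))
  qed
qed

lemma L2_ext_imp_L2:
  assumes "open \<Omega>" "F \<in> L2_ext \<Omega>"
  shows "F \<in> L2 (lebesgue_on \<Omega>)"
proof -
  have F: "F \<in> borel_measurable borel" "integrable lborel (\<lambda>x. (F x)\<^sup>2)" "\<And>x. x \<notin> \<Omega> \<Longrightarrow> F x = 0"
    using assms(2) by (auto simp: L2_ext_def)
  have "integrable (lebesgue_on \<Omega>) (\<lambda>x. (F x)\<^sup>2)"
    by (subst integral_lebesgue_on_borel(1)) (use F assms(1) in auto)
  with F(1) show ?thesis by (simp add: L2_def borel_imp_lebesgue_on)
qed

lemma has_weak_deriv_cong_AE:
  assumes "\<Omega> \<in> sets borel" "AE x in lborel. x \<in> \<Omega> \<longrightarrow> u x = U x" "AE x in lborel. x \<in> \<Omega> \<longrightarrow> v x = V x"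
    and m: "u \<in> borel_measurable (lebesgue_on \<Omega>)" "v \<in> borel_measurable (lebesgue_on \<Omega>)"
      "U \<in> borel_measurable (lebesgue_on \<Omega>)" "V \<in> borel_measurable (lebesgue_on \<Omega>)"
  shows "has_weak_deriv \<Omega> \<theta> u v \<longleftrightarrow> has_weak_deriv \<Omega> \<theta> U V"
proof -
  have "(\<integral>x. u x * frechet_derivative \<phi> (at x) \<theta> \<partial>lebesgue_on \<Omega>) = (\<integral>x. U x * frechet_derivative \<phi> (at x) \<theta> \<partial>lebesgue_on \<Omega>)
    \<and> (\<integral>x. v x * \<phi> x \<partial>lebesgue_on \<Omega>) = (\<integral>x. V x * \<phi> x \<partial>lebesgue_on \<Omega>)"
    if \<phi>: "\<phi> \<in> Cc_infinity \<Omega>" for \<phi>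
  proof (intro conjI integral_cong_AE)
    show "AE x in lebesgue_on \<Omega>. u x * frechet_derivative \<phi> (at x) \<theta> = U x * frechet_derivative \<phi> (at x) \<theta>"
      using assms(2) by (subst AE_lebesgue_on_iff[OF assms(1)]) (auto elim: eventually_mono)
    show "AE x in lebesgue_on \<Omega>. v x * \<phi> x = V x * \<phi> x"
      using assms(3) by (subst AE_lebesgue_on_iff[OF assms(1)]) (auto elim: eventually_mono)
  qed (intro borel_measurable_times m borel_imp_lebesgue_on Cc_infinity_borel[OF \<phi>])+
  then show ?thesis by (auto simp: has_weak_deriv_def)
qed

lemma has_weak_deriv_iff_lborel:
  assumes \<Omega>: "open \<Omega>" and U: "U \<in> L2_ext \<Omega>" and V: "V \<in> L2_ext \<Omega>"
  shows "has_weak_deriv \<Omega> \<theta> U V \<longleftrightarrow> (\<forall>\<phi>\<in>Cc_infinity \<Omega>.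
    (\<integral>x. U x * frechet_derivative \<phi> (at x) \<theta> \<partial>lborel) = - (\<integral>x. V x * \<phi> x \<partial>lborel))"
proof -
  have "(\<integral>x. U x * frechet_derivative \<phi> (at x) \<theta> \<partial>lebesgue_on \<Omega>) = (\<integral>x. U x * frechet_derivative \<phi> (at x) \<theta> \<partial>lborel)
    \<and> (\<integral>x. V x * \<phi> x \<partial>lebesgue_on \<Omega>) = (\<integral>x. V x * \<phi> x \<partial>lborel)"
    if \<phi>: "\<phi> \<in> Cc_infinity \<Omega>" for \<phi>
    using \<Omega> U V Cc_infinity_borel[OF \<phi>]
    by (intro conjI integral_lebesgue_on_borel) (auto simp: L2_ext_def)
  then show ?thesis by (auto simp: has_weak_deriv_def)
qed

section \<open>Lebesgue measure along parallel lines\<close>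

lemma nn_integral_lborel_reflect:
  fixes x :: "'a::euclidean_space" and f :: "'a \<Rightarrow> ennreal"
  assumes [measurable]: "f \<in> borel_measurable borel"
  shows "(\<integral>\<^sup>+y. f (x - y) \<partial>lborel) = (\<integral>\<^sup>+y. f y \<partial>lborel)"
proof -
  have "lborel = distr lborel borel (\<lambda>y. x + (-1) *\<^sub>R y)"
    using lborel_affine[of "-1" x] by (simp add: density_1)
  then have "(\<integral>\<^sup>+y. f y \<partial>lborel) = (\<integral>\<^sup>+y. f y \<partial>distr lborel borel (\<lambda>y. x + (-1) *\<^sub>R y))"
    by simp
  also have "\<dots> = (\<integral>\<^sup>+y. f (x - y) \<partial>lborel)"
    by (subst nn_integral_distr) auto
  finally show ?thesis by simp
qed

text \<open>
  Uniqueness of a translation invariant measure. Integrate \<open>1_A(x) 1_B(x + y)\<close> over both variables,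
  with \<open>B\<close> the unit ball: integrating first over \<open>y\<close> gives \<open>M A * lborel B\<close>, and shifting \<open>x\<close> by \<open>y\<close>
  first gives \<open>lborel A * M B\<close>.
\<close>

lemma translation_invariant_eq_lborel:
  fixes M :: "'a::euclidean_space measure"
  assumes sets[measurable_cong]: "sets M = sets borel" and "sigma_finite_measure M"
    and inv: "\<And>c. distr M borel (\<lambda>x. x + c) = M"
    and ball: "emeasure M (cball 0 1) = emeasure lborel (cball (0::'a) 1)"
  shows "M = lborel"
proof (rule measure_eqI)
  show "sets M = sets lborel" using sets by simp
  fix A assume "A \<in> sets M"
  then have [measurable]: "A \<in> sets borel" using sets by simp
  interpret M: sigma_finite_measure M by fact
  interpret P: pair_sigma_finite M "lborel :: 'a measure" ..
  let ?B = "cball (0::'a) 1"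
  have [measurable]: "?B \<in> sets borel" by simp
  have shift: "(\<integral>\<^sup>+x. f (x + c) \<partial>M) = (\<integral>\<^sup>+x. f x \<partial>M)"
    if [measurable]: "f \<in> borel_measurable borel" for f c
  proof -
    have "(\<integral>\<^sup>+x. f x \<partial>M) = (\<integral>\<^sup>+x. f x \<partial>distr M borel (\<lambda>x. x + c))" by (simp add: inv)
    also have "\<dots> = (\<integral>\<^sup>+x. f (x + c) \<partial>M)" by (rule nn_integral_distr) auto
    finally show ?thesis by simp
  qed
  have reflect: "(\<integral>\<^sup>+y. indicator A (x - y) \<partial>lborel) = emeasure lborel A" for x
    using nn_integral_lborel_reflect[of "indicator A" x] by simp
  have "emeasure M A * emeasure lborel ?B = (\<integral>\<^sup>+x. indicator A x * emeasure lborel ?B \<partial>M)"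
    by (subst nn_integral_multc) auto
  also have "\<dots> = (\<integral>\<^sup>+x. (\<integral>\<^sup>+y. indicator A x * indicator ?B (y + x) \<partial>lborel) \<partial>M)"
  proof (intro nn_integral_cong)
    fix x
    have "(\<integral>\<^sup>+y. indicator A x * indicator ?B (y + x) \<partial>lborel) = indicator A x * (\<integral>\<^sup>+y. indicator ?B (y + x) \<partial>lborel)"
      by (rule nn_integral_cmult) measurable
    also have "(\<integral>\<^sup>+y. indicator ?B (y + x) \<partial>lborel) = emeasure lborel ?B"
      by (subst nn_integral_lborel_shift) auto
    finally show "indicator A x * emeasure lborel ?B = (\<integral>\<^sup>+y. indicator A x * indicator ?B (y + x) \<partial>lborel)"
      by simp
  qed
  also have "\<dots> = (\<integral>\<^sup>+y. (\<integral>\<^sup>+x. indicator A x * indicator ?B (y + x) \<partial>M) \<partial>lborel)"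
    by (rule P.Fubini'[symmetric]) measurable
  also have "\<dots> = (\<integral>\<^sup>+y. (\<integral>\<^sup>+x. indicator A (x - y) * indicator ?B x \<partial>M) \<partial>lborel)"
  proof (rule nn_integral_cong)
    fix y
    show "(\<integral>\<^sup>+x. indicator A x * indicator ?B (y + x) \<partial>M) = (\<integral>\<^sup>+x. indicator A (x - y) * indicator ?B x \<partial>M)"
      using shift[of "\<lambda>x. indicator A (x - y) * indicator ?B x" y] by (simp add: add.commute)
  qed
  also have "\<dots> = (\<integral>\<^sup>+x. (\<integral>\<^sup>+y. indicator A (x - y) * indicator ?B x \<partial>lborel) \<partial>M)"
    by (rule P.Fubini') measurable
  also have "\<dots> = (\<integral>\<^sup>+x. emeasure lborel A * indicator ?B x \<partial>M)"
    by (intro nn_integral_cong) (simp add: nn_integral_multc reflect)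
  also have "\<dots> = emeasure lborel A * emeasure lborel ?B"
    by (subst nn_integral_cmult) (auto simp: ball)
  finally have "emeasure lborel ?B * emeasure M A = emeasure lborel ?B * emeasure lborel A"
    by (simp add: mult.commute)
  moreover have "emeasure lborel ?B \<noteq> \<infinity>"
    using emeasure_lborel_cball_finite[of "0::'a" 1] by auto
  moreover have "emeasure lborel ?B \<noteq> 0"
    using unit_ball_vol_pos[of "real DIM('a)"] by (subst emeasure_cball) (simp_all add: less_imp_neq[symmetric])
  ultimately show "emeasure M A = emeasure lborel A"
    by (auto simp: ennreal_mult_cancel_left)
qed

interpretation lborel_PiM: product_sigma_finite "\<lambda>_. lborel :: real measure"
  by standard

lemma PiM_lborel_shift:
  fixes v :: "'i \<Rightarrow> real"
  assumes "finite I"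
  shows "distr (Pi\<^sub>M I (\<lambda>_. lborel)) (Pi\<^sub>M I (\<lambda>_. lborel)) (\<lambda>f. \<lambda>i\<in>I. f i + v i) = Pi\<^sub>M I (\<lambda>_. lborel)"
proof (rule lborel_PiM.PiM_eqI[OF assms])
  show "sets (distr (Pi\<^sub>M I (\<lambda>_. lborel)) (Pi\<^sub>M I (\<lambda>_. lborel)) (\<lambda>f. \<lambda>i\<in>I. f i + v i)) = sets (Pi\<^sub>M I (\<lambda>_. lborel))"
    by simp
  fix A :: "'i \<Rightarrow> real set" assume A: "\<And>i. i \<in> I \<Longrightarrow> A i \<in> sets lborel"
  have m: "(\<lambda>f. \<lambda>i\<in>I. f i + v i) \<in> Pi\<^sub>M I (\<lambda>_. lborel) \<rightarrow>\<^sub>M Pi\<^sub>M I (\<lambda>_. lborel :: real measure)"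
    by (intro measurable_restrict) measurable
  have vm: "(\<lambda>t. t + v i) -` A i \<in> sets lborel" if "i \<in> I" for i
    using measurable_sets[of "\<lambda>t. t + v i" lborel lborel "A i"] A[OF that] by simp
  have "emeasure (distr (Pi\<^sub>M I (\<lambda>_. lborel)) (Pi\<^sub>M I (\<lambda>_. lborel)) (\<lambda>f. \<lambda>i\<in>I. f i + v i)) (Pi\<^sub>E I A)
    = emeasure (Pi\<^sub>M I (\<lambda>_. lborel)) ((\<lambda>f. \<lambda>i\<in>I. f i + v i) -` Pi\<^sub>E I A \<inter> space (Pi\<^sub>M I (\<lambda>_. lborel)))"
    by (rule emeasure_distr[OF m]) (intro sets_PiM_I_finite assms A)
  also have "(\<lambda>f. \<lambda>i\<in>I. f i + v i) -` Pi\<^sub>E I A \<inter> space (Pi\<^sub>M I (\<lambda>_. lborel)) = Pi\<^sub>E I (\<lambda>i. (\<lambda>t. t + v i) -` A i)"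
    by (auto simp: space_PiM PiE_iff extensional_def)
  also have "emeasure (Pi\<^sub>M I (\<lambda>_. lborel)) \<dots> = (\<Prod>i\<in>I. emeasure lborel ((\<lambda>t. t + v i) -` A i))"
    by (intro lborel_PiM.emeasure_PiM assms vm)
  also have "\<dots> = (\<Prod>i\<in>I. emeasure lborel (A i))"
  proof (intro prod.cong refl)
    fix i assume i: "i \<in> I"
    have "emeasure lborel (A i) = emeasure (distr lborel borel ((+) (v i))) (A i)"
      by (simp add: lborel_distr_plus)
    also have "\<dots> = emeasure lborel ((\<lambda>t. t + v i) -` A i)"
      using A[OF i] by (subst emeasure_distr) (auto simp: add.commute[of "v i"] vimage_def)
    finally show "emeasure lborel ((\<lambda>t. t + v i) -` A i) = emeasure lborel (A i)" by simp
  qed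
  finally show "emeasure (distr (Pi\<^sub>M I (\<lambda>_. lborel)) (Pi\<^sub>M I (\<lambda>_. lborel)) (\<lambda>f. \<lambda>i\<in>I. f i + v i)) (Pi\<^sub>E I A)
    = (\<Prod>i\<in>I. emeasure lborel (A i))" .
qed

lemma orthonormal_basis_of_finite:
  fixes C :: "'a::euclidean_space set"
  assumes "orthonormal_basis_of V C"
  shows "finite C" "independent C" "card C = dim V"
proof -
  have "0 \<notin> C" using assms by (auto simp: orthonormal_basis_of_def)
  then show ind: "independent C"
    using assms pairwise_orthogonal_independent by (auto simp: orthonormal_basis_of_def)
  then show "finite C" by (rule independent_imp_finite)
  show "card C = dim V"
    using dim_span_eq_card_independent[OF ind] assms by (metis orthonormal_basis_of_def)
qed

lemma orthonormal_sum_inner: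
  assumes "orthonormal_basis_of V C" "c \<in> C"
  shows "(\<Sum>b\<in>C. f b *\<^sub>R b) \<bullet> c = f c"
proof -
  have "(\<Sum>b\<in>C. f b *\<^sub>R b) \<bullet> c = (\<Sum>b\<in>C. f b * (b \<bullet> c))"
    by (simp add: inner_sum_left)
  also have "\<dots> = (\<Sum>b\<in>C. if b = c then f c else 0)"
    using assms
    by (intro sum.cong) (auto simp: orthonormal_basis_of_def pairwise_def orthogonal_def norm_eq_1)
  finally show ?thesis using assms orthonormal_basis_of_finite(1)[OF assms(1)] by simp
qed

text \<open>
  Lebesgue measure may be computed in any orthonormal coordinates. The product measure is
  translation invariant, and the volume of the unit ball of the coordinate space depends only on the
  number of coordinates.
\<close>

lemma lborel_eq_orthonormal_coordinates:
  fixes C :: "'a::euclidean_space set"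
  assumes C: "orthonormal_basis_of UNIV C"
  shows "distr (\<Pi>\<^sub>M b\<in>C. lborel) borel (\<lambda>f. \<Sum>b\<in>C. f b *\<^sub>R b) = (lborel :: 'a measure)"
    (is "?M = _")
proof (rule translation_invariant_eq_lborel)
  note fin = orthonormal_basis_of_finite[OF C]
  let ?P = "\<Pi>\<^sub>M b\<in>C. (lborel :: real measure)"
  let ?S = "\<lambda>f::'a \<Rightarrow> real. \<Sum>b\<in>C. f b *\<^sub>R b"
  have S[measurable]: "?S \<in> ?P \<rightarrow>\<^sub>M borel" by measurable
  have norm_S: "norm (?S f) = sqrt (\<Sum>b\<in>C. (f b)\<^sup>2)" for f
  proof -
    have "(norm (?S f))\<^sup>2 = (\<Sum>b\<in>C. (norm (f b *\<^sub>R b))\<^sup>2)"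
      using C by (intro norm_sum_Pythagorean fin(1))
        (auto simp: orthonormal_basis_of_def pairwise_def orthogonal_def)
    also have "\<dots> = (\<Sum>b\<in>C. (f b)\<^sup>2)"
      using C by (intro sum.cong) (auto simp: orthonormal_basis_of_def)
    finally show ?thesis by (metis norm_ge_zero real_sqrt_unique)
  qed
  have ball: "emeasure ?M (cball 0 r) = ennreal (unit_ball_vol (real (card C)) * r ^ card C)" if "r > 0" for r
  proof -
    have "emeasure ?M (cball 0 r) = emeasure ?P (?S -` cball 0 r \<inter> space ?P)"
      by (rule emeasure_distr) auto
    also have "?S -` cball 0 r \<inter> space ?P = {f. sqrt (\<Sum>i\<in>C. (f i)\<^sup>2) \<le> r} \<inter> space ?P"
      by (auto simp: norm_S)
    finally show ?thesis using emeasure_cball_aux[OF fin(1) that] by simp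
  qed
  show "sets ?M = sets borel" by simp
  show "sigma_finite_measure ?M"
  proof
    let ?A = "range (\<lambda>n::nat. cball (0::'a) (real (Suc n)))"
    have "\<Union>?A = UNIV"
    proof (intro equalityI subsetI UNIV_I)
      fix x :: 'a
      obtain n :: nat where "norm x \<le> real n" using real_arch_simple by blast
      then have "x \<in> cball 0 (real (Suc n))" by simp
      then show "x \<in> \<Union>?A" by blast
    qed
    moreover have "emeasure ?M (cball 0 (real (Suc n))) \<noteq> \<infinity>" for n
      using ball[of "real (Suc n)"] by simp
    ultimately show "\<exists>A. countable A \<and> A \<subseteq> sets ?M \<and> \<Union> A = space ?M \<and> (\<forall>a\<in>A. emeasure ?M a \<noteq> \<infinity>)"
      by (intro exI[of _ ?A]) auto
  qed
  show "emeasure ?M (cball 0 1) = emeasure lborel (cball (0::'a) 1)"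
    using fin(3) by (subst ball) (simp_all add: emeasure_cball)
  show "distr ?M borel (\<lambda>x. x + c) = ?M" for c
  proof -
    let ?T = "\<lambda>f. \<lambda>b\<in>C. f b + c \<bullet> b"
    have T[measurable]: "?T \<in> ?P \<rightarrow>\<^sub>M ?P" by (intro measurable_restrict) measurable
    have c: "c = ?S (\<lambda>b. c \<bullet> b)"
    proof -
      have "c \<in> span C" using C by (simp add: orthonormal_basis_of_def)
      then obtain g where g: "c = ?S g"
        using span_finite[OF fin(1)] by auto
      have "?S (\<lambda>b. c \<bullet> b) = ?S g"
        by (intro sum.cong refl) (simp add: g orthonormal_sum_inner[OF C])
      with g show ?thesis by simp
    qed
    have "distr ?M borel (\<lambda>x. x + c) = distr ?P borel (\<lambda>f. ?S f + c)"
      by (subst distr_distr) (auto simp: comp_def)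
    also have "\<dots> = distr ?P borel (\<lambda>f. ?S (?T f))"
      by (intro distr_cong refl) (subst (1) c, simp add: scaleR_add_left sum.distrib)
    also have "\<dots> = distr (distr ?P ?P ?T) borel ?S"
      by (subst distr_distr) (auto simp: comp_def)
    also have "\<dots> = ?M" by (simp only: PiM_lborel_shift[OF fin(1)])
    finally show ?thesis .
  qed
qed

lemma sets_lborel_hyperplane [simp, measurable_cong]: "sets (lborel_hyperplane \<theta>) = sets borel"
  by (simp add: lborel_hyperplane_def Let_def)

lemma space_lborel_hyperplane [simp]: "space (lborel_hyperplane \<theta>) = UNIV"
  by (simp add: lborel_hyperplane_def Let_def)

lemma subspace_hyperplane: "subspace (hyperplane \<theta>)"
  by (auto simp: hyperplane_def subspace_def inner_add_left)

lemma orthonormal_basis_of_exists: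
  fixes V :: "'a::euclidean_space set"
  shows "subspace V \<Longrightarrow> \<exists>B. orthonormal_basis_of V B"
  by (rule orthonormal_basis_subspace[of V]) (auto simp: orthonormal_basis_of_def)

text \<open>
  Adding \<open>\<theta>\<close> to an orthonormal basis of the hyperplane gives an orthonormal basis of the space; in
  these coordinates the formula is Fubini's theorem for a product measure.
\<close>

lemma nn_integral_lborel_lines:
  fixes \<theta> :: "'a::euclidean_space"
  assumes \<theta>: "norm \<theta> = 1" and F[measurable]: "F \<in> borel_measurable borel"
  shows "(\<integral>\<^sup>+x. F x \<partial>lborel) = (\<integral>\<^sup>+y. (\<integral>\<^sup>+s. F (s *\<^sub>R \<theta> + y) \<partial>lborel) \<partial>lborel_hyperplane \<theta>)"
    and "AE y in lborel_hyperplane \<theta>. y \<in> hyperplane \<theta>"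
proof -
  define B where "B = (SOME B. orthonormal_basis_of (hyperplane \<theta>) B)"
  have B: "orthonormal_basis_of (hyperplane \<theta>) B"
    unfolding B_def by (rule someI_ex[OF orthonormal_basis_of_exists[OF subspace_hyperplane]])
  note fin = orthonormal_basis_of_finite[OF B]
  have Bh: "b \<bullet> \<theta> = 0" if "b \<in> B" for b
    using B that span_base[of b B] by (auto simp: orthonormal_basis_of_def hyperplane_def)
  have \<theta>B: "\<theta> \<notin> B" using Bh[of \<theta>] \<theta> by (auto simp: norm_eq_1)
  have C: "orthonormal_basis_of UNIV (insert \<theta> B)"
  proof -
    have "x \<in> span (insert \<theta> B)" for x
    proof -
      have "x - (x \<bullet> \<theta>) *\<^sub>R \<theta> \<in> hyperplane \<theta>"
        using \<theta> by (simp add: hyperplane_def inner_diff_left norm_eq_1)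
      then have "x - (x \<bullet> \<theta>) *\<^sub>R \<theta> \<in> span B"
        using B by (simp add: orthonormal_basis_of_def)
      then show ?thesis by (auto simp: span_breakdown_eq)
    qed
    then show ?thesis
      using B Bh \<theta> by (auto simp: orthonormal_basis_of_def pairwise_insert orthogonal_def inner_commute)
  qed
  let ?P = "\<Pi>\<^sub>M b\<in>B. (lborel :: real measure)"
  have LH: "lborel_hyperplane \<theta> = distr ?P borel (\<lambda>f. \<Sum>b\<in>B. f b *\<^sub>R b)"
    by (simp add: lborel_hyperplane_def Let_def B_def)
  have "(\<integral>\<^sup>+x. F x \<partial>lborel) = (\<integral>\<^sup>+x. F x \<partial>distr (\<Pi>\<^sub>M b\<in>insert \<theta> B. lborel) borel (\<lambda>f. \<Sum>b\<in>insert \<theta> B. f b *\<^sub>R b))"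
    by (simp only: lborel_eq_orthonormal_coordinates[OF C])
  also have "\<dots> = (\<integral>\<^sup>+f. F (\<Sum>b\<in>insert \<theta> B. f b *\<^sub>R b) \<partial>(\<Pi>\<^sub>M b\<in>insert \<theta> B. lborel))"
    by (rule nn_integral_distr) measurable
  also have "\<dots> = (\<integral>\<^sup>+f. (\<integral>\<^sup>+s. F (\<Sum>b\<in>insert \<theta> B. (f(\<theta> := s)) b *\<^sub>R b) \<partial>lborel) \<partial>?P)"
    by (rule lborel_PiM.product_nn_integral_insert[OF fin(1) \<theta>B]) measurable
  also have "\<dots> = (\<integral>\<^sup>+f. (\<integral>\<^sup>+s. F (s *\<^sub>R \<theta> + (\<Sum>b\<in>B. f b *\<^sub>R b)) \<partial>lborel) \<partial>?P)"
  proof (intro nn_integral_cong)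
    fix f :: "'a \<Rightarrow> real" and s :: real
    have "(\<Sum>b\<in>B. (f(\<theta> := s)) b *\<^sub>R b) = (\<Sum>b\<in>B. f b *\<^sub>R b)"
      using \<theta>B by (intro sum.cong) auto
    then show "F (\<Sum>b\<in>insert \<theta> B. (f(\<theta> := s)) b *\<^sub>R b) = F (s *\<^sub>R \<theta> + (\<Sum>b\<in>B. f b *\<^sub>R b))"
      using fin(1) \<theta>B by (simp del: fun_upd_apply) (simp add: fun_upd_same)
  qed
  also have "\<dots> = (\<integral>\<^sup>+y. (\<integral>\<^sup>+s. F (s *\<^sub>R \<theta> + y) \<partial>lborel) \<partial>lborel_hyperplane \<theta>)"
    unfolding LH by (rule nn_integral_distr[symmetric]) measurable
  finally show "(\<integral>\<^sup>+x. F x \<partial>lborel) = (\<integral>\<^sup>+y. (\<integral>\<^sup>+s. F (s *\<^sub>R \<theta> + y) \<partial>lborel) \<partial>lborel_hyperplane \<theta>)" .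
  have "closed (hyperplane \<theta>)" by (rule closed_subspace[OF subspace_hyperplane])
  then have [measurable]: "hyperplane \<theta> \<in> sets borel" by simp
  show "AE y in lborel_hyperplane \<theta>. y \<in> hyperplane \<theta>"
    unfolding LH
    by (subst AE_distr_iff) (auto simp: hyperplane_def inner_sum_left Bh)
qed

lemma AE_lborel_imp_AE_lines:
  fixes \<theta> :: "'a::euclidean_space"
  assumes \<theta>: "norm \<theta> = 1" and "AE x in lborel. P x"
  shows "AE y in lborel_hyperplane \<theta>. AE s in lborel. P (s *\<^sub>R \<theta> + y)"
proof -
  obtain N where N[measurable]: "N \<in> sets borel" and N0: "emeasure lborel N = 0" "{x. \<not> P x} \<subseteq> N"
    using assms(2) by (auto simp: eventually_ae_filter null_sets_def)
  have "(\<integral>\<^sup>+y. (\<integral>\<^sup>+s. indicator N (s *\<^sub>R \<theta> + y) \<partial>lborel) \<partial>lborel_hyperplane \<theta>) = (\<integral>\<^sup>+x. indicator N x \<partial>lborel)"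
    by (rule nn_integral_lborel_lines(1)[OF \<theta>, symmetric]) measurable
  also have "\<dots> = 0" using N0 by simp
  finally have "AE y in lborel_hyperplane \<theta>. (\<integral>\<^sup>+s. indicator N (s *\<^sub>R \<theta> + y) \<partial>lborel) = (0::ennreal)"
    by (subst (asm) nn_integral_0_iff_AE) measurable
  then show ?thesis
  proof eventually_elim
    case (elim y)
    then have "AE s in lborel. indicator N (s *\<^sub>R \<theta> + y) = (0::ennreal)"
      by (subst (asm) nn_integral_0_iff_AE) measurable
    then show ?case by eventually_elim (use N0 in \<open>auto simp: indicator_def split: if_splits\<close>)
  qed
qed

text \<open>
  The converse of the previous lemma needs a Borel predicate: a set all of whose slices are null can
  be nonmeasurable.
\<close>

lemma AE_lines_imp_AE_lborel:
  fixes \<theta> :: "'a::euclidean_space"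
  assumes \<theta>: "norm \<theta> = 1" and P[measurable]: "Measurable.pred borel P"
    and "AE y in lborel_hyperplane \<theta>. AE s in lborel. P (s *\<^sub>R \<theta> + y)"
  shows "AE x in lborel. P x"
proof -
  let ?N = "{x. \<not> P x}"
  have N[measurable]: "?N \<in> sets borel" using P by measurable
  have "(\<integral>\<^sup>+x. indicator ?N x \<partial>lborel) = (\<integral>\<^sup>+y. (\<integral>\<^sup>+s. indicator ?N (s *\<^sub>R \<theta> + y) \<partial>lborel) \<partial>lborel_hyperplane \<theta>)"
    by (rule nn_integral_lborel_lines(1)[OF \<theta>]) measurable
  also have "\<dots> = (\<integral>\<^sup>+y. 0 \<partial>lborel_hyperplane \<theta>)"
  proof (rule nn_integral_cong_AE)
    show "AE y in lborel_hyperplane \<theta>. (\<integral>\<^sup>+s. indicator ?N (s *\<^sub>R \<theta> + y) \<partial>lborel) = 0"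
      using assms(3)
    proof eventually_elim
      case (elim y)
      then have "AE s in lborel. indicator ?N (s *\<^sub>R \<theta> + y) = (0::ennreal)"
        by eventually_elim simp
      then show ?case by (subst nn_integral_0_iff_AE) measurable
    qed
  qed
  finally have "emeasure lborel ?N = 0" by simp
  then have "?N \<in> null_sets lborel" using N by auto
  then have "AE x in lborel. x \<notin> ?N" by (rule AE_not_in)
  then show ?thesis by simp
qed

section \<open>Exit times\<close>

text \<open>
  In a unit direction a segment in \<open>\<Omega>\<close> is not longer than the diameter of an enclosing ball. Hence
  the supremum that defines the exit time is taken over a bounded set.
\<close>

lemma delta_dir_set:
  fixes \<Omega> :: "'a::euclidean_space set"
  assumes "bounded \<Omega>"
  obtains D where "D > 0" "\<And>x \<theta>. norm \<theta> = 1 \<Longrightarrow> {s. 0 \<le> s \<and> (\<forall>t\<in>{0..<s}. x + t *\<^sub>R \<theta> \<in> \<Omega>)} \<subseteq> {0..D}"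
proof -
  obtain R where R: "R > 0" "\<Omega> \<subseteq> ball 0 R" using assms bounded_subset_ballD by blast
  show ?thesis
  proof (rule that[of "2 * R"])
    fix x \<theta> :: 'a assume \<theta>: "norm \<theta> = 1"
    show "{s. 0 \<le> s \<and> (\<forall>t\<in>{0..<s}. x + t *\<^sub>R \<theta> \<in> \<Omega>)} \<subseteq> {0..2 * R}"
    proof (clarsimp, rule ccontr)
      fix s assume s: "0 \<le> s" "\<forall>t\<in>{0..<s}. x + t *\<^sub>R \<theta> \<in> \<Omega>" "\<not> s \<le> 2 * R"
      have "x + 0 *\<^sub>R \<theta> \<in> \<Omega>" "x + (2 * R) *\<^sub>R \<theta> \<in> \<Omega>"
        using s R(1) by (auto simp del: scaleR_zero_left)
      then have "x + 0 *\<^sub>R \<theta> \<in> ball 0 R" "x + (2 * R) *\<^sub>R \<theta> \<in> ball 0 R"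
        using R(2) by blast+
      then have "norm ((x + (2 * R) *\<^sub>R \<theta>) - (x + 0 *\<^sub>R \<theta>)) < R + R"
        using norm_triangle_ineq4[of "x + (2 * R) *\<^sub>R \<theta>" "x + 0 *\<^sub>R \<theta>"] by (auto simp del: add_diff_cancel_left')
      then show False using \<theta> R by simp
    qed
  qed (use R in simp)
qed

lemma delta_dir_bounded:
  fixes \<Omega> :: "'a::euclidean_space set"
  assumes "bounded \<Omega>"
  obtains D where "D > 0" "\<And>x \<theta>. norm \<theta> = 1 \<Longrightarrow> 0 \<le> delta_dir \<Omega> \<theta> x \<and> delta_dir \<Omega> \<theta> x \<le> D"
proof -
  obtain D where D: "D > 0" "\<And>x \<theta>. norm \<theta> = 1 \<Longrightarrow> {s. 0 \<le> s \<and> (\<forall>t\<in>{0..<s}. x + t *\<^sub>R \<theta> \<in> \<Omega>)} \<subseteq> {0..D}"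
    by (rule delta_dir_set[OF assms]) (rule that)
  show ?thesis
  proof (rule that[OF D(1)])
    fix x \<theta> :: 'a assume \<theta>: "norm \<theta> = 1"
    let ?E = "{s. 0 \<le> s \<and> (\<forall>t\<in>{0..<s}. x + t *\<^sub>R \<theta> \<in> \<Omega>)}"
    have 0: "0 \<in> ?E" by simp
    then have "0 \<le> Sup ?E"
      using bdd_above_mono[OF bdd_above_Icc D(2)[OF \<theta>]] by (rule cSup_upper)
    moreover have "Sup ?E \<le> D"
      using 0 D(2)[OF \<theta>, of x] by (intro cSup_least) auto
    ultimately show "0 \<le> delta_dir \<Omega> \<theta> x \<and> delta_dir \<Omega> \<theta> x \<le> D" by (simp add: delta_dir_def)
  qed
qed

text \<open>
  The exit time exceeds \<open>a\<close> exactly if the closed segment of length \<open>a\<close> lies in \<open>\<Omega>\<close>, because \<open>\<Omega>\<close> is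
  open. This gives lower semicontinuity, hence Borel measurability, of the exit time.
\<close>

lemma delta_dir_greater_iff:
  fixes \<Omega> :: "'a::euclidean_space set"
  assumes \<Omega>: "open \<Omega>" "bounded \<Omega>" and \<theta>: "norm \<theta> = 1" and a: "0 \<le> a"
  shows "a < delta_dir \<Omega> \<theta> x \<longleftrightarrow> (\<forall>t\<in>{0..a}. x + t *\<^sub>R \<theta> \<in> \<Omega>)"
proof -
  let ?E = "{s. 0 \<le> s \<and> (\<forall>t\<in>{0..<s}. x + t *\<^sub>R \<theta> \<in> \<Omega>)}"
  obtain D where "\<And>x \<theta>. norm \<theta> = 1 \<Longrightarrow> {s. 0 \<le> s \<and> (\<forall>t\<in>{0..<s}. x + t *\<^sub>R \<theta> \<in> \<Omega>)} \<subseteq> {0..D}"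
    by (rule delta_dir_set[OF \<Omega>(2)]) (rule that)
  from bdd_above_mono[OF bdd_above_Icc this[OF \<theta>]] have bdd: "bdd_above ?E" .
  have "0 \<in> ?E" by simp
  then have ne: "?E \<noteq> {}" by blast
  have "a < Sup ?E \<longleftrightarrow> (\<exists>s\<in>?E. a < s)" by (rule less_cSup_iff[OF ne bdd])
  also have "\<dots> \<longleftrightarrow> (\<forall>t\<in>{0..a}. x + t *\<^sub>R \<theta> \<in> \<Omega>)"
  proof
    assume *: "\<forall>t\<in>{0..a}. x + t *\<^sub>R \<theta> \<in> \<Omega>"
    then have "x + a *\<^sub>R \<theta> \<in> \<Omega>" using a by auto
    then obtain e where e: "e > 0" "ball (x + a *\<^sub>R \<theta>) e \<subseteq> \<Omega>"
      using \<Omega>(1) openE by blast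
    have "a + e \<in> ?E"
    proof safe
      fix t assume t: "t \<in> {0..<a + e}"
      show "x + t *\<^sub>R \<theta> \<in> \<Omega>"
      proof (cases "t \<le> a")
        case False
        have "dist (x + a *\<^sub>R \<theta>) (x + t *\<^sub>R \<theta>) = norm ((a - t) *\<^sub>R \<theta>)"
          by (simp add: dist_norm scaleR_diff_left)
        then have "x + t *\<^sub>R \<theta> \<in> ball (x + a *\<^sub>R \<theta>) e" using False t \<theta> by auto
        then show ?thesis using e by blast
      qed (use * t in auto)
    qed (use a e in auto)
    then show "\<exists>s\<in>?E. a < s" using e by force
  qed (use a in force)
  finally show ?thesis by (simp only: delta_dir_def)
qed

context
  fixes \<Omega> :: "'a::euclidean_space set" and \<theta> :: 'a
  assumes \<Omega>: "open \<Omega>" "bounded \<Omega>" and \<theta>: "norm \<theta> = 1"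
begin

lemma delta_dir_nonneg: "0 \<le> delta_dir \<Omega> \<theta> x"
  using delta_dir_bounded[OF \<Omega>(2)] \<theta> by metis

lemma delta_dir_pos: "x \<in> \<Omega> \<Longrightarrow> 0 < delta_dir \<Omega> \<theta> x"
  using delta_dir_greater_iff[OF \<Omega> \<theta>, of 0 x] by simp

lemma before_exit_in: "0 \<le> t \<Longrightarrow> t < delta_dir \<Omega> \<theta> x \<Longrightarrow> x + t *\<^sub>R \<theta> \<in> \<Omega>"
  using delta_dir_greater_iff[OF \<Omega> \<theta>, of t x] by simp

lemma exit_not_in: "Phi_dir \<Omega> \<theta> x \<notin> \<Omega>"
proof
  assume "Phi_dir \<Omega> \<theta> x \<in> \<Omega>"
  then have "\<forall>t\<in>{0..delta_dir \<Omega> \<theta> x}. x + t *\<^sub>R \<theta> \<in> \<Omega>"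
    using before_exit_in[of _ x] by (force simp: Phi_dir_def order_le_less)
  then show False
    using delta_dir_greater_iff[OF \<Omega> \<theta> delta_dir_nonneg, of x x] by blast
qed

lemma delta_dir_eqI:
  assumes "0 \<le> r" "\<And>t. 0 \<le> t \<Longrightarrow> t < r \<Longrightarrow> x + t *\<^sub>R \<theta> \<in> \<Omega>" "x + r *\<^sub>R \<theta> \<notin> \<Omega>"
  shows "delta_dir \<Omega> \<theta> x = r"
proof (rule antisym)
  show "delta_dir \<Omega> \<theta> x \<le> r"
    using before_exit_in[of r x] assms by (metis not_le)
  show "r \<le> delta_dir \<Omega> \<theta> x"
  proof (rule ccontr)
    assume *: "\<not> r \<le> delta_dir \<Omega> \<theta> x"
    have "Phi_dir \<Omega> \<theta> x \<in> \<Omega>"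
      unfolding Phi_dir_def using * delta_dir_nonneg[of x] by (intro assms(2)) auto
    then show False using exit_not_in by blast
  qed
qed

lemma borel_measurable_delta_dir [measurable]: "delta_dir \<Omega> \<theta> \<in> borel_measurable borel"
proof (rule borel_measurableI_greater)
  fix a
  show "{x \<in> space borel. a < delta_dir \<Omega> \<theta> x} \<in> sets borel"
  proof (cases "0 \<le> a")
    case True
    then have "{x \<in> space borel. a < delta_dir \<Omega> \<theta> x} = {x. \<forall>t\<in>{0..a}. x + t *\<^sub>R \<theta> \<in> \<Omega>}"
      using delta_dir_greater_iff[OF \<Omega> \<theta>] by auto
    then show ?thesis using open_segments_inside[OF \<Omega>(1)] by simp
  next
    case False
    then have "{x \<in> space borel. a < delta_dir \<Omega> \<theta> x} = UNIV"
      using delta_dir_nonneg by (auto simp: not_le intro: less_le_trans[of a 0])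
    then show ?thesis by simp
  qed
qed

lemma borel_measurable_Phi_dir [measurable]: "Phi_dir \<Omega> \<theta> \<in> borel_measurable borel"
  unfolding Phi_dir_def[abs_def] by measurable

lemma Phi_dir_frontier:
  assumes "x \<in> \<Omega>"
  shows "Phi_dir \<Omega> \<theta> x \<in> frontier \<Omega>"
proof -
  have "(\<lambda>n. x + (delta_dir \<Omega> \<theta> x * (1 - 1 / real (Suc n))) *\<^sub>R \<theta>) \<longlonglongrightarrow> x + (delta_dir \<Omega> \<theta> x * (1 - 0)) *\<^sub>R \<theta>"
    using LIMSEQ_inverse_real_of_nat by (intro tendsto_intros) (simp add: inverse_eq_divide)
  moreover have "x + (delta_dir \<Omega> \<theta> x * (1 - 1 / real (Suc n))) *\<^sub>R \<theta> \<in> \<Omega>" for n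
    using delta_dir_pos[OF assms] by (intro before_exit_in) (auto simp: field_simps)
  ultimately have "Phi_dir \<Omega> \<theta> x \<in> closure \<Omega>"
    unfolding closure_sequential Phi_dir_def by (intro exI conjI allI) auto
  then show ?thesis
    using exit_not_in \<Omega>(1) by (simp add: frontier_def interior_open)
qed

lemma measurable_Phi_dir:
  "Phi_dir \<Omega> \<theta> \<in> lebesgue_on \<Omega> \<rightarrow>\<^sub>M restrict_space borel (frontier \<Omega>)"
  by (intro measurable_restrict_space2 measurable_restrict_space1 measurable_completion)
    (auto simp: Phi_dir_frontier)

end

section \<open>Weak derivatives in one dimension\<close>

lemma AE_exists_in_interval:
  fixes a b :: real
  assumes "AE s in lborel. P s" "a < b"
  shows "\<exists>s\<in>{a<..<b}. P s"
proof (rule ccontr)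
  assume *: "\<not> (\<exists>s\<in>{a<..<b}. P s)"
  have "AE s in lborel. s \<notin> {a<..<b}"
    using assms(1) by eventually_elim (use * in auto)
  then have "{a<..<b} \<in> null_sets lborel"
    by (subst (asm) AE_iff_null_sets[symmetric]) auto
  then show False using assms(2) by (auto simp: null_sets_def)
qed

text \<open>
  The segments overlap in one point, so the integrands agree only almost everywhere.
\<close>

lemma seg_integral_add:
  fixes \<theta> :: "'a::euclidean_space"
  assumes int: "integrable lborel (\<lambda>t. V (x + t *\<^sub>R \<theta>))" and ab: "0 \<le> a" "0 \<le> b"
  shows "seg_integral \<theta> V (a + b) x = seg_integral \<theta> V a x + seg_integral \<theta> V b (x + a *\<^sub>R \<theta>)"
proof -
  let ?f = "\<lambda>t. V (x + t *\<^sub>R \<theta>)"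
  have [measurable]: "?f \<in> borel_measurable borel" using int by auto
  have cut: "integrable lborel (\<lambda>t. if p \<le> t \<and> t \<le> q then ?f t else 0)" for p q
    by (rule Bochner_Integration.integrable_bound[OF int]) auto
  have "seg_integral \<theta> V b (x + a *\<^sub>R \<theta>) = (\<integral>t. (if a \<le> t + a \<and> t + a \<le> a + b then ?f (t + a) else 0) \<partial>lborel)"
    unfolding seg_integral_def by (intro Bochner_Integration.integral_cong refl) (auto simp: algebra_simps)
  also have "\<dots> = (\<integral>t. (if a \<le> t \<and> t \<le> a + b then ?f t else 0) \<partial>lborel)"
    by (rule integral_lborel_shift) measurable
  finally have "seg_integral \<theta> V a x + seg_integral \<theta> V b (x + a *\<^sub>R \<theta>)
    = (\<integral>t. (if 0 \<le> t \<and> t \<le> a then ?f t else 0) + (if a \<le> t \<and> t \<le> a + b then ?f t else 0) \<partial>lborel)"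
    unfolding seg_integral_def[of \<theta> V a x]
    by (subst Bochner_Integration.integral_add[OF cut cut]) simp
  also have "\<dots> = seg_integral \<theta> V (a + b) x"
    unfolding seg_integral_def
  proof (rule integral_cong_AE)
    show "AE t in lborel. (if 0 \<le> t \<and> t \<le> a then ?f t else 0) + (if a \<le> t \<and> t \<le> a + b then ?f t else 0)
      = (if 0 \<le> t \<and> t \<le> a + b then ?f t else 0)"
      using AE_lborel_singleton[of a] by eventually_elim (use ab in auto)
  qed measurable
  finally show ?thesis by simp
qed

text \<open>
  In one dimension a function minus a primitive of its weak derivative is constant on intervals. The
  function \<open>F s = U s + (integral of V from s to \<beta>)\<close> has vanishing increments for every step \<open>h\<close> and
  almost every \<open>s\<close>; by Fubini, for almost every \<open>s\<close> it equals \<open>F s\<close> almost everywhere to the right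
  of \<open>s\<close>. Such \<open>s\<close> exist arbitrarily close to \<open>\<alpha>\<close>, and the constants agree because the intervals
  overlap.
\<close>

lemma primitive_constant_on_interval:
  fixes U V :: "real \<Rightarrow> real"
  assumes S: "open S" and U: "integrable lborel U" and V: "integrable lborel V"
    and wd: "\<And>\<phi>. \<phi> \<in> Cc_infinity S \<Longrightarrow>
      (\<integral>x. U x * frechet_derivative \<phi> (at x) 1 \<partial>lborel) = - (\<integral>x. V x * \<phi> x \<partial>lborel)"
    and sub: "{\<alpha><..<\<beta>} \<subseteq> S" and less: "\<alpha> < \<beta>"
  obtains c where "AE s in lborel. s \<in> {\<alpha><..<\<beta>} \<longrightarrow> U s + seg_integral 1 V (\<beta> - s) s = c"
proof -
  have [measurable]: "U \<in> borel_measurable borel" "V \<in> borel_measurable borel" using U V by auto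
  define F where "F s = U s + seg_integral 1 V (\<beta> - s) s" for s
  have [measurable]: "F \<in> borel_measurable borel" unfolding F_def[abs_def] by measurable
  let ?Q = "\<lambda>h s. 0 \<le> h \<longrightarrow> \<alpha> < s \<longrightarrow> s + h < \<beta> \<longrightarrow> F (s + h) = F s"
  have Q: "AE s in lborel. ?Q h s" for h
  proof (cases "0 \<le> h")
    case True
    have "AE s in lborel. (\<forall>t\<in>{0..h}. s + t *\<^sub>R 1 \<in> S) \<longrightarrow> U (s + h *\<^sub>R 1) - U s = seg_integral 1 V h s"
      by (rule weak_derivative_imp_increment[OF S U V wd True])
    then show ?thesis
    proof eventually_elim
      case (elim s)
      show ?case
      proof (intro impI)
        assume s: "\<alpha> < s" "s + h < \<beta>"
        then have "U (s + h) - U s = seg_integral 1 V h s"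
          using elim sub by (auto simp: subset_iff)
        moreover have "seg_integral 1 V (h + (\<beta> - (s + h))) s = seg_integral 1 V h s + seg_integral 1 V (\<beta> - (s + h)) (s + h *\<^sub>R 1)"
          using s True integrable_lborel_shift[OF V, of s] by (intro seg_integral_add) (auto simp: add.commute)
        ultimately show "F (s + h) = F s" by (simp add: F_def)
      qed
    qed
  qed auto
  have "{p \<in> space (lborel \<Otimes>\<^sub>M lborel). ?Q (fst p) (snd p)} \<in> sets (lborel \<Otimes>\<^sub>M lborel)"
    by measurable
  moreover have "AE h in lborel. AE s in lborel. ?Q h s"
    by (rule AE_I2) (rule Q)
  ultimately have ae: "AE s in lborel. AE h in lborel. ?Q h s"
    by (rule lborel_pair.AE_commute[THEN iffD1])
  have "\<exists>s\<in>{\<alpha><..<\<alpha> + (\<beta> - \<alpha>) / real (n + 2)}. AE h in lborel. ?Q h s" for n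
    by (rule AE_exists_in_interval[OF ae]) (use less in simp)
  then have "\<forall>n. \<exists>s. s \<in> {\<alpha><..<\<alpha> + (\<beta> - \<alpha>) / real (n + 2)} \<and> (AE h in lborel. ?Q h s)" by blast
  from choice[OF this] obtain \<sigma> where \<sigma>: "\<And>n. \<sigma> n \<in> {\<alpha><..<\<alpha> + (\<beta> - \<alpha>) / real (n + 2)}" "\<And>n. AE h in lborel. ?Q h (\<sigma> n)"
    by blast
  have \<sigma>\<beta>: "\<sigma> n < \<beta>" for n
  proof -
    have "(\<beta> - \<alpha>) / real (n + 2) \<le> (\<beta> - \<alpha>) / 1" using less by (intro divide_left_mono) auto
    then show ?thesis using \<sigma>(1)[of n] by simp
  qed
  have \<sigma>c: "AE r in lborel. \<sigma> n < r \<and> r < \<beta> \<longrightarrow> F r = F (\<sigma> n)" for n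
    using AE_lborel_shift[OF \<sigma>(2)[of n], of "- \<sigma> n"] by eventually_elim (use \<sigma>(1)[of n] in auto)
  \<comment> \<open>Both constants are attained almost everywhere to the right of the larger of the two points.\<close>
  have const: "F (\<sigma> n) = F (\<sigma> 0)" for n
  proof -
    have "AE r in lborel. (\<sigma> n < r \<and> r < \<beta> \<longrightarrow> F r = F (\<sigma> n)) \<and> (\<sigma> 0 < r \<and> r < \<beta> \<longrightarrow> F r = F (\<sigma> 0))"
      using \<sigma>c[of n] \<sigma>c[of 0] by eventually_elim auto
    from AE_exists_in_interval[OF this, of "max (\<sigma> n) (\<sigma> 0)" \<beta>] \<sigma>\<beta>[of n] \<sigma>\<beta>[of 0]
    show ?thesis by auto
  qed
  have "AE r in lborel. \<forall>n. \<sigma> n < r \<and> r < \<beta> \<longrightarrow> F r = F (\<sigma> n)"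
    using \<sigma>c by (simp add: AE_all_countable)
  then have "AE r in lborel. r \<in> {\<alpha><..<\<beta>} \<longrightarrow> U r + seg_integral 1 V (\<beta> - r) r = F (\<sigma> 0)"
  proof eventually_elim
    case (elim r)
    show ?case
    proof
      assume r: "r \<in> {\<alpha><..<\<beta>}"
      obtain n :: nat where n: "(\<beta> - \<alpha>) / (r - \<alpha>) < real n" using reals_Archimedean2 by blast
      then have "(\<beta> - \<alpha>) / real (n + 2) < r - \<alpha>"
        using r by (auto simp: field_simps)
      then have "\<sigma> n < r" using \<sigma>(1)[of n] by auto
      then show "U r + seg_integral 1 V (\<beta> - r) r = F (\<sigma> 0)"
        using elim r const[of n] by (auto simp: F_def)
    qed
  qed
  then show ?thesis by (rule that)
qed

lemma seg_integral_1_eq: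
  fixes V :: "real \<Rightarrow> real"
  assumes V: "integrable lborel V"
  shows "seg_integral 1 V (\<beta> - s) s = integral {s..\<beta>} V"
proof -
  have [measurable]: "V \<in> borel_measurable borel" using V by auto
  have "seg_integral 1 V (\<beta> - s) s = (\<integral>t. indicator {s..\<beta>} (t + s) *\<^sub>R V (t + s) \<partial>lborel)"
    unfolding seg_integral_def by (intro Bochner_Integration.integral_cong refl) (auto simp: indicator_def add.commute)
  also have "\<dots> = (\<integral>t. indicator {s..\<beta>} t *\<^sub>R V t \<partial>lborel)"
    by (rule integral_lborel_shift) measurable
  also have "\<dots> = integral {s..\<beta>} V"
    using set_borel_integral_eq_integral(2)[of "{s..\<beta>}" V] integrable_mult_indicator[OF _ V, of "{s..\<beta>}"]
    by (simp add: set_integrable_def set_lebesgue_integral_def)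
  finally show ?thesis .
qed

lemma continuous_on_seg_integral_1:
  fixes V :: "real \<Rightarrow> real"
  assumes V: "integrable lborel V"
  shows "continuous_on {\<alpha>..\<beta>} (\<lambda>s. seg_integral 1 V (\<beta> - s) s)"
proof -
  have "V integrable_on {\<alpha>..\<beta>}"
    using integrable_on_lborel[OF V] by (rule integrable_on_subinterval) simp
  then show ?thesis
    using indefinite_integral_continuous_1'[of V \<alpha> \<beta>] by (simp add: seg_integral_1_eq[OF V])
qed

text \<open>
  An interval of positive length meets every set of full measure, so \<open>\<beta>\<close> is a limit of points where
  \<open>f\<close> has the value \<open>c\<close>.
\<close>

lemma continuous_AE_const_endpoint:
  fixes f :: "real \<Rightarrow> real"
  assumes f: "continuous_on {\<alpha><..\<beta>} f" and less: "\<alpha> < \<beta>"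
    and ae: "AE s in lborel. s \<in> {\<alpha><..<\<beta>} \<longrightarrow> f s = c"
  shows "f \<beta> = c"
proof -
  have "\<exists>s\<in>{\<beta> - (\<beta> - \<alpha>) / real (n + 1)<..<\<beta>}. s \<in> {\<alpha><..<\<beta>} \<longrightarrow> f s = c" for n
    by (rule AE_exists_in_interval[OF ae]) (use less in simp)
  then obtain \<sigma> where \<sigma>: "\<And>n. \<sigma> n \<in> {\<beta> - (\<beta> - \<alpha>) / real (n + 1)<..<\<beta>}" "\<And>n. \<sigma> n \<in> {\<alpha><..<\<beta>} \<longrightarrow> f (\<sigma> n) = c"
    by metis
  have in_: "\<sigma> n \<in> {\<alpha><..<\<beta>}" for n
  proof -
    have "(\<beta> - \<alpha>) / real (n + 1) \<le> (\<beta> - \<alpha>) / 1" using less by (intro divide_left_mono) auto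
    then show ?thesis using \<sigma>(1)[of n] by simp
  qed
  have "\<sigma> \<longlonglongrightarrow> \<beta>"
  proof (rule tendsto_sandwich)
    have "(\<lambda>n. \<beta> - (\<beta> - \<alpha>) * inverse (real (Suc n))) \<longlonglongrightarrow> \<beta> - (\<beta> - \<alpha>) * 0"
      by (intro tendsto_intros LIMSEQ_inverse_real_of_nat)
    then show "(\<lambda>n. \<beta> - (\<beta> - \<alpha>) / real (n + 1)) \<longlonglongrightarrow> \<beta>" by (simp add: divide_inverse)
    show "(\<lambda>n. \<beta>) \<longlonglongrightarrow> \<beta>" by simp
  qed (use \<sigma>(1) in \<open>auto intro!: always_eventually less_imp_le\<close>)
  moreover have "\<sigma> n \<in> {\<alpha><..\<beta>}" for n using in_[of n] by auto
  ultimately have "(\<lambda>n. f (\<sigma> n)) \<longlonglongrightarrow> f \<beta>"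
    using f less by (intro continuous_on_tendsto_compose[OF f]) auto
  moreover have "f (\<sigma> n) = c" for n using \<sigma>(2) in_ by blast
  ultimately show ?thesis by (simp add: LIMSEQ_const_iff)
qed

section \<open>Slices and their components\<close>

lemma open_line_slice:
  fixes \<Omega> :: "'a::euclidean_space set"
  assumes "open \<Omega>" shows "open (line_slice \<Omega> \<theta> y)"
proof -
  have "line_slice \<Omega> \<theta> y = (\<lambda>s. s *\<^sub>R \<theta> + y) -` \<Omega>" by (auto simp: line_slice_def)
  then show ?thesis using assms by (auto intro!: open_vimage continuous_intros)
qed

text \<open>
  If an endpoint belonged to the set, adding it would give a larger connected subset.
\<close>

lemma open_interval_component_endpoints:
  fixes S :: "real set"
  assumes S: "open S" and C: "{\<alpha><..<\<beta>} \<in> components S"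
  shows "\<alpha> < \<beta>" "{\<alpha><..<\<beta>} \<subseteq> S" "\<alpha> \<notin> S" "\<beta> \<notin> S"
proof -
  have ne: "{\<alpha><..<\<beta>} \<noteq> {}" using in_components_nonempty[OF C] .
  then show less: "\<alpha> < \<beta>" by auto
  show sub: "{\<alpha><..<\<beta>} \<subseteq> S" using in_components_subset[OF C] .
  have max: "D = {\<alpha><..<\<beta>}" if "{\<alpha><..<\<beta>} \<subseteq> D" "D \<subseteq> S" "connected D" for D
    using C that ne unfolding in_components_maximal by blast
  show "\<beta> \<notin> S"
  proof
    assume "\<beta> \<in> S"
    then have "{\<alpha><..\<beta>} = {\<alpha><..<\<beta>}"
      using sub by (intro max) (auto simp: subset_iff order_le_less)
    then show False using less by (metis greaterThanAtMost_iff greaterThanLessThan_iff order_refl less_irrefl)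
  qed
  show "\<alpha> \<notin> S"
  proof
    assume "\<alpha> \<in> S"
    then have "{\<alpha>..<\<beta>} = {\<alpha><..<\<beta>}"
      using sub by (intro max) (auto simp: subset_iff order_le_less)
    then show False using less by (metis atLeastLessThan_iff greaterThanLessThan_iff order_refl less_irrefl)
  qed
qed

lemma open_interval_in_components:
  fixes S :: "real set"
  assumes "s \<in> {\<alpha><..<\<beta>}" "{\<alpha><..<\<beta>} \<subseteq> S" "\<alpha> \<notin> S" "\<beta> \<notin> S"
  shows "{\<alpha><..<\<beta>} \<in> components S"
proof -
  have "connected_component_set S s = {\<alpha><..<\<beta>}"
  proof
    show "{\<alpha><..<\<beta>} \<subseteq> connected_component_set S s"
      using assms by (intro connected_component_maximal) auto
    show "connected_component_set S s \<subseteq> {\<alpha><..<\<beta>}"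
    proof
      fix r assume r: "r \<in> connected_component_set S s"
      have s: "s \<in> connected_component_set S s" using assms by (auto intro: connected_component_refl)
      have icc: "{a..b} \<subseteq> S" if "a \<in> connected_component_set S s" "b \<in> connected_component_set S s" for a b
        using connected_contains_Icc[OF connected_connected_component that] connected_component_subset by blast
      have "\<not> r \<le> \<alpha>" using subsetD[OF icc[OF r s], of \<alpha>] assms by auto
      moreover have "\<not> \<beta> \<le> r" using subsetD[OF icc[OF s r], of \<beta>] assms by auto
      ultimately show "r \<in> {\<alpha><..<\<beta>}" by auto
    qed
  qed
  then show ?thesis using assms unfolding components_iff by blast
qed

lemma countable_components_open:
  fixes S :: "'a::euclidean_space set"
  assumes "open S" shows "countable (components S)"
proof (rule countable_disjoint_open_subsets)
  show "pairwise disjnt (components S)"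
    using pairwise_disjoint_components[of S] by (simp add: pairwise_def disjnt_def)
  show "open C" if "C \<in> components S" for C
    using open_components[OF assms that] .
qed

context
  fixes \<Omega> :: "'a::euclidean_space set" and \<theta> :: 'a
  assumes \<Omega>: "open \<Omega>" "bounded \<Omega>" and \<theta>: "norm \<theta> = 1"
begin

lemma component_exit:
  assumes "{\<alpha><..<\<beta>} \<in> components (line_slice \<Omega> \<theta> y)" "s \<in> {\<alpha><..<\<beta>}"
  shows "delta_dir \<Omega> \<theta> (s *\<^sub>R \<theta> + y) = \<beta> - s" "Phi_dir \<Omega> \<theta> (s *\<^sub>R \<theta> + y) = \<beta> *\<^sub>R \<theta> + y"
proof -
  note I = open_interval_component_endpoints[OF open_line_slice[OF \<Omega>(1)] assms(1)]
  show *: "delta_dir \<Omega> \<theta> (s *\<^sub>R \<theta> + y) = \<beta> - s"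
  proof (rule delta_dir_eqI[OF \<Omega> \<theta>])
    show "s *\<^sub>R \<theta> + y + (\<beta> - s) *\<^sub>R \<theta> \<notin> \<Omega>"
      using I(4) by (simp add: line_slice_def algebra_simps)
    fix t assume t: "0 \<le> t" "t < \<beta> - s"
    then have "s + t \<in> line_slice \<Omega> \<theta> y" using I(2) assms(2) by (auto simp: subset_iff)
    then show "s *\<^sub>R \<theta> + y + t *\<^sub>R \<theta> \<in> \<Omega>" by (simp add: line_slice_def algebra_simps)
  qed (use assms(2) in auto)
  show "Phi_dir \<Omega> \<theta> (s *\<^sub>R \<theta> + y) = \<beta> *\<^sub>R \<theta> + y"
    unfolding Phi_dir_def * by (simp add: algebra_simps)
qed

text \<open>
  The component through a point is bounded by the exit points in the two opposite directions.
\<close>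

lemma component_exists:
  assumes "s *\<^sub>R \<theta> + y \<in> \<Omega>"
  defines "\<alpha> \<equiv> s - delta_dir \<Omega> (- \<theta>) (s *\<^sub>R \<theta> + y)" and "\<beta> \<equiv> s + delta_dir \<Omega> \<theta> (s *\<^sub>R \<theta> + y)"
  shows "{\<alpha><..<\<beta>} \<in> components (line_slice \<Omega> \<theta> y)" "s \<in> {\<alpha><..<\<beta>}"
proof -
  let ?x = "s *\<^sub>R \<theta> + y"
  have \<theta>': "norm (- \<theta>) = 1" using \<theta> by simp
  show s: "s \<in> {\<alpha><..<\<beta>}"
    using delta_dir_pos[OF \<Omega> \<theta> assms(1)] delta_dir_pos[OF \<Omega> \<theta>' assms(1)] by (auto simp: \<alpha>_def \<beta>_def)
  show "{\<alpha><..<\<beta>} \<in> components (line_slice \<Omega> \<theta> y)"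
  proof (rule open_interval_in_components[OF s])
    show "{\<alpha><..<\<beta>} \<subseteq> line_slice \<Omega> \<theta> y"
    proof
      fix r assume r: "r \<in> {\<alpha><..<\<beta>}"
      show "r \<in> line_slice \<Omega> \<theta> y"
      proof (cases "s \<le> r")
        case True
        then have "?x + (r - s) *\<^sub>R \<theta> \<in> \<Omega>"
          using r by (intro before_exit_in[OF \<Omega> \<theta>]) (auto simp: \<beta>_def)
        then show ?thesis by (simp add: line_slice_def algebra_simps)
      next
        case False
        then have "?x + (s - r) *\<^sub>R (- \<theta>) \<in> \<Omega>"
          using r by (intro before_exit_in[OF \<Omega> \<theta>']) (auto simp: \<alpha>_def)
        then show ?thesis by (simp add: line_slice_def algebra_simps)
      qed
    qed
    show "\<alpha> \<notin> line_slice \<Omega> \<theta> y"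
      using exit_not_in[OF \<Omega> \<theta>', of ?x] by (simp add: line_slice_def \<alpha>_def Phi_dir_def algebra_simps)
    show "\<beta> \<notin> line_slice \<Omega> \<theta> y"
      using exit_not_in[OF \<Omega> \<theta>, of ?x] by (simp add: line_slice_def \<beta>_def Phi_dir_def algebra_simps)
  qed
qed

text \<open>
  There are only countably many components.
\<close>

lemma AE_on_components_imp_AE_slice:
  assumes "\<And>\<alpha> \<beta>. {\<alpha><..<\<beta>} \<in> components (line_slice \<Omega> \<theta> y) \<Longrightarrow> AE s in lborel. s \<in> {\<alpha><..<\<beta>} \<longrightarrow> P s"
  shows "AE s in lborel. s *\<^sub>R \<theta> + y \<in> \<Omega> \<longrightarrow> P s"
proof -
  let ?K = "components (line_slice \<Omega> \<theta> y)"
  have "countable ?K" by (intro countable_components_open open_line_slice \<Omega>)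
  moreover have "AE s in lborel. s \<in> C \<longrightarrow> P s" if C: "C \<in> ?K" for C
  proof -
    obtain s where s: "s \<in> C" using in_components_nonempty[OF C] by blast
    then have "s *\<^sub>R \<theta> + y \<in> \<Omega>" using in_components_subset[OF C] by (auto simp: line_slice_def)
    from component_exists[OF this] obtain \<alpha> \<beta> where I: "{\<alpha><..<\<beta>} \<in> ?K" "s \<in> {\<alpha><..<\<beta>}" by blast
    then have "C = {\<alpha><..<\<beta>}"
      using C s components_nonoverlap[OF C I(1)] by blast
    with assms I(1) show ?thesis by simp
  qed
  ultimately have "AE s in lborel. \<forall>C\<in>?K. s \<in> C \<longrightarrow> P s"
    by (subst AE_ball_countable) auto
  then show ?thesis
    by eventually_elim (use component_exists in blast)
qed

end

section \<open>Directional traces as values at the exit\<close>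

lemma AE_lines_integrable:
  fixes F :: "'a::euclidean_space \<Rightarrow> real"
  assumes \<theta>: "norm \<theta> = 1" and F: "integrable lborel F"
  shows "AE y in lborel_hyperplane \<theta>. integrable lborel (\<lambda>s. F (s *\<^sub>R \<theta> + y))"
proof -
  have [measurable]: "F \<in> borel_measurable borel" using F by auto
  have "(\<integral>\<^sup>+y. (\<integral>\<^sup>+s. ennreal (norm (F (s *\<^sub>R \<theta> + y))) \<partial>lborel) \<partial>lborel_hyperplane \<theta>) = (\<integral>\<^sup>+x. ennreal (norm (F x)) \<partial>lborel)"
    by (rule nn_integral_lborel_lines(1)[OF \<theta>, symmetric]) measurable
  also have "\<dots> \<noteq> \<infinity>" using F by (simp add: integrable_iff_bounded less_top)
  finally have "AE y in lborel_hyperplane \<theta>. (\<integral>\<^sup>+s. ennreal (norm (F (s *\<^sub>R \<theta> + y))) \<partial>lborel) \<noteq> \<infinity>"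
    by (intro nn_integral_PInf_AE) measurable
  then show ?thesis
    by eventually_elim (auto intro!: integrableI_bounded simp: less_top)
qed

lemma line_coordinates:
  assumes "norm \<theta> = 1"
  shows "proj_dir \<theta> x \<in> hyperplane \<theta>" "(x \<bullet> \<theta>) *\<^sub>R \<theta> + proj_dir \<theta> x = x"
    "y \<in> hyperplane \<theta> \<Longrightarrow> proj_dir \<theta> (s *\<^sub>R \<theta> + y) = y"
  using assms by (auto simp: proj_dir_def hyperplane_def inner_diff_left inner_add_left norm_eq_1)

text \<open>
  Throughout, \<open>V\<close> is the weak derivative of \<open>U\<close> in direction \<open>\<theta>\<close>, both in the form of Borel
  functions extended by zero.
\<close>

locale directional_weak_derivative =
  fixes \<Omega> :: "'a::euclidean_space set" and \<theta> :: 'a and U V :: "'a \<Rightarrow> real"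
  assumes \<Omega>: "open \<Omega>" "bounded \<Omega>" and \<theta>: "norm \<theta> = 1"
    and U: "U \<in> L2_ext \<Omega>" and V: "V \<in> L2_ext \<Omega>" and wd: "has_weak_deriv \<Omega> \<theta> U V"
begin

lemma measurable_UV [measurable]: "U \<in> borel_measurable borel" "V \<in> borel_measurable borel"
  using U V by (auto simp: L2_ext_def)

lemma integrable_UV: "integrable lborel U" "integrable lborel V"
  using L2_ext_integrable[OF \<Omega>(2)] U V by auto

lemma integrable_UV_sq: "integrable lborel (\<lambda>x. (U x)\<^sup>2)" "integrable lborel (\<lambda>x. (V x)\<^sup>2)"
  using U V by (auto simp: L2_ext_def)

definition good_line :: "'a \<Rightarrow> bool" where
  "good_line y \<longleftrightarrow> y \<in> hyperplane \<theta>
     \<and> integrable lborel (\<lambda>s. U (s *\<^sub>R \<theta> + y)) \<and> integrable lborel (\<lambda>s. V (s *\<^sub>R \<theta> + y))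
     \<and> (\<lambda>s. U (s *\<^sub>R \<theta> + y)) \<in> L2_ext (line_slice \<Omega> \<theta> y) \<and> (\<lambda>s. V (s *\<^sub>R \<theta> + y)) \<in> L2_ext (line_slice \<Omega> \<theta> y)
     \<and> has_weak_deriv (line_slice \<Omega> \<theta> y) 1 (\<lambda>s. U (s *\<^sub>R \<theta> + y)) (\<lambda>s. V (s *\<^sub>R \<theta> + y))"

text \<open>
  The increments for the steps \<open>1/(n+1)\<close> hold at almost every point, hence almost everywhere on
  almost every line, and on a line they give back a weak derivative. This avoids the choice of a
  countable dense set of test functions on the lines.
\<close>

lemma AE_good_line: "AE y in lborel_hyperplane \<theta>. good_line y"
proof -
  let ?h = "\<lambda>n. 1 / real (Suc n)"
  let ?inc = "\<lambda>n x. (\<forall>t\<in>{0..?h n}. x + t *\<^sub>R \<theta> \<in> \<Omega>) \<longrightarrow> U (x + ?h n *\<^sub>R \<theta>) - U x = seg_integral \<theta> V (?h n) x"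
  have wd': "(\<integral>x. U x * frechet_derivative \<phi> (at x) \<theta> \<partial>lborel) = - (\<integral>x. V x * \<phi> x \<partial>lborel)"
    if "\<phi> \<in> Cc_infinity \<Omega>" for \<phi>
    using wd has_weak_deriv_iff_lborel[OF \<Omega>(1) U V] that by blast
  have "AE x in lborel. ?inc n x" for n
    by (rule weak_derivative_imp_increment[OF \<Omega>(1) integrable_UV wd']) auto
  then have "AE x in lborel. \<forall>n. ?inc n x" by (subst AE_all_countable) simp
  from AE_lborel_imp_AE_lines[OF \<theta> this]
  have inc: "AE y in lborel_hyperplane \<theta>. AE s in lborel. \<forall>n. ?inc n (s *\<^sub>R \<theta> + y)" .
  show ?thesis
    using inc AE_lines_integrable[OF \<theta> integrable_UV(1)] AE_lines_integrable[OF \<theta> integrable_UV(2)]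
      AE_lines_integrable[OF \<theta> integrable_UV_sq(1)] AE_lines_integrable[OF \<theta> integrable_UV_sq(2)]
      nn_integral_lborel_lines(2)[OF \<theta> measurable_UV(1)[THEN measurable_compose[OF _ measurable_ennreal]]]
  proof eventually_elim
    case (elim y)
    let ?U = "\<lambda>s. U (s *\<^sub>R \<theta> + y)" and ?V = "\<lambda>s. V (s *\<^sub>R \<theta> + y)"
    let ?S = "line_slice \<Omega> \<theta> y"
    have L2: "?U \<in> L2_ext ?S" "?V \<in> L2_ext ?S"
      using elim(4,5) U V by (auto simp: L2_ext_def line_slice_def)
    note S = open_line_slice[OF \<Omega>(1), of \<theta> y]
    have "has_weak_deriv ?S 1 ?U ?V"
      unfolding has_weak_deriv_iff_lborel[OF S L2]
    proof
      fix \<phi> assume \<phi>: "\<phi> \<in> Cc_infinity ?S"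
      show "(\<integral>x. ?U x * frechet_derivative \<phi> (at x) 1 \<partial>lborel) = - (\<integral>x. ?V x * \<phi> x \<partial>lborel)"
      proof (rule increment_imp_weak_derivative[OF S elim(2,3) _ \<phi>])
        fix n
        show "AE x in lborel. (\<forall>t\<in>{0..?h n}. x + t *\<^sub>R 1 \<in> ?S) \<longrightarrow> ?U (x + ?h n *\<^sub>R 1) - ?U x = seg_integral 1 ?V (?h n) x"
          using elim(1)
        proof eventually_elim
          case (elim s)
          have "seg_integral 1 ?V (?h n) s = seg_integral \<theta> V (?h n) (s *\<^sub>R \<theta> + y)"
            unfolding seg_integral_def by (simp add: algebra_simps cong: if_cong)
          moreover have "s *\<^sub>R \<theta> + y + t *\<^sub>R \<theta> = (s + t *\<^sub>R 1) *\<^sub>R \<theta> + y" for t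
            by (simp add: algebra_simps)
          ultimately show ?case
            using elim[THEN spec, of n] by (simp only: line_slice_def mem_Collect_eq)
        qed
      qed
    qed
    then show ?case using elim L2 by (simp add: good_line_def)
  qed
qed

lemma good_line_component:
  assumes y: "good_line y" and I: "{\<alpha><..<\<beta>} \<in> components (line_slice \<Omega> \<theta> y)"
  obtains c where "AE s in lborel. s \<in> {\<alpha><..<\<beta>} \<longrightarrow>
    U (s *\<^sub>R \<theta> + y) + seg_integral 1 (\<lambda>s. V (s *\<^sub>R \<theta> + y)) (\<beta> - s) s = c"
proof -
  note S = open_line_slice[OF \<Omega>(1), of \<theta> y]
  have y': "integrable lborel (\<lambda>s. U (s *\<^sub>R \<theta> + y))" "integrable lborel (\<lambda>s. V (s *\<^sub>R \<theta> + y))"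
    "(\<lambda>s. U (s *\<^sub>R \<theta> + y)) \<in> L2_ext (line_slice \<Omega> \<theta> y)" "(\<lambda>s. V (s *\<^sub>R \<theta> + y)) \<in> L2_ext (line_slice \<Omega> \<theta> y)"
    "has_weak_deriv (line_slice \<Omega> \<theta> y) 1 (\<lambda>s. U (s *\<^sub>R \<theta> + y)) (\<lambda>s. V (s *\<^sub>R \<theta> + y))"
    using y by (auto simp: good_line_def)
  note E = open_interval_component_endpoints[OF S I]
  show ?thesis
  proof (rule primitive_constant_on_interval[OF S y'(1,2) _ E(2,1)])
    show "(\<integral>x. U (x *\<^sub>R \<theta> + y) * frechet_derivative \<phi> (at x) 1 \<partial>lborel) = - (\<integral>x. V (x *\<^sub>R \<theta> + y) * \<phi> x \<partial>lborel)"
      if "\<phi> \<in> Cc_infinity (line_slice \<Omega> \<theta> y)" for \<phi>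
      using y'(5) that unfolding has_weak_deriv_iff_lborel[OF S y'(3,4)] by blast
  qed (rule that)
qed

text \<open>
  For almost every \<open>x\<close>, the value that the continuous representative of \<open>U\<close> on the segment from \<open>x\<close>
  to the boundary takes at the exit point.
\<close>

definition exit_value :: "'a \<Rightarrow> real" where
  "exit_value x = U x + seg_integral \<theta> V (delta_dir \<Omega> \<theta> x) x"

lemma measurable_exit_value [measurable]: "exit_value \<in> borel_measurable borel"
proof -
  note borel_measurable_delta_dir[OF \<Omega> \<theta>, measurable]
  show ?thesis unfolding exit_value_def[abs_def] by measurable
qed

lemma exit_value_on_component:
  assumes I: "{\<alpha><..<\<beta>} \<in> components (line_slice \<Omega> \<theta> y)" and s: "s \<in> {\<alpha><..<\<beta>}"
  shows "exit_value (s *\<^sub>R \<theta> + y) = U (s *\<^sub>R \<theta> + y) + seg_integral 1 (\<lambda>s. V (s *\<^sub>R \<theta> + y)) (\<beta> - s) s"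
  unfolding exit_value_def component_exit(1)[OF \<Omega> \<theta> I s] seg_integral_def
  by (simp add: algebra_simps cong: if_cong)

lemma exit_value_const_on_component:
  assumes y: "good_line y" and I: "{\<alpha><..<\<beta>} \<in> components (line_slice \<Omega> \<theta> y)"
  obtains c where "AE s in lborel. s \<in> {\<alpha><..<\<beta>} \<longrightarrow> exit_value (s *\<^sub>R \<theta> + y) = c"
proof -
  obtain c where c: "AE s in lborel. s \<in> {\<alpha><..<\<beta>} \<longrightarrow>
    U (s *\<^sub>R \<theta> + y) + seg_integral 1 (\<lambda>s. V (s *\<^sub>R \<theta> + y)) (\<beta> - s) s = c"
    by (rule good_line_component[OF y I])
  show ?thesis
    by (rule that[of c], use c in eventually_elim) (simp add: exit_value_on_component[OF I])
qed

text \<open>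
  On a good line \<open>exit_value\<close> is constant almost everywhere, but perhaps not everywhere, on a component. The
  average over the remaining segment is a Borel function that is constant on the whole component.
\<close>

definition exit_average :: "'a \<Rightarrow> real" where
  "exit_average x = seg_integral \<theta> exit_value (delta_dir \<Omega> \<theta> x) x / delta_dir \<Omega> \<theta> x"

lemma measurable_exit_average [measurable]: "exit_average \<in> borel_measurable borel"
proof -
  note borel_measurable_delta_dir[OF \<Omega> \<theta>, measurable]
  show ?thesis unfolding exit_average_def[abs_def] by measurable
qed

lemma exit_average_on_component:
  assumes I: "{\<alpha><..<\<beta>} \<in> components (line_slice \<Omega> \<theta> y)" and s: "s \<in> {\<alpha><..<\<beta>}"
    and c: "AE s in lborel. s \<in> {\<alpha><..<\<beta>} \<longrightarrow> exit_value (s *\<^sub>R \<theta> + y) = c"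
  shows "exit_average (s *\<^sub>R \<theta> + y) = c"
proof -
  have "seg_integral \<theta> exit_value (\<beta> - s) (s *\<^sub>R \<theta> + y) = (\<integral>t. indicator {0..\<beta> - s} t * c \<partial>lborel)"
    unfolding seg_integral_def
  proof (rule integral_cong_AE)
    show "AE t in lborel. (if 0 \<le> t \<and> t \<le> \<beta> - s then exit_value (s *\<^sub>R \<theta> + y + t *\<^sub>R \<theta>) else 0)
      = indicator {0..\<beta> - s} t * c"
      using AE_lborel_shift[OF c, of s] AE_lborel_singleton[of "\<beta> - s"]
    proof eventually_elim
      case (elim t)
      have *: "s *\<^sub>R \<theta> + y + t *\<^sub>R \<theta> = (t + s) *\<^sub>R \<theta> + y" by (simp add: algebra_simps)
      show ?case using elim s unfolding * by (auto simp: indicator_def)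
    qed
  qed measurable
  also have "\<dots> = (\<beta> - s) * c" using s by simp
  finally show ?thesis
    using s by (simp add: exit_average_def component_exit(1)[OF \<Omega> \<theta> I s])
qed

lemma AE_exit_average_eq: "AE x in lborel. x \<in> \<Omega> \<longrightarrow> exit_average x = exit_value x"
proof (rule AE_lines_imp_AE_lborel[OF \<theta>])
  have [measurable]: "\<Omega> \<in> sets borel" using \<Omega> by simp
  show "Measurable.pred borel (\<lambda>x. x \<in> \<Omega> \<longrightarrow> exit_average x = exit_value x)" by measurable
  show "AE y in lborel_hyperplane \<theta>. AE s in lborel. s *\<^sub>R \<theta> + y \<in> \<Omega> \<longrightarrow>
      exit_average (s *\<^sub>R \<theta> + y) = exit_value (s *\<^sub>R \<theta> + y)"
    using AE_good_line
  proof eventually_elim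
    case (elim y)
    show ?case
    proof (rule AE_on_components_imp_AE_slice[OF \<Omega> \<theta>])
      fix \<alpha> \<beta> assume I: "{\<alpha><..<\<beta>} \<in> components (line_slice \<Omega> \<theta> y)"
      obtain c where c: "AE s in lborel. s \<in> {\<alpha><..<\<beta>} \<longrightarrow> exit_value (s *\<^sub>R \<theta> + y) = c"
        by (rule exit_value_const_on_component[OF elim I])
      then show "AE s in lborel. s \<in> {\<alpha><..<\<beta>} \<longrightarrow> exit_average (s *\<^sub>R \<theta> + y) = exit_value (s *\<^sub>R \<theta> + y)"
        by eventually_elim (use exit_average_on_component[OF I _ c] in auto)
    qed
  qed
qed

text \<open>
  If \<open>g\<close> takes at the right end of each component the limit of a continuous representative, then its
  values at the exit points are the exit values. The function \<open>g\<close> is arbitrary and may be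
  nonmeasurable, so almost every line cannot be turned into almost every point by Fubini. Instead,
  \<open>g\<close> is compared with the Borel function \<open>exit_average\<close> at every point of a good line, and the union
  of the bad lines is contained in the preimage of a Borel null set of the hyperplane.
\<close>

lemma exit_limits_imp_exit_value:
  assumes g: "AE y in lborel_hyperplane \<theta>. \<forall>\<alpha> \<beta>. {\<alpha><..<\<beta>} \<in> components (line_slice \<Omega> \<theta> y) \<longrightarrow>
      (\<exists>v. (AE s in lborel. s \<in> {\<alpha><..<\<beta>} \<longrightarrow> v s = U (s *\<^sub>R \<theta> + y)) \<and> continuous_on {\<alpha><..\<beta>} v \<and> g (\<beta> *\<^sub>R \<theta> + y) = v \<beta>)"
  shows "AE x in lborel. x \<in> \<Omega> \<longrightarrow> g (Phi_dir \<Omega> \<theta> x) = exit_value x"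
proof -
  have "AE y in lborel_hyperplane \<theta>. \<forall>s. s *\<^sub>R \<theta> + y \<in> \<Omega> \<longrightarrow>
      g (Phi_dir \<Omega> \<theta> (s *\<^sub>R \<theta> + y)) = exit_average (s *\<^sub>R \<theta> + y)"
    using g AE_good_line
  proof eventually_elim
    case (elim y)
    show ?case
    proof (intro allI impI)
      fix s assume "s *\<^sub>R \<theta> + y \<in> \<Omega>"
      from component_exists[OF \<Omega> \<theta> this] obtain \<alpha> \<beta>
        where I: "{\<alpha><..<\<beta>} \<in> components (line_slice \<Omega> \<theta> y)" and s: "s \<in> {\<alpha><..<\<beta>}" by blast
      let ?V = "\<lambda>s. V (s *\<^sub>R \<theta> + y)"
      have V1: "integrable lborel ?V" using elim(2) by (simp add: good_line_def)
      obtain c where c: "AE s in lborel. s \<in> {\<alpha><..<\<beta>} \<longrightarrow> exit_value (s *\<^sub>R \<theta> + y) = c"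
        by (rule exit_value_const_on_component[OF elim(2) I])
      obtain v where v: "AE s in lborel. s \<in> {\<alpha><..<\<beta>} \<longrightarrow> v s = U (s *\<^sub>R \<theta> + y)"
        "continuous_on {\<alpha><..\<beta>} v" "g (\<beta> *\<^sub>R \<theta> + y) = v \<beta>"
        using elim(1) I by blast
      have "v \<beta> + seg_integral 1 ?V (\<beta> - \<beta>) \<beta> = c"
      proof (rule continuous_AE_const_endpoint[where f="\<lambda>s. v s + seg_integral 1 ?V (\<beta> - s) s" and \<alpha>=\<alpha>])
        show "continuous_on {\<alpha><..\<beta>} (\<lambda>s. v s + seg_integral 1 ?V (\<beta> - s) s)"
          using continuous_on_seg_integral_1[OF V1, of \<alpha> \<beta>]
          by (intro continuous_on_add v) (rule continuous_on_subset, auto)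
        show "\<alpha> < \<beta>" using s by auto
        show "AE s in lborel. s \<in> {\<alpha><..<\<beta>} \<longrightarrow> v s + seg_integral 1 ?V (\<beta> - s) s = c"
          using c v(1) by eventually_elim (auto simp: exit_value_on_component[OF I])
      qed
      moreover have "seg_integral 1 ?V (\<beta> - \<beta>) \<beta> = 0"
        by (subst seg_integral_1_eq[OF V1]) simp
      ultimately show "g (Phi_dir \<Omega> \<theta> (s *\<^sub>R \<theta> + y)) = exit_average (s *\<^sub>R \<theta> + y)"
        using exit_average_on_component[OF I s c] v(3) by (simp add: component_exit(2)[OF \<Omega> \<theta> I s])
    qed
  qed
  \<comment> \<open>The exceptional lines as a Borel set, so that Fubini applies to its preimage.\<close>
  then obtain N where N[measurable]: "N \<in> sets borel" "emeasure (lborel_hyperplane \<theta>) N = 0"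
    and good: "\<And>y s. y \<notin> N \<Longrightarrow> s *\<^sub>R \<theta> + y \<in> \<Omega> \<Longrightarrow>
      g (Phi_dir \<Omega> \<theta> (s *\<^sub>R \<theta> + y)) = exit_average (s *\<^sub>R \<theta> + y)"
    by (auto simp: eventually_ae_filter null_sets_def)
  have [measurable]: "proj_dir \<theta> \<in> borel_measurable borel" unfolding proj_dir_def[abs_def] by measurable
  have "AE x in lborel. proj_dir \<theta> x \<notin> N"
  proof (rule AE_lines_imp_AE_lborel[OF \<theta>])
    have "AE y in lborel_hyperplane \<theta>. y \<notin> N" using N by (intro AE_not_in) (auto simp: null_sets_def)
    with AE_good_line
    show "AE y in lborel_hyperplane \<theta>. AE s in lborel. proj_dir \<theta> (s *\<^sub>R \<theta> + y) \<notin> N"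
      by eventually_elim (simp add: line_coordinates(3)[OF \<theta>] good_line_def)
  qed measurable
  with AE_exit_average_eq show ?thesis
  proof eventually_elim
    case (elim x)
    then show ?case
      using good[of "proj_dir \<theta> x" "x \<bullet> \<theta>"] by (simp add: line_coordinates(2)[OF \<theta>])
  qed
qed

text \<open>
  Directional traces are exactly the functions whose values at the exit points are the exit values;
  this is one half, and \<open>exit_value_imp_directional_trace\<close> the other. The right hand side does not
  depend on lines any more, and it is linear and continuous in \<open>U\<close> and \<open>V\<close>.
\<close>

lemma directional_trace_imp_exit_value:
  assumes u: "AE x in lborel. x \<in> \<Omega> \<longrightarrow> u x = U x" and tr: "directional_trace \<Omega> \<theta> u g"
  shows "AE x in lborel. x \<in> \<Omega> \<longrightarrow> g (Phi_dir \<Omega> \<theta> x) = exit_value x"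
proof (rule exit_limits_imp_exit_value)
  have [measurable]: "\<Omega> \<in> sets borel" using \<Omega> by simp
  from tr obtain w A where w: "AE x in lebesgue_on \<Omega>. w x = u x"
    and A: "proj_dir \<theta> ` \<Omega> - A \<in> null_sets (completion (lborel_hyperplane \<theta>))"
    and comp: "\<And>y \<alpha> \<beta>. y \<in> A \<Longrightarrow> {\<alpha><..<\<beta>} \<in> components (line_slice \<Omega> \<theta> y) \<Longrightarrow>
      \<exists>v. (AE s in lebesgue_on {\<alpha><..<\<beta>}. v s = w (s *\<^sub>R \<theta> + y)) \<and> continuous_on {\<alpha><..\<beta>} v \<and> g (\<beta> *\<^sub>R \<theta> + y) = v \<beta>"
    unfolding directional_trace_def by blast
  have "AE x in lborel. x \<in> \<Omega> \<longrightarrow> w x = u x" using w by (simp add: AE_lebesgue_on_iff)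
  with u have "AE x in lborel. x \<in> \<Omega> \<longrightarrow> w x = U x" by eventually_elim auto
  note wU = AE_lborel_imp_AE_lines[OF \<theta> this]
  have "AE y in completion (lborel_hyperplane \<theta>). y \<notin> proj_dir \<theta> ` \<Omega> - A"
    by (rule AE_not_in[OF A])
  then have "AE y in lborel_hyperplane \<theta>. y \<notin> proj_dir \<theta> ` \<Omega> - A"
    by (simp add: AE_completion_iff)
  with wU AE_good_line
  show "AE y in lborel_hyperplane \<theta>. \<forall>\<alpha> \<beta>. {\<alpha><..<\<beta>} \<in> components (line_slice \<Omega> \<theta> y) \<longrightarrow>
      (\<exists>v. (AE s in lborel. s \<in> {\<alpha><..<\<beta>} \<longrightarrow> v s = U (s *\<^sub>R \<theta> + y)) \<and> continuous_on {\<alpha><..\<beta>} v \<and> g (\<beta> *\<^sub>R \<theta> + y) = v \<beta>)"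
  proof eventually_elim
    case (elim y)
    show ?case
    proof (intro allI impI)
      fix \<alpha> \<beta> assume I: "{\<alpha><..<\<beta>} \<in> components (line_slice \<Omega> \<theta> y)"
      note E = open_interval_component_endpoints[OF open_line_slice[OF \<Omega>(1)] I]
      have "(\<alpha> + \<beta>) / 2 \<in> line_slice \<Omega> \<theta> y" using E(1,2) by auto
      then have "((\<alpha> + \<beta>) / 2) *\<^sub>R \<theta> + y \<in> \<Omega>" by (simp add: line_slice_def)
      then have "y \<in> proj_dir \<theta> ` \<Omega>"
        using line_coordinates(3)[OF \<theta>, of y "(\<alpha> + \<beta>) / 2"] elim by (force simp: good_line_def)
      then have "y \<in> A" using elim by blast
      from comp[OF this I] obtain v where v: "AE s in lebesgue_on {\<alpha><..<\<beta>}. v s = w (s *\<^sub>R \<theta> + y)"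
        "continuous_on {\<alpha><..\<beta>} v" "g (\<beta> *\<^sub>R \<theta> + y) = v \<beta>" by blast
      have "AE s in lborel. s \<in> {\<alpha><..<\<beta>} \<longrightarrow> v s = w (s *\<^sub>R \<theta> + y)"
        using v(1) by (simp add: AE_lebesgue_on_iff)
      with elim(1) have "AE s in lborel. s \<in> {\<alpha><..<\<beta>} \<longrightarrow> v s = U (s *\<^sub>R \<theta> + y)"
      proof eventually_elim
        case (elim s)
        then show ?case using E(2) by (auto simp: line_slice_def subset_iff)
      qed
      with v(2,3) show "\<exists>v. (AE s in lborel. s \<in> {\<alpha><..<\<beta>} \<longrightarrow> v s = U (s *\<^sub>R \<theta> + y)) \<and> continuous_on {\<alpha><..\<beta>} v \<and> g (\<beta> *\<^sub>R \<theta> + y) = v \<beta>"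
        by blast
    qed
  qed
qed

text \<open>
  Continuity on the closure gives a continuous representative on each component, right end included,
  so the boundary values of \<open>u\<close> itself are the limits that the criterion asks for.
\<close>

lemma continuous_imp_exit_value:
  assumes u: "AE x in lborel. x \<in> \<Omega> \<longrightarrow> u x = U x" and cont: "continuous_on (closure \<Omega>) u"
  shows "AE x in lborel. x \<in> \<Omega> \<longrightarrow> u (Phi_dir \<Omega> \<theta> x) = exit_value x"
proof (rule exit_limits_imp_exit_value)
  show "AE y in lborel_hyperplane \<theta>. \<forall>\<alpha> \<beta>. {\<alpha><..<\<beta>} \<in> components (line_slice \<Omega> \<theta> y) \<longrightarrow>
      (\<exists>v. (AE s in lborel. s \<in> {\<alpha><..<\<beta>} \<longrightarrow> v s = U (s *\<^sub>R \<theta> + y)) \<and> continuous_on {\<alpha><..\<beta>} v \<and> u (\<beta> *\<^sub>R \<theta> + y) = v \<beta>)"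
    using AE_lborel_imp_AE_lines[OF \<theta> u]
  proof eventually_elim
    case (elim y)
    show ?case
    proof (intro allI impI exI conjI)
      fix \<alpha> \<beta> assume I: "{\<alpha><..<\<beta>} \<in> components (line_slice \<Omega> \<theta> y)"
      note E = open_interval_component_endpoints[OF open_line_slice[OF \<Omega>(1)] I]
      show "AE s in lborel. s \<in> {\<alpha><..<\<beta>} \<longrightarrow> u (s *\<^sub>R \<theta> + y) = U (s *\<^sub>R \<theta> + y)"
        using elim by eventually_elim (use E(2) in \<open>auto simp: line_slice_def subset_iff\<close>)
      have "(\<alpha> + \<beta>) / 2 \<in> {\<alpha><..<\<beta>}" using E(1) by auto
      moreover from this have "((\<alpha> + \<beta>) / 2) *\<^sub>R \<theta> + y \<in> \<Omega>" using E(2) by (auto simp: line_slice_def subset_iff)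
      ultimately have "\<beta> *\<^sub>R \<theta> + y \<in> closure \<Omega>"
        using Phi_dir_frontier[OF \<Omega> \<theta>] component_exit(2)[OF \<Omega> \<theta> I] by (metis DiffD1 frontier_def)
      moreover have "s *\<^sub>R \<theta> + y \<in> closure \<Omega>" if "s \<in> {\<alpha><..<\<beta>}" for s
        using that E(2) closure_subset by (auto simp: line_slice_def subset_iff)
      ultimately have "s *\<^sub>R \<theta> + y \<in> closure \<Omega>" if "s \<in> {\<alpha><..\<beta>}" for s
        using that by (cases "s = \<beta>") auto
      then show "continuous_on {\<alpha><..\<beta>} (\<lambda>s. u (s *\<^sub>R \<theta> + y))"
        by (intro continuous_on_compose2[OF cont] continuous_intros) auto
    qed simp
  qed
qed

text \<open>
  On almost every line the identity holds almost everywhere on each component, so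
  \<open>g(exit point) - (integral of V up to the exit point)\<close> is a continuous representative of \<open>U\<close> there.
\<close>

lemma exit_value_imp_directional_trace:
  assumes u: "u \<in> W_dir \<Omega> \<theta>" "AE x in lborel. x \<in> \<Omega> \<longrightarrow> u x = U x"
    and g: "AE x in lborel. x \<in> \<Omega> \<longrightarrow> g (Phi_dir \<Omega> \<theta> x) = exit_value x"
  shows "directional_trace \<Omega> \<theta> u g"
proof -
  have [measurable]: "\<Omega> \<in> sets borel" using \<Omega> by simp
  define Q where "Q y \<longleftrightarrow> good_line y \<and> (AE s in lborel. s *\<^sub>R \<theta> + y \<in> \<Omega> \<longrightarrow>
    g (Phi_dir \<Omega> \<theta> (s *\<^sub>R \<theta> + y)) = exit_value (s *\<^sub>R \<theta> + y))" for y
  have "AE y in lborel_hyperplane \<theta>. Q y"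
    using AE_good_line AE_lborel_imp_AE_lines[OF \<theta> g] by eventually_elim (simp add: Q_def)
  then obtain N where N: "N \<in> null_sets (lborel_hyperplane \<theta>)" "{y. \<not> Q y} \<subseteq> N"
    by (auto simp: eventually_ae_filter)
  let ?A = "{y \<in> proj_dir \<theta> ` \<Omega>. Q y}"
  show ?thesis
    unfolding directional_trace_def
  proof (intro conjI exI[of _ U] exI[of _ ?A] u ballI allI impI)
    show "AE x in lebesgue_on \<Omega>. U x = u x"
      using u(2) by (subst AE_lebesgue_on_iff) (auto elim: eventually_mono)
    show "?A \<subseteq> proj_dir \<theta> ` \<Omega>" by auto
    show "proj_dir \<theta> ` \<Omega> - ?A \<in> null_sets (completion (lborel_hyperplane \<theta>))"
      using null_sets_completionI[OF N(1)] by (rule null_sets_completion_subset[rotated]) (use N(2) in auto)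
    fix y assume "y \<in> ?A"
    then have y: "good_line y" and gy: "AE s in lborel. s *\<^sub>R \<theta> + y \<in> \<Omega> \<longrightarrow>
      g (Phi_dir \<Omega> \<theta> (s *\<^sub>R \<theta> + y)) = exit_value (s *\<^sub>R \<theta> + y)" by (auto simp: Q_def)
    let ?U = "\<lambda>s. U (s *\<^sub>R \<theta> + y)" and ?V = "\<lambda>s. V (s *\<^sub>R \<theta> + y)"
    let ?S = "line_slice \<Omega> \<theta> y"
    note S = open_line_slice[OF \<Omega>(1), of \<theta> y]
    have "?U \<in> L2 (lebesgue_on ?S)" "?V \<in> L2 (lebesgue_on ?S)"
      using y L2_ext_imp_L2[OF S] by (auto simp: good_line_def)
    moreover have "has_weak_deriv ?S 1 ?U ?V" using y by (simp add: good_line_def)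
    ultimately show "?U \<in> H1 ?S" by (auto simp: H1_def W_dir_def)
    fix \<alpha> \<beta> assume I: "{\<alpha><..<\<beta>} \<in> components ?S"
    note E = open_interval_component_endpoints[OF S I]
    have V1: "integrable lborel ?V" using y by (simp add: good_line_def)
    show "\<exists>v. (AE s in lebesgue_on {\<alpha><..<\<beta>}. v s = U (s *\<^sub>R \<theta> + y)) \<and> continuous_on {\<alpha><..\<beta>} v \<and> g (\<beta> *\<^sub>R \<theta> + y) = v \<beta>"
    proof (intro exI[of _ "\<lambda>s. g (\<beta> *\<^sub>R \<theta> + y) - seg_integral 1 ?V (\<beta> - s) s"] conjI)
      show "continuous_on {\<alpha><..\<beta>} (\<lambda>s. g (\<beta> *\<^sub>R \<theta> + y) - seg_integral 1 ?V (\<beta> - s) s)"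
        using continuous_on_seg_integral_1[OF V1, of \<alpha> \<beta>]
        by (intro continuous_on_diff continuous_on_const) (rule continuous_on_subset, auto)
      show "g (\<beta> *\<^sub>R \<theta> + y) = g (\<beta> *\<^sub>R \<theta> + y) - seg_integral 1 ?V (\<beta> - \<beta>) \<beta>"
        by (subst seg_integral_1_eq[OF V1]) simp
      have "AE s in lborel. s \<in> {\<alpha><..<\<beta>} \<longrightarrow> g (\<beta> *\<^sub>R \<theta> + y) - seg_integral 1 ?V (\<beta> - s) s = U (s *\<^sub>R \<theta> + y)"
        using gy
      proof eventually_elim
        case (elim s)
        show ?case
        proof
          assume s: "s \<in> {\<alpha><..<\<beta>}"
          then have "s *\<^sub>R \<theta> + y \<in> \<Omega>" using E(2) by (auto simp: line_slice_def subset_iff)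
          with elim show "g (\<beta> *\<^sub>R \<theta> + y) - seg_integral 1 ?V (\<beta> - s) s = U (s *\<^sub>R \<theta> + y)"
            by (simp add: component_exit(2)[OF \<Omega> \<theta> I s] exit_value_on_component[OF I s])
        qed
      qed
      then show "AE s in lebesgue_on {\<alpha><..<\<beta>}. g (\<beta> *\<^sub>R \<theta> + y) - seg_integral 1 ?V (\<beta> - s) s = U (s *\<^sub>R \<theta> + y)"
        by (subst AE_lebesgue_on_iff) auto
    qed
  qed
qed

end

section \<open>The trace inequality\<close>

text \<open>
  Expand the integral of \<open>(\<mu> f - m)\<^sup>2\<close>, where \<open>m\<close> is the integral of \<open>f\<close> and \<open>\<mu>\<close> the total mass.
\<close>

lemma square_integral_le:
  fixes f :: "'b \<Rightarrow> real"
  assumes "finite_measure M" and f[measurable]: "f \<in> borel_measurable M" and f2: "integrable M (\<lambda>x. (f x)\<^sup>2)"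
  shows "integrable M f" "(\<integral>x. f x \<partial>M)\<^sup>2 \<le> measure M (space M) * (\<integral>x. (f x)\<^sup>2 \<partial>M)"
proof -
  interpret finite_measure M by fact
  have "integrable M (\<lambda>x. 1 + (f x)\<^sup>2)" using f2 by simp
  then show f1: "integrable M f"
  proof (rule Bochner_Integration.integrable_bound)
    from abs_le_1_plus_square show "AE x in M. norm (f x) \<le> norm (1 + (f x)\<^sup>2)" by (intro AE_I2) auto
  qed simp
  let ?\<mu> = "measure M (space M)" and ?m = "\<integral>x. f x \<partial>M" and ?q = "\<integral>x. (f x)\<^sup>2 \<partial>M"
  show "?m\<^sup>2 \<le> ?\<mu> * ?q"
  proof (cases "?\<mu> = 0")
    case True
    then have "emeasure M (space M) = 0" by (simp add: emeasure_eq_measure)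
    then have "AE x in M. f x = 0" by (intro AE_I[where N="space M"]) auto
    then have "?m = 0" by (rule integral_eq_zero_AE)
    with True show ?thesis by simp
  next
    case False
    then have pos: "?\<mu> > 0" using measure_nonneg[of M "space M"] by linarith
    have "0 \<le> (\<integral>x. (?\<mu> * f x - ?m)\<^sup>2 \<partial>M)" by simp
    also have "\<dots> = (\<integral>x. ?\<mu>\<^sup>2 * (f x)\<^sup>2 - (2 * ?\<mu> * ?m) * f x + ?m\<^sup>2 \<partial>M)"
      by (intro Bochner_Integration.integral_cong refl) (simp add: power2_eq_square algebra_simps)
    also have "\<dots> = ?\<mu>\<^sup>2 * ?q - (2 * ?\<mu> * ?m) * ?m + ?\<mu> * ?m\<^sup>2"
      using f1 f2 by simp
    also have "\<dots> = ?\<mu> * (?\<mu> * ?q - ?m\<^sup>2)" by (simp add: power2_eq_square algebra_simps)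
    finally show ?thesis using pos by (simp add: zero_le_mult_iff)
  qed
qed

lemma square_set_integral_le:
  fixes f :: "'a::euclidean_space \<Rightarrow> real"
  assumes [measurable]: "A \<in> sets borel" "f \<in> borel_measurable borel" and A: "emeasure lborel A < \<infinity>"
    and f2: "integrable lborel (\<lambda>x. indicator A x * (f x)\<^sup>2)"
  shows "integrable lborel (\<lambda>x. indicator A x * f x)"
    "(\<integral>x. indicator A x * f x \<partial>lborel)\<^sup>2 \<le> measure lborel A * (\<integral>x. indicator A x * (f x)\<^sup>2 \<partial>lborel)"
proof -
  let ?M = "restrict_space lborel A"
  have fm: "finite_measure ?M"
    using A by (intro finite_measureI) (simp add: emeasure_restrict_space space_restrict_space)
  have m: "f \<in> borel_measurable ?M" by (intro measurable_restrict_space1) simp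
  have i: "integrable ?M (\<lambda>x. (f x)\<^sup>2)" using f2 by (subst integrable_restrict_space) auto
  note S = square_integral_le[OF fm m i]
  show "integrable lborel (\<lambda>x. indicator A x * f x)"
    using S(1) by (subst (asm) integrable_restrict_space) auto
  show "(\<integral>x. indicator A x * f x \<partial>lborel)\<^sup>2 \<le> measure lborel A * (\<integral>x. indicator A x * (f x)\<^sup>2 \<partial>lborel)"
    using S(2) by (simp add: integral_restrict_space measure_restrict_space space_restrict_space)
qed

lemma square_seg_integral_le:
  fixes \<theta> :: "'a::euclidean_space"
  assumes [measurable]: "V \<in> borel_measurable borel" and h: "0 \<le> h" "h \<le> D"
    and int: "integrable lborel (\<lambda>t. if 0 \<le> t \<and> t \<le> D then (V (x + t *\<^sub>R \<theta>))\<^sup>2 else 0)"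
  shows "(seg_integral \<theta> V h x)\<^sup>2 \<le> D * seg_integral \<theta> (\<lambda>z. (V z)\<^sup>2) D x"
proof -
  have if_ind: "(if 0 \<le> t \<and> t \<le> p then c else 0) = indicator {0..p} t * c" for t p c :: real
    by (auto simp: indicator_def)
  have sq: "integrable lborel (\<lambda>t. indicator {0..h} t * (V (x + t *\<^sub>R \<theta>))\<^sup>2)"
    using int by (rule Bochner_Integration.integrable_bound) (use h in \<open>auto simp: indicator_def\<close>)
  have "(seg_integral \<theta> V h x)\<^sup>2 = (\<integral>t. indicator {0..h} t * V (x + t *\<^sub>R \<theta>) \<partial>lborel)\<^sup>2"
    by (simp only: seg_integral_def if_ind)
  also have "\<dots> \<le> measure lborel {0..h} * (\<integral>t. indicator {0..h} t * (V (x + t *\<^sub>R \<theta>))\<^sup>2 \<partial>lborel)"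
    by (rule square_set_integral_le) (use sq h in auto)
  also have "\<dots> \<le> D * seg_integral \<theta> (\<lambda>z. (V z)\<^sup>2) D x"
  proof (rule mult_mono)
    show "(\<integral>t. indicator {0..h} t * (V (x + t *\<^sub>R \<theta>))\<^sup>2 \<partial>lborel) \<le> seg_integral \<theta> (\<lambda>z. (V z)\<^sup>2) D x"
      unfolding seg_integral_def using h by (intro integral_mono sq int) (auto simp: indicator_def)
    show "0 \<le> (\<integral>t. indicator {0..h} t * (V (x + t *\<^sub>R \<theta>))\<^sup>2 \<partial>lborel)"
      by (intro Bochner_Integration.integral_nonneg) auto
  qed (use h in auto)
  finally show ?thesis .
qed

text \<open>
  The trace inequality. The square of the segment integral is at most \<open>D\<close> times the integral of the
  square over a segment of length \<open>D\<close>, and integrating the latter over all starting points costs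
  another factor \<open>D\<close>. The constant does not depend on the direction.
\<close>

lemma (in directional_weak_derivative) exit_value_square_bound:
  assumes D: "\<And>x. delta_dir \<Omega> \<theta> x \<le> D" "0 \<le> D"
  shows "integrable lborel (\<lambda>x. indicator \<Omega> x * (exit_value x)\<^sup>2)"
    "(\<integral>x. indicator \<Omega> x * (exit_value x)\<^sup>2 \<partial>lborel) \<le> 2 * (\<integral>x. (U x)\<^sup>2 \<partial>lborel) + 2 * D\<^sup>2 * (\<integral>x. (V x)\<^sup>2 \<partial>lborel)"
proof -
  have [measurable]: "\<Omega> \<in> sets borel" using \<Omega> by simp
  let ?W = "\<lambda>x. 2 * (U x)\<^sup>2 + 2 * D * seg_integral \<theta> (\<lambda>z. (V z)\<^sup>2) D x"
  have W: "integrable lborel ?W"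
    by (intro Bochner_Integration.integrable_add integrable_mult_right integrable_UV_sq integrable_seg_integral(1))
  have le: "AE x in lborel. indicator \<Omega> x * (exit_value x)\<^sup>2 \<le> ?W x"
    using integrable_seg_integral(2)[OF integrable_UV_sq(2), of D \<theta>]
  proof eventually_elim
    case (elim x)
    have sg: "(seg_integral \<theta> V (delta_dir \<Omega> \<theta> x) x)\<^sup>2 \<le> D * seg_integral \<theta> (\<lambda>z. (V z)\<^sup>2) D x"
      using D delta_dir_nonneg[OF \<Omega> \<theta>] elim by (intro square_seg_integral_le) auto
    from square_add_le[of "U x" "seg_integral \<theta> V (delta_dir \<Omega> \<theta> x) x"] sg
    have "(exit_value x)\<^sup>2 \<le> ?W x" unfolding exit_value_def by linarith
    then show ?case
      using order_trans[OF zero_le_power2[of "exit_value x"]] by (auto simp: indicator_def)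
  qed
  show i: "integrable lborel (\<lambda>x. indicator \<Omega> x * (exit_value x)\<^sup>2)"
    using W
  proof (rule Bochner_Integration.integrable_bound)
    show "AE x in lborel. norm (indicator \<Omega> x * (exit_value x)\<^sup>2) \<le> norm (?W x)"
      using le by eventually_elim (auto simp: indicator_def)
  qed measurable
  have "(\<integral>x. indicator \<Omega> x * (exit_value x)\<^sup>2 \<partial>lborel) \<le> (\<integral>x. ?W x \<partial>lborel)"
    by (rule integral_mono_AE[OF i W le])
  also have "\<dots> = 2 * (\<integral>x. (U x)\<^sup>2 \<partial>lborel) + 2 * D * (D * (\<integral>x. (V x)\<^sup>2 \<partial>lborel))"
    using integrable_seg_integral(1)[OF integrable_UV_sq(2), of \<theta> D] integrable_seg_integral(3)[OF integrable_UV_sq(2) D(2), of \<theta>] integrable_UV_sq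
    by simp
  finally show "(\<integral>x. indicator \<Omega> x * (exit_value x)\<^sup>2 \<partial>lborel) \<le> 2 * (\<integral>x. (U x)\<^sup>2 \<partial>lborel) + 2 * D\<^sup>2 * (\<integral>x. (V x)\<^sup>2 \<partial>lborel)"
    by (simp add: power2_eq_square mult.assoc)
qed

section \<open>Linearity and uniqueness of weak derivatives\<close>

lemma L2_ext_zero: "(\<lambda>x. 0) \<in> L2_ext \<Omega>"
  by (simp add: L2_ext_def)

lemma L2_ext_scale: "F \<in> L2_ext \<Omega> \<Longrightarrow> (\<lambda>x. c * F x) \<in> L2_ext \<Omega>"
  by (auto simp: L2_ext_def power_mult_distrib)

lemma L2_ext_add:
  assumes "F \<in> L2_ext \<Omega>" "G \<in> L2_ext \<Omega>"
  shows "(\<lambda>x. F x + G x) \<in> L2_ext \<Omega>"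
proof -
  have [measurable]: "F \<in> borel_measurable borel" "G \<in> borel_measurable borel"
    using assms by (auto simp: L2_ext_def)
  have "integrable lborel (\<lambda>x. 2 * (F x)\<^sup>2 + 2 * (G x)\<^sup>2)"
    using assms by (auto simp: L2_ext_def)
  then have "integrable lborel (\<lambda>x. (F x + G x)\<^sup>2)"
  proof (rule Bochner_Integration.integrable_bound)
    from square_add_le show "AE x in lborel. norm ((F x + G x)\<^sup>2) \<le> norm (2 * (F x)\<^sup>2 + 2 * (G x)\<^sup>2)"
      by (intro AE_I2) (simp add: abs_of_nonneg)
  qed measurable
  with assms show ?thesis by (auto simp: L2_ext_def)
qed

lemma L2_ext_diff: "F \<in> L2_ext \<Omega> \<Longrightarrow> G \<in> L2_ext \<Omega> \<Longrightarrow> (\<lambda>x. F x - G x) \<in> L2_ext \<Omega>"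
  using L2_ext_add[OF _ L2_ext_scale[of G \<Omega> "-1"], of F] by simp

lemma L2_ext_sum: "finite I \<Longrightarrow> (\<And>i. i \<in> I \<Longrightarrow> F i \<in> L2_ext \<Omega>) \<Longrightarrow> (\<lambda>x. \<Sum>i\<in>I. c i * F i x) \<in> L2_ext \<Omega>"
  by (induction I rule: finite_induct) (auto intro!: L2_ext_zero L2_ext_add L2_ext_scale)

lemma has_weak_deriv_direction:
  fixes \<Omega> :: "'a::euclidean_space set"
  assumes \<Omega>: "open \<Omega>" "bounded \<Omega>" and U: "U \<in> L2_ext \<Omega>"
    and G: "\<And>b. b \<in> Basis \<Longrightarrow> G b \<in> L2_ext \<Omega>" "\<And>b. b \<in> Basis \<Longrightarrow> has_weak_deriv \<Omega> b U (G b)"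
  shows "has_weak_deriv \<Omega> \<theta> U (\<lambda>x. \<Sum>b\<in>Basis. (\<theta> \<bullet> b) * G b x)"
proof (subst has_weak_deriv_iff_lborel[OF \<Omega>(1) U])
  show "(\<lambda>x. \<Sum>b\<in>Basis. (\<theta> \<bullet> b) * G b x) \<in> L2_ext \<Omega>" by (intro L2_ext_sum G) auto
  show "\<forall>\<phi>\<in>Cc_infinity \<Omega>. (\<integral>x. U x * frechet_derivative \<phi> (at x) \<theta> \<partial>lborel)
    = - (\<integral>x. (\<Sum>b\<in>Basis. (\<theta> \<bullet> b) * G b x) * \<phi> x \<partial>lborel)"
  proof
    fix \<phi> assume \<phi>: "\<phi> \<in> Cc_infinity \<Omega>"
    have iU: "integrable lborel (\<lambda>x. U x * frechet_derivative \<phi> (at x) b)" for b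
      by (intro Cc_infinity_integrable_mult[OF \<phi>] L2_ext_integrable[OF \<Omega>(2)] U)
    have iG: "integrable lborel (\<lambda>x. G b x * \<phi> x)" if "b \<in> Basis" for b
      by (intro Cc_infinity_integrable_mult[OF \<phi>] L2_ext_integrable[OF \<Omega>(2)] G that)
    have "(\<integral>x. U x * frechet_derivative \<phi> (at x) \<theta> \<partial>lborel)
      = (\<integral>x. (\<Sum>b\<in>Basis. (\<theta> \<bullet> b) * (U x * frechet_derivative \<phi> (at x) b)) \<partial>lborel)"
      by (intro Bochner_Integration.integral_cong refl, subst Cc_infinity_derivative_sum[OF \<phi>])
        (simp add: sum_distrib_left algebra_simps)
    also have "\<dots> = (\<Sum>b\<in>Basis. (\<theta> \<bullet> b) * (\<integral>x. U x * frechet_derivative \<phi> (at x) b \<partial>lborel))"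
      using iU by (subst Bochner_Integration.integral_sum) auto
    also have "\<dots> = (\<Sum>b\<in>Basis. (\<theta> \<bullet> b) * (- (\<integral>x. G b x * \<phi> x \<partial>lborel)))"
    proof (intro sum.cong refl)
      fix b :: 'a assume b: "b \<in> Basis"
      have "(\<integral>x. U x * frechet_derivative \<phi> (at x) b \<partial>lborel) = - (\<integral>x. G b x * \<phi> x \<partial>lborel)"
        using G(2)[OF b] \<phi> unfolding has_weak_deriv_iff_lborel[OF \<Omega>(1) U G(1)[OF b]] by blast
      then show "(\<theta> \<bullet> b) * (\<integral>x. U x * frechet_derivative \<phi> (at x) b \<partial>lborel) = (\<theta> \<bullet> b) * (- (\<integral>x. G b x * \<phi> x \<partial>lborel))"
        by simp
    qed
    also have "\<dots> = - (\<integral>x. (\<Sum>b\<in>Basis. (\<theta> \<bullet> b) * (G b x * \<phi> x)) \<partial>lborel)"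
      using iG by (subst Bochner_Integration.integral_sum) (auto simp: sum_negf)
    also have "(\<lambda>x. \<Sum>b\<in>Basis. (\<theta> \<bullet> b) * (G b x * \<phi> x)) = (\<lambda>x. (\<Sum>b\<in>Basis. (\<theta> \<bullet> b) * G b x) * \<phi> x)"
      by (simp add: sum_distrib_right mult.assoc)
    finally show "(\<integral>x. U x * frechet_derivative \<phi> (at x) \<theta> \<partial>lborel)
      = - (\<integral>x. (\<Sum>b\<in>Basis. (\<theta> \<bullet> b) * G b x) * \<phi> x \<partial>lborel)" .
  qed
qed

lemma has_weak_deriv_diff:
  fixes \<Omega> :: "'a::euclidean_space set"
  assumes \<Omega>: "open \<Omega>" "bounded \<Omega>" and L2: "U \<in> L2_ext \<Omega>" "V \<in> L2_ext \<Omega>" "U' \<in> L2_ext \<Omega>" "V' \<in> L2_ext \<Omega>"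
    and wd: "has_weak_deriv \<Omega> \<theta> U V" "has_weak_deriv \<Omega> \<theta> U' V'"
  shows "has_weak_deriv \<Omega> \<theta> (\<lambda>x. U x - U' x) (\<lambda>x. V x - V' x)"
  unfolding has_weak_deriv_iff_lborel[OF \<Omega>(1) L2_ext_diff[OF L2(1,3)] L2_ext_diff[OF L2(2,4)]]
proof
  fix \<phi> assume \<phi>: "\<phi> \<in> Cc_infinity \<Omega>"
  note i = Cc_infinity_integrable_mult[OF \<phi> L2_ext_integrable[OF \<Omega>(2)]]
  show "(\<integral>x. (U x - U' x) * frechet_derivative \<phi> (at x) \<theta> \<partial>lborel) = - (\<integral>x. (V x - V' x) * \<phi> x \<partial>lborel)"
    using wd \<phi> i L2 unfolding has_weak_deriv_iff_lborel[OF \<Omega>(1) L2(1,2)] has_weak_deriv_iff_lborel[OF \<Omega>(1) L2(3,4)]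
    by (simp add: left_diff_distrib)
qed

text \<open>
  The difference of two weak derivatives is orthogonal to all test functions.
\<close>

lemma weak_deriv_unique:
  fixes \<Omega> :: "'a::euclidean_space set"
  assumes \<Omega>: "open \<Omega>" "bounded \<Omega>" and L2: "U \<in> L2_ext \<Omega>" "V \<in> L2_ext \<Omega>" "V' \<in> L2_ext \<Omega>"
    and wd: "has_weak_deriv \<Omega> \<theta> U V" "has_weak_deriv \<Omega> \<theta> U V'"
  shows "AE x in lborel. V x = V' x"
proof -
  have "AE x in lborel. x \<in> \<Omega> \<longrightarrow> V x - V' x = 0"
  proof (rule fundamental_lemma[OF _ \<Omega>(1)])
    show "integrable lborel (\<lambda>x. V x - V' x)"
      using L2 by (intro Bochner_Integration.integrable_diff L2_ext_integrable[OF \<Omega>(2)])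
    fix \<psi> assume \<psi>: "\<psi> \<in> Cc_infinity \<Omega>"
    note i = Cc_infinity_integrable_mult[OF \<psi> L2_ext_integrable[OF \<Omega>(2)]]
    show "(\<integral>x. (V x - V' x) * \<psi> x \<partial>lborel) = 0"
      using wd \<psi> i L2 unfolding has_weak_deriv_iff_lborel[OF \<Omega>(1) L2(1,2)] has_weak_deriv_iff_lborel[OF \<Omega>(1) L2(1,3)]
      by (simp add: left_diff_distrib)
  qed
  then show ?thesis
    by eventually_elim (use L2(2,3) in \<open>auto simp: L2_ext_def\<close>)
qed

section \<open>Representations in the Sobolev space\<close>

text \<open>
  The functions that \<open>weak_deriv\<close> chooses need not be Borel on the whole space, so the proofs carry
  Borel representatives of \<open>u\<close> and of its partial derivatives along.
\<close>

definition H1_rep :: "'a::euclidean_space set \<Rightarrow> ('a \<Rightarrow> real) \<Rightarrow> ('a \<Rightarrow> real) \<Rightarrow> ('a \<Rightarrow> 'a \<Rightarrow> real) \<Rightarrow> bool" where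
  "H1_rep \<Omega> u U G \<longleftrightarrow> u \<in> borel_measurable (lebesgue_on \<Omega>) \<and> U \<in> L2_ext \<Omega> \<and> (AE x in lborel. x \<in> \<Omega> \<longrightarrow> u x = U x)
     \<and> (\<forall>b\<in>Basis. G b \<in> L2_ext \<Omega> \<and> has_weak_deriv \<Omega> b U (G b))"

lemma L2_ext_AE_eq:
  fixes \<Omega> :: "'a::euclidean_space set"
  assumes \<Omega>: "open \<Omega>" and u: "u \<in> borel_measurable (lebesgue_on \<Omega>)" and U: "U \<in> L2_ext \<Omega>"
    and eq: "AE x in lborel. x \<in> \<Omega> \<longrightarrow> u x = U x"
  shows "u \<in> L2 (lebesgue_on \<Omega>)" "(\<integral>x. (u x)\<^sup>2 \<partial>lebesgue_on \<Omega>) = (\<integral>x. (U x)\<^sup>2 \<partial>lborel)"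
proof -
  have UL: "U \<in> L2 (lebesgue_on \<Omega>)" by (rule L2_ext_imp_L2[OF \<Omega> U])
  have "AE x in lebesgue_on \<Omega>. (U x)\<^sup>2 = (u x)\<^sup>2"
    using eq \<Omega> by (subst AE_lebesgue_on_iff) (auto elim: eventually_mono)
  then have *: "integrable (lebesgue_on \<Omega>) (\<lambda>x. (u x)\<^sup>2)"
    "(\<integral>x. (U x)\<^sup>2 \<partial>lebesgue_on \<Omega>) = (\<integral>x. (u x)\<^sup>2 \<partial>lebesgue_on \<Omega>)"
    using UL u by (auto intro!: integrable_cong_AE_imp[where g="\<lambda>x. (U x)\<^sup>2"] integral_cong_AE simp: L2_def)
  from *(1) u show "u \<in> L2 (lebesgue_on \<Omega>)" by (simp add: L2_def)
  have "(\<integral>x. (U x)\<^sup>2 \<partial>lebesgue_on \<Omega>) = (\<integral>x. (U x)\<^sup>2 \<partial>lborel)"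
    using U \<Omega> by (intro integral_lebesgue_on_borel(2)) (auto simp: L2_ext_def)
  with *(2) show "(\<integral>x. (u x)\<^sup>2 \<partial>lebesgue_on \<Omega>) = (\<integral>x. (U x)\<^sup>2 \<partial>lborel)" by simp
qed

lemma has_weak_deriv_rep:
  fixes \<Omega> :: "'a::euclidean_space set"
  assumes \<Omega>: "open \<Omega>" and u: "u \<in> borel_measurable (lebesgue_on \<Omega>)" and U: "U \<in> L2_ext \<Omega>"
    and eq: "AE x in lborel. x \<in> \<Omega> \<longrightarrow> u x = U x"
    and v: "v \<in> borel_measurable (lebesgue_on \<Omega>)" and V: "V \<in> L2_ext \<Omega>"
    and eqv: "AE x in lborel. x \<in> \<Omega> \<longrightarrow> v x = V x"
  shows "has_weak_deriv \<Omega> \<theta> u v \<longleftrightarrow> has_weak_deriv \<Omega> \<theta> U V"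
  using L2_ext_imp_L2[OF \<Omega> U] L2_ext_imp_L2[OF \<Omega> V] \<Omega>
  by (intro has_weak_deriv_cong_AE eq eqv u v) (auto simp: L2_def)

lemma H1_rep_W_dir:
  fixes \<Omega> :: "'a::euclidean_space set"
  assumes \<Omega>: "open \<Omega>" "bounded \<Omega>" and r: "H1_rep \<Omega> u U G"
  shows "u \<in> W_dir \<Omega> \<theta>"
proof -
  let ?V = "\<lambda>x. \<Sum>b\<in>Basis. (\<theta> \<bullet> b) * G b x"
  have V: "?V \<in> L2_ext \<Omega>" using r by (intro L2_ext_sum) (auto simp: H1_rep_def)
  have "has_weak_deriv \<Omega> \<theta> U ?V" using r by (intro has_weak_deriv_direction \<Omega>) (auto simp: H1_rep_def)
  moreover have "?V \<in> L2 (lebesgue_on \<Omega>)" by (rule L2_ext_imp_L2[OF \<Omega>(1) V])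
  moreover have "has_weak_deriv \<Omega> \<theta> u ?V \<longleftrightarrow> has_weak_deriv \<Omega> \<theta> U ?V"
    using r calculation(2) by (intro has_weak_deriv_rep \<Omega> V) (auto simp: H1_rep_def L2_def)
  moreover have "u \<in> L2 (lebesgue_on \<Omega>)"
    using r by (intro L2_ext_AE_eq(1)[OF \<Omega>(1)]) (auto simp: H1_rep_def)
  ultimately show ?thesis by (auto simp: W_dir_def)
qed

lemma H1_rep_imp_H1:
  assumes "open \<Omega>" "bounded \<Omega>" "H1_rep \<Omega> u U G"
  shows "u \<in> H1 \<Omega>"
  using H1_rep_W_dir[OF assms] by (auto simp: H1_def W_dir_def)

lemma H1_rep_exists:
  fixes \<Omega> :: "'a::euclidean_space set"
  assumes \<Omega>: "open \<Omega>" and u: "u \<in> H1 \<Omega>"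
  obtains U G where "H1_rep \<Omega> u U G"
proof -
  have u2: "u \<in> L2 (lebesgue_on \<Omega>)" using u by (simp add: H1_def)
  obtain U where U: "U \<in> L2_ext \<Omega>" "AE x in lborel. x \<in> \<Omega> \<longrightarrow> u x = U x"
    using L2_ext_exists[OF \<Omega> u2] by blast
  have "\<exists>V. V \<in> L2_ext \<Omega> \<and> has_weak_deriv \<Omega> b U V" if "b \<in> Basis" for b
  proof -
    have "u \<in> W_dir \<Omega> b" using u that by (simp add: H1_def)
    then have "\<exists>v\<in>L2 (lebesgue_on \<Omega>). has_weak_deriv \<Omega> b u v" by (simp add: W_dir_def)
    then obtain v where v: "v \<in> L2 (lebesgue_on \<Omega>)" "has_weak_deriv \<Omega> b u v" ..
    obtain V where V: "V \<in> L2_ext \<Omega>" "AE x in lborel. x \<in> \<Omega> \<longrightarrow> v x = V x"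
      using L2_ext_exists[OF \<Omega> v(1)] by blast
    have "has_weak_deriv \<Omega> b U V"
      using has_weak_deriv_rep[OF \<Omega> _ U _ V] u2 v by (auto simp: L2_def)
    with V show ?thesis by blast
  qed
  then have "\<forall>b. \<exists>V. b \<in> Basis \<longrightarrow> V \<in> L2_ext \<Omega> \<and> has_weak_deriv \<Omega> b U V" by blast
  from choice[OF this] obtain G where "\<forall>b\<in>Basis. G b \<in> L2_ext \<Omega> \<and> has_weak_deriv \<Omega> b U (G b)" by blast
  then show ?thesis using u2 U by (intro that[of U G]) (auto simp: H1_rep_def L2_def)
qed

text \<open>
  The norm is defined through an arbitrary choice of weak derivatives; by uniqueness it can be
  computed from any representation.
\<close>

lemma H1_rep_norm:
  fixes \<Omega> :: "'a::euclidean_space set"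
  assumes \<Omega>: "open \<Omega>" "bounded \<Omega>" and r: "H1_rep \<Omega> u U G"
  shows "(H1_norm \<Omega> u)\<^sup>2 = (\<integral>x. (U x)\<^sup>2 \<partial>lborel) + (\<Sum>b\<in>Basis. \<integral>x. (G b x)\<^sup>2 \<partial>lborel)"
proof -
  have r': "u \<in> borel_measurable (lebesgue_on \<Omega>)" "U \<in> L2_ext \<Omega>" "AE x in lborel. x \<in> \<Omega> \<longrightarrow> u x = U x"
    "\<And>b. b \<in> Basis \<Longrightarrow> G b \<in> L2_ext \<Omega>" "\<And>b. b \<in> Basis \<Longrightarrow> has_weak_deriv \<Omega> b U (G b)"
    using r by (auto simp: H1_rep_def)
  have wd: "(\<integral>x. (weak_deriv \<Omega> b u x)\<^sup>2 \<partial>lebesgue_on \<Omega>) = (\<integral>x. (G b x)\<^sup>2 \<partial>lborel)" if b: "b \<in> Basis" for b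
  proof -
    have "u \<in> W_dir \<Omega> b" by (rule H1_rep_W_dir[OF \<Omega> r])
    then have "\<exists>v. v \<in> L2 (lebesgue_on \<Omega>) \<and> has_weak_deriv \<Omega> b u v" by (auto simp: W_dir_def)
    from someI_ex[OF this] have v: "weak_deriv \<Omega> b u \<in> L2 (lebesgue_on \<Omega>)" "has_weak_deriv \<Omega> b u (weak_deriv \<Omega> b u)"
      by (auto simp: weak_deriv_def)
    obtain V where V: "V \<in> L2_ext \<Omega>" "AE x in lborel. x \<in> \<Omega> \<longrightarrow> weak_deriv \<Omega> b u x = V x"
      using L2_ext_exists[OF \<Omega>(1) v(1)] by blast
    have "has_weak_deriv \<Omega> b U V"
      using has_weak_deriv_rep[OF \<Omega>(1) r'(1,2,3) _ V] v by (auto simp: L2_def)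
    then have "AE x in lborel. V x = G b x"
      using r'(4,5)[OF b] by (intro weak_deriv_unique[OF \<Omega> r'(2) V(1)])
    then have "(\<integral>x. (V x)\<^sup>2 \<partial>lborel) = (\<integral>x. (G b x)\<^sup>2 \<partial>lborel)"
      using V(1) r'(4)[OF b] by (intro integral_cong_AE) (auto simp: L2_ext_def elim: eventually_mono)
    moreover have "(\<integral>x. (weak_deriv \<Omega> b u x)\<^sup>2 \<partial>lebesgue_on \<Omega>) = (\<integral>x. (V x)\<^sup>2 \<partial>lborel)"
      using v(1) by (intro L2_ext_AE_eq(2)[OF \<Omega>(1) _ V]) (simp add: L2_def)
    ultimately show ?thesis by simp
  qed
  have "(H1_norm \<Omega> u)\<^sup>2 = (\<integral>x. (u x)\<^sup>2 \<partial>lebesgue_on \<Omega>) + (\<Sum>b\<in>Basis. \<integral>x. (weak_deriv \<Omega> b u x)\<^sup>2 \<partial>lebesgue_on \<Omega>)"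
    unfolding H1_norm_def by (intro real_sqrt_pow2 add_nonneg_nonneg sum_nonneg Bochner_Integration.integral_nonneg) auto
  then show ?thesis
    using wd L2_ext_AE_eq(2)[OF \<Omega>(1) r'(1,2,3)] by simp
qed

lemma H1_rep_diff:
  fixes \<Omega> :: "'a::euclidean_space set"
  assumes \<Omega>: "open \<Omega>" "bounded \<Omega>" and r: "H1_rep \<Omega> u U G" "H1_rep \<Omega> v V H"
  shows "H1_rep \<Omega> (\<lambda>x. u x - v x) (\<lambda>x. U x - V x) (\<lambda>b x. G b x - H b x)"
  unfolding H1_rep_def
proof (intro conjI ballI)
  show "AE x in lborel. x \<in> \<Omega> \<longrightarrow> u x - v x = U x - V x"
    using r unfolding H1_rep_def by (auto elim: eventually_elim2)
qed (use r in \<open>auto simp: H1_rep_def intro!: L2_ext_diff has_weak_deriv_diff \<Omega>\<close>)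

lemma H1_rep_directional:
  fixes \<Omega> :: "'a::euclidean_space set"
  assumes \<Omega>: "open \<Omega>" "bounded \<Omega>" and \<theta>: "norm \<theta> = 1" and r: "H1_rep \<Omega> u U G"
  shows "directional_weak_derivative \<Omega> \<theta> U (\<lambda>x. \<Sum>b\<in>Basis. (\<theta> \<bullet> b) * G b x)"
  using r by unfold_locales (auto simp: H1_rep_def intro!: \<Omega> \<theta> L2_ext_sum has_weak_deriv_direction)

text \<open>
  The Cauchy-Schwarz inequality, together with \<open>norm \<theta> = 1\<close>.
\<close>

lemma directional_derivative_square_le:
  fixes G :: "'a::euclidean_space \<Rightarrow> 'a \<Rightarrow> real"
  assumes \<theta>: "norm \<theta> = 1" and G: "\<And>b. b \<in> Basis \<Longrightarrow> G b \<in> L2_ext \<Omega>"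
  shows "(\<integral>x. (\<Sum>b\<in>Basis. (\<theta> \<bullet> b) * G b x)\<^sup>2 \<partial>lborel) \<le> (\<Sum>b\<in>Basis. \<integral>x. (G b x)\<^sup>2 \<partial>lborel)"
proof -
  have int: "integrable lborel (\<lambda>x. (G b x)\<^sup>2)" if "b \<in> Basis" for b
    using G[OF that] by (simp add: L2_ext_def)
  have one: "(\<Sum>b\<in>Basis. (\<theta> \<bullet> b)\<^sup>2) = 1"
    using \<theta> by (simp add: norm_eq_1 euclidean_inner[of \<theta> \<theta>] power2_eq_square)
  have "(\<integral>x. (\<Sum>b\<in>Basis. (\<theta> \<bullet> b) * G b x)\<^sup>2 \<partial>lborel) \<le> (\<integral>x. (\<Sum>b\<in>Basis. (G b x)\<^sup>2) \<partial>lborel)"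
  proof (rule integral_mono)
    show "integrable lborel (\<lambda>x. (\<Sum>b\<in>Basis. (\<theta> \<bullet> b) * G b x)\<^sup>2)"
      using L2_ext_sum[of Basis G \<Omega> "\<lambda>b. \<theta> \<bullet> b"] G by (auto simp: L2_ext_def)
    show "integrable lborel (\<lambda>x. \<Sum>b\<in>Basis. (G b x)\<^sup>2)" by (intro Bochner_Integration.integrable_sum int)
    show "(\<Sum>b\<in>Basis. (\<theta> \<bullet> b) * G b x)\<^sup>2 \<le> (\<Sum>b\<in>Basis. (G b x)\<^sup>2)" for x
      using Cauchy_Schwarz_ineq_sum[of "\<lambda>b. \<theta> \<bullet> b" "\<lambda>b. G b x" Basis] by (simp add: one)
  qed
  also have "\<dots> = (\<Sum>b\<in>Basis. \<integral>x. (G b x)\<^sup>2 \<partial>lborel)" by (intro Bochner_Integration.integral_sum int)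
  finally show ?thesis .
qed

section \<open>Approximation at the exit points\<close>

text \<open>
  The sum of the functions has a finite integral, so it is finite almost everywhere.
\<close>

lemma AE_tendsto_0_of_geometric_integrals:
  fixes f :: "nat \<Rightarrow> 'b \<Rightarrow> real"
  assumes int: "\<And>n. integrable M (f n)" and nonneg: "\<And>n x. 0 \<le> f n x"
    and le: "\<And>n. (\<integral>x. f n x \<partial>M) \<le> C * q ^ n" and q: "0 \<le> q" "q < 1"
  shows "AE x in M. (\<lambda>n. f n x) \<longlonglongrightarrow> 0"
proof -
  have [measurable]: "f n \<in> borel_measurable M" for n using int by auto
  have sm: "summable (\<lambda>n. \<integral>x. f n x \<partial>M)"
  proof (rule summable_comparison_test')
    show "summable (\<lambda>n. C * q ^ n)" using q by (intro summable_mult summable_geometric) auto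
    show "norm (\<integral>x. f n x \<partial>M) \<le> C * q ^ n" for n
      using le[of n] Bochner_Integration.integral_nonneg[of M "f n"] nonneg by simp
  qed
  have "(\<integral>\<^sup>+x. (\<Sum>n. ennreal (f n x)) \<partial>M) = (\<Sum>n. \<integral>\<^sup>+x. ennreal (f n x) \<partial>M)"
    by (rule nn_integral_suminf) simp
  also have "\<dots> = (\<Sum>n. ennreal (\<integral>x. f n x \<partial>M))"
    by (intro suminf_cong nn_integral_eq_integral int) (simp add: nonneg)
  also have "\<dots> \<noteq> \<infinity>"
    using sm nonneg by (subst suminf_ennreal2) (auto intro!: Bochner_Integration.integral_nonneg)
  finally have "AE x in M. (\<Sum>n. ennreal (f n x)) \<noteq> \<infinity>"
    by (intro nn_integral_PInf_AE) auto
  then show ?thesis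
  proof eventually_elim
    case (elim x)
    then have "summable (\<lambda>n. f n x)"
      by (intro summable_suminf_not_top nonneg) simp
    then show ?case by (rule summable_LIMSEQ_zero)
  qed
qed

lemma exit_value_diff:
  fixes \<Omega> :: "'a::euclidean_space set"
  assumes "directional_weak_derivative \<Omega> \<theta> U V" "directional_weak_derivative \<Omega> \<theta> U' V'"
  shows "AE x in lborel. directional_weak_derivative.exit_value \<Omega> \<theta> (\<lambda>x. U x - U' x) (\<lambda>x. V x - V' x) x
    = directional_weak_derivative.exit_value \<Omega> \<theta> U V x - directional_weak_derivative.exit_value \<Omega> \<theta> U' V' x"
proof -
  interpret A: directional_weak_derivative \<Omega> \<theta> U V by fact
  interpret B: directional_weak_derivative \<Omega> \<theta> U' V' by fact
  have C: "directional_weak_derivative \<Omega> \<theta> (\<lambda>x. U x - U' x) (\<lambda>x. V x - V' x)"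
    by unfold_locales (intro A.\<Omega> A.\<theta> L2_ext_diff has_weak_deriv_diff A.U A.V B.U B.V A.wd B.wd)+
  obtain D where D: "D > 0" "\<And>x \<theta>. norm \<theta> = 1 \<Longrightarrow> 0 \<le> delta_dir \<Omega> \<theta> x \<and> delta_dir \<Omega> \<theta> x \<le> D"
    by (rule delta_dir_bounded[OF A.\<Omega>(2)]) (rule that)
  show ?thesis
    using integrable_seg_integral(2)[OF A.integrable_UV(2), of D \<theta>] integrable_seg_integral(2)[OF B.integrable_UV(2), of D \<theta>]
  proof eventually_elim
    case (elim x)
    let ?\<delta> = "delta_dir \<Omega> \<theta> x"
    have \<delta>: "0 \<le> ?\<delta>" "?\<delta> \<le> D" using D(2)[OF A.\<theta>, of x] by auto
    have "integrable lborel (\<lambda>t. if 0 \<le> t \<and> t \<le> ?\<delta> then V (x + t *\<^sub>R \<theta>) else 0)"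
      using elim(1) by (rule Bochner_Integration.integrable_bound) (use \<delta> in auto)
    moreover have "integrable lborel (\<lambda>t. if 0 \<le> t \<and> t \<le> ?\<delta> then V' (x + t *\<^sub>R \<theta>) else 0)"
      using elim(2) by (rule Bochner_Integration.integrable_bound) (use \<delta> in auto)
    ultimately have "seg_integral \<theta> V ?\<delta> x - seg_integral \<theta> V' ?\<delta> x = (\<integral>t. (if 0 \<le> t \<and> t \<le> ?\<delta> then V (x + t *\<^sub>R \<theta>) else 0)
        - (if 0 \<le> t \<and> t \<le> ?\<delta> then V' (x + t *\<^sub>R \<theta>) else 0) \<partial>lborel)"
      unfolding seg_integral_def by (rule Bochner_Integration.integral_diff[symmetric])
    also have "\<dots> = seg_integral \<theta> (\<lambda>x. V x - V' x) ?\<delta> x"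
      unfolding seg_integral_def by (intro Bochner_Integration.integral_cong refl) auto
    finally show ?case
      by (simp add: A.exit_value_def B.exit_value_def directional_weak_derivative.exit_value_def[OF C])
  qed
qed

abbreviation gradient_along :: "('a::euclidean_space \<Rightarrow> 'a \<Rightarrow> real) \<Rightarrow> 'a \<Rightarrow> 'a \<Rightarrow> real" where
  "gradient_along G \<theta> \<equiv> (\<lambda>x. \<Sum>b\<in>Basis. (\<theta> \<bullet> b) * G b x)"

abbreviation trace_at_exit :: "'a::euclidean_space set \<Rightarrow> ('a \<Rightarrow> real) \<Rightarrow> ('a \<Rightarrow> 'a \<Rightarrow> real) \<Rightarrow> 'a \<Rightarrow> 'a \<Rightarrow> real" where
  "trace_at_exit \<Omega> U G \<theta> \<equiv> directional_weak_derivative.exit_value \<Omega> \<theta> U (gradient_along G \<theta>)"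

text \<open>
  The order of the quantifiers matters: one constant serves all functions and all directions.
\<close>

lemma trace_at_exit_square_bound:
  fixes \<Omega> :: "'a::euclidean_space set"
  assumes \<Omega>: "open \<Omega>" "bounded \<Omega>"
  obtains D where "D > 0" "\<And>u U G \<theta>. H1_rep \<Omega> u U G \<Longrightarrow> norm \<theta> = 1 \<Longrightarrow>
    integrable lborel (\<lambda>x. indicator \<Omega> x * (trace_at_exit \<Omega> U G \<theta> x)\<^sup>2) \<and>
    (\<integral>x. indicator \<Omega> x * (trace_at_exit \<Omega> U G \<theta> x)\<^sup>2 \<partial>lborel) \<le> D * (H1_norm \<Omega> u)\<^sup>2"
proof -
  obtain D where D: "D > 0" "\<And>x \<theta>. norm \<theta> = 1 \<Longrightarrow> 0 \<le> delta_dir \<Omega> \<theta> x \<and> delta_dir \<Omega> \<theta> x \<le> D"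
    by (rule delta_dir_bounded[OF \<Omega>(2)]) (rule that)
  show ?thesis
  proof (rule that[of "2 + 2 * D\<^sup>2"])
    show "2 + 2 * D\<^sup>2 > 0" by (simp add: add_pos_nonneg)
    fix u U G and \<theta> :: 'a assume r: "H1_rep \<Omega> u U G" and \<theta>: "norm \<theta> = 1"
    interpret directional_weak_derivative \<Omega> \<theta> U "gradient_along G \<theta>"
      by (rule H1_rep_directional[OF \<Omega> \<theta> r])
    let ?a = "\<integral>x. (U x)\<^sup>2 \<partial>lborel" and ?b = "\<Sum>b\<in>Basis. \<integral>x. (G b x)\<^sup>2 \<partial>lborel"
    note B = exit_value_square_bound[of D]
    have nn: "0 \<le> ?a" "0 \<le> ?b" by (auto intro!: sum_nonneg)
    have "(\<integral>x. indicator \<Omega> x * (exit_value x)\<^sup>2 \<partial>lborel) \<le> 2 * ?a + 2 * D\<^sup>2 * (\<integral>x. (gradient_along G \<theta> x)\<^sup>2 \<partial>lborel)"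
      using B(2) D \<theta> by auto
    also have "\<dots> \<le> 2 * ?a + 2 * D\<^sup>2 * ?b"
      using directional_derivative_square_le[OF \<theta>, of G \<Omega>] r
      by (intro add_left_mono mult_left_mono) (auto simp: H1_rep_def)
    also have "\<dots> \<le> (2 + 2 * D\<^sup>2) * (?a + ?b)" using nn by (simp add: algebra_simps)
    finally show "integrable lborel (\<lambda>x. indicator \<Omega> x * (exit_value x)\<^sup>2) \<and>
      (\<integral>x. indicator \<Omega> x * (exit_value x)\<^sup>2 \<partial>lborel) \<le> (2 + 2 * D\<^sup>2) * (H1_norm \<Omega> u)\<^sup>2"
      using B(1) D \<theta> by (simp add: H1_rep_norm[OF \<Omega> r])
  qed
qed

text \<open>
  The trace inequality bounds the error at the exit points by a geometric series, so the error tends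
  to \<open>0\<close> almost everywhere. The approximating sequence is the same for all directions; its limit is
  therefore one function on the boundary that serves all of them.
\<close>

lemma approximation_converges_at_exit:
  fixes \<Omega> :: "'a::euclidean_space set"
  assumes \<Omega>: "open \<Omega>" "bounded \<Omega>" and \<theta>: "norm \<theta> = 1" and r: "H1_rep \<Omega> u U G"
    and v: "\<And>n. v n \<in> H1 \<Omega>" "\<And>n. continuous_on (closure \<Omega>) (v n)"
    and conv: "\<And>n. H1_norm \<Omega> (\<lambda>x. u x - v n x) < (1 / 2) ^ n"
  shows "AE x in lborel. x \<in> \<Omega> \<longrightarrow> (\<lambda>n. v n (Phi_dir \<Omega> \<theta> x)) \<longlonglongrightarrow> trace_at_exit \<Omega> U G \<theta> x"
proof -
  obtain C where C: "C > 0" "\<And>u U G \<theta>. H1_rep \<Omega> u U G \<Longrightarrow> norm \<theta> = 1 \<Longrightarrow>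
    integrable lborel (\<lambda>x. indicator \<Omega> x * (trace_at_exit \<Omega> U G \<theta> x)\<^sup>2) \<and>
    (\<integral>x. indicator \<Omega> x * (trace_at_exit \<Omega> U G \<theta> x)\<^sup>2 \<partial>lborel) \<le> C * (H1_norm \<Omega> u)\<^sup>2"
    by (rule trace_at_exit_square_bound[OF \<Omega>]) (rule that)
  have "\<exists>W H. H1_rep \<Omega> (v n) W H" for n using H1_rep_exists[OF \<Omega>(1) v(1)[of n]] by metis
  then have "\<forall>n. \<exists>p. H1_rep \<Omega> (v n) (fst p) (snd p)" by simp
  from choice[OF this] obtain p where p: "\<And>n. H1_rep \<Omega> (v n) (fst (p n)) (snd (p n))" by blast
  define W H where "W n = fst (p n)" and "H n = snd (p n)" for n
  have rv: "H1_rep \<Omega> (v n) (W n) (H n)" for n using p by (simp add: W_def H_def)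
  let ?D = "\<lambda>n x. U x - W n x" and ?E = "\<lambda>n b x. G b x - H n b x"
  have rd: "H1_rep \<Omega> (\<lambda>x. u x - v n x) (?D n) (?E n)" for n by (rule H1_rep_diff[OF \<Omega> r rv])
  have at: "AE x in lborel. x \<in> \<Omega> \<longrightarrow> v n (Phi_dir \<Omega> \<theta> x) = trace_at_exit \<Omega> (W n) (H n) \<theta> x" for n
    using rv[of n]
    by (intro directional_weak_derivative.continuous_imp_exit_value[OF H1_rep_directional[OF \<Omega> \<theta> rv]] v)
      (simp add: H1_rep_def)
  have diff: "AE x in lborel. trace_at_exit \<Omega> (?D n) (?E n) \<theta> x
      = trace_at_exit \<Omega> U G \<theta> x - trace_at_exit \<Omega> (W n) (H n) \<theta> x" for n
  proof -
    have "gradient_along (?E n) \<theta> = (\<lambda>x. gradient_along G \<theta> x - gradient_along (H n) \<theta> x)"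
      by (simp add: sum_subtractf right_diff_distrib)
    with exit_value_diff[OF H1_rep_directional[OF \<Omega> \<theta> r] H1_rep_directional[OF \<Omega> \<theta> rv[of n]]]
    show ?thesis by simp
  qed
  have "AE x in lborel. (\<lambda>n. indicator \<Omega> x * (trace_at_exit \<Omega> (?D n) (?E n) \<theta> x)\<^sup>2) \<longlonglongrightarrow> 0"
  proof (rule AE_tendsto_0_of_geometric_integrals[where q="1/4" and C=C])
    fix n
    show "integrable lborel (\<lambda>x. indicator \<Omega> x * (trace_at_exit \<Omega> (?D n) (?E n) \<theta> x)\<^sup>2)"
      using C(2)[OF rd \<theta>] by blast
    have "(H1_norm \<Omega> (\<lambda>x. u x - v n x))\<^sup>2 \<le> ((1 / 2) ^ n)\<^sup>2"
    proof (rule power_mono)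
      show "0 \<le> H1_norm \<Omega> (\<lambda>x. u x - v n x)" unfolding H1_norm_def
        by (intro real_sqrt_ge_zero add_nonneg_nonneg sum_nonneg Bochner_Integration.integral_nonneg) auto
    qed (use conv[of n] in simp)
    also have "((1 / 2) ^ n)\<^sup>2 = (1 / 4 :: real) ^ n"
      by (simp add: power2_eq_square power_mult_distrib[symmetric])
    finally show "(\<integral>x. indicator \<Omega> x * (trace_at_exit \<Omega> (?D n) (?E n) \<theta> x)\<^sup>2 \<partial>lborel) \<le> C * (1 / 4) ^ n"
      using C(2)[OF rd \<theta>, of n] C(1) by (meson mult_left_mono less_imp_le order_trans)
  qed auto
  moreover have "AE x in lborel. \<forall>n. x \<in> \<Omega> \<longrightarrow> v n (Phi_dir \<Omega> \<theta> x) = trace_at_exit \<Omega> (W n) (H n) \<theta> x"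
    using at by (subst AE_all_countable) simp
  moreover have "AE x in lborel. \<forall>n. trace_at_exit \<Omega> (?D n) (?E n) \<theta> x
      = trace_at_exit \<Omega> U G \<theta> x - trace_at_exit \<Omega> (W n) (H n) \<theta> x"
    using diff by (subst AE_all_countable) simp
  ultimately show ?thesis
  proof eventually_elim
    case (elim x)
    show ?case
    proof
      assume x: "x \<in> \<Omega>"
      with elim have "(\<lambda>n. (trace_at_exit \<Omega> U G \<theta> x - v n (Phi_dir \<Omega> \<theta> x))\<^sup>2) \<longlonglongrightarrow> 0" by simp
      from tendsto_real_sqrt[OF this]
      have "(\<lambda>n. \<bar>trace_at_exit \<Omega> U G \<theta> x - v n (Phi_dir \<Omega> \<theta> x)\<bar>) \<longlonglongrightarrow> 0" by simp
      then have "(\<lambda>n. trace_at_exit \<Omega> U G \<theta> x - v n (Phi_dir \<Omega> \<theta> x)) \<longlonglongrightarrow> 0"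
        by (rule tendsto_rabs_zero_cancel)
      from tendsto_diff[OF tendsto_const[of "trace_at_exit \<Omega> U G \<theta> x"] this]
      show "(\<lambda>n. v n (Phi_dir \<Omega> \<theta> x)) \<longlonglongrightarrow> trace_at_exit \<Omega> U G \<theta> x" by simp
    qed
  qed
qed

section \<open>Omnidirectional traces\<close>

lemma sets_mu_dir [simp]: "sets (mu_dir \<Omega> \<theta>) = sets (restrict_space borel (frontier \<Omega>))"
  and space_mu_dir [simp]: "space (mu_dir \<Omega> \<theta>) = frontier \<Omega>"
  by (simp_all add: mu_dir_def space_restrict_space)

text \<open>
  The exit points transport the integral over the boundary to an integral over \<open>\<Omega>\<close>, where the trace
  inequality gives a bound that is uniform in the direction.
\<close>

lemma exit_value_imp_omni_trace:
  fixes \<Omega> :: "'a::euclidean_space set"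
  assumes \<Omega>: "open \<Omega>" "bounded \<Omega>" and r: "H1_rep \<Omega> u U G"
    and g[measurable]: "g \<in> borel_measurable (restrict_space borel (frontier \<Omega>))"
    and eq: "\<And>\<theta>. norm \<theta> = 1 \<Longrightarrow> AE x in lborel. x \<in> \<Omega> \<longrightarrow> g (Phi_dir \<Omega> \<theta> x) = trace_at_exit \<Omega> U G \<theta> x"
  shows "omni_trace \<Omega> u g"
  unfolding omni_trace_def
proof
  have [measurable]: "\<Omega> \<in> sets borel" using \<Omega> by simp
  obtain C where C: "C > 0" "\<And>u U G \<theta>. H1_rep \<Omega> u U G \<Longrightarrow> norm \<theta> = 1 \<Longrightarrow>
    integrable lborel (\<lambda>x. indicator \<Omega> x * (trace_at_exit \<Omega> U G \<theta> x)\<^sup>2) \<and>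
    (\<integral>x. indicator \<Omega> x * (trace_at_exit \<Omega> U G \<theta> x)\<^sup>2 \<partial>lborel) \<le> C * (H1_norm \<Omega> u)\<^sup>2"
    by (rule trace_at_exit_square_bound[OF \<Omega>]) (rule that)
  have "g \<in> L2 (mu_dir \<Omega> \<theta>) \<and> (\<integral>z. (g z)\<^sup>2 \<partial>mu_dir \<Omega> \<theta>) \<le> C * (H1_norm \<Omega> u)\<^sup>2" if \<theta>: "norm \<theta> = 1" for \<theta>
  proof -
    interpret directional_weak_derivative \<Omega> \<theta> U "gradient_along G \<theta>"
      by (rule H1_rep_directional[OF \<Omega> \<theta> r])
    note Phi = measurable_Phi_dir[OF \<Omega> \<theta>]
    have m: "(\<lambda>x. (g (Phi_dir \<Omega> \<theta> x))\<^sup>2) \<in> borel_measurable (lebesgue_on \<Omega>)"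
      using measurable_compose[OF Phi g] by measurable
    have ae: "AE x in lebesgue_on \<Omega>. indicator \<Omega> x * (exit_value x)\<^sup>2 = (g (Phi_dir \<Omega> \<theta> x))\<^sup>2"
      using eq[OF \<theta>] by (subst AE_lebesgue_on_iff) (auto elim: eventually_mono)
    have m': "(\<lambda>x. indicator \<Omega> x * (exit_value x)\<^sup>2) \<in> borel_measurable borel" by measurable
    note I = integral_lebesgue_on_borel[OF m' \<open>\<Omega> \<in> sets borel\<close>]
    have int: "integrable (lebesgue_on \<Omega>) (\<lambda>x. (g (Phi_dir \<Omega> \<theta> x))\<^sup>2)"
    proof (rule integrable_cong_AE_imp[OF _ m ae])
      show "integrable (lebesgue_on \<Omega>) (\<lambda>x. indicator \<Omega> x * (exit_value x)\<^sup>2)"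
        using C(2)[OF r \<theta>] by (subst I(1)) auto
    qed
    have "(\<integral>x. (g (Phi_dir \<Omega> \<theta> x))\<^sup>2 \<partial>lebesgue_on \<Omega>) = (\<integral>x. indicator \<Omega> x * (exit_value x)\<^sup>2 \<partial>lebesgue_on \<Omega>)"
      using ae borel_imp_lebesgue_on[OF m'] m by (intro integral_cong_AE) (auto elim: eventually_mono)
    also have "\<dots> \<le> C * (H1_norm \<Omega> u)\<^sup>2"
      using C(2)[OF r \<theta>] by (subst I(2)) auto
    finally have le: "(\<integral>x. (g (Phi_dir \<Omega> \<theta> x))\<^sup>2 \<partial>lebesgue_on \<Omega>) \<le> C * (H1_norm \<Omega> u)\<^sup>2" .
    have g2: "(\<lambda>z. (g z)\<^sup>2) \<in> borel_measurable (restrict_space borel (frontier \<Omega>))" by measurable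
    have "integrable (mu_dir \<Omega> \<theta>) (\<lambda>z. (g z)\<^sup>2)"
      using int by (simp add: mu_dir_def integrable_distr_eq[OF Phi g2])
    moreover have "g \<in> borel_measurable (mu_dir \<Omega> \<theta>)"
      using g by (simp add: mu_dir_def)
    moreover have "(\<integral>z. (g z)\<^sup>2 \<partial>mu_dir \<Omega> \<theta>) \<le> C * (H1_norm \<Omega> u)\<^sup>2"
      using le by (simp add: mu_dir_def integral_distr[OF Phi g2])
    ultimately show ?thesis by (simp add: L2_def)
  qed
  then show "g \<in> L2_omni \<Omega>"
    unfolding L2_omni_def using C(1)
    by (intro CollectI exI[of _ "C * (H1_norm \<Omega> u)\<^sup>2"] conjI ballI bexI[of _ g]) auto
  show "\<forall>\<theta>\<in>sphere 0 1. \<exists>h\<in>gamma_dir \<Omega> \<theta> u. AE z in mu_dir \<Omega> \<theta>. h z = g z"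
  proof
    fix \<theta> :: 'a assume "\<theta> \<in> sphere 0 1"
    then have \<theta>: "norm \<theta> = 1" by simp
    interpret directional_weak_derivative \<Omega> \<theta> U "gradient_along G \<theta>"
      by (rule H1_rep_directional[OF \<Omega> \<theta> r])
    have "directional_trace \<Omega> \<theta> u g"
      using r by (intro exit_value_imp_directional_trace H1_rep_W_dir[OF \<Omega> r] eq \<theta>) (simp add: H1_rep_def)
    then show "\<exists>h\<in>gamma_dir \<Omega> \<theta> u. AE z in mu_dir \<Omega> \<theta>. h z = g z"
      by (intro bexI[of _ g]) (auto simp: gamma_dir_def)
  qed
qed

lemma AE_mu_dir_imp_AE:
  fixes \<Omega> :: "'a::euclidean_space set"
  assumes \<Omega>: "open \<Omega>" "bounded \<Omega>" and \<theta>: "norm \<theta> = 1" and ae: "AE z in mu_dir \<Omega> \<theta>. P z"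
  shows "AE x in lborel. x \<in> \<Omega> \<longrightarrow> P (Phi_dir \<Omega> \<theta> x)"
  using AE_distrD[OF measurable_Phi_dir[OF \<Omega> \<theta>] ae[unfolded mu_dir_def]] \<Omega>
  by (simp add: AE_lebesgue_on_iff)

lemma omni_trace_imp_exit_value:
  fixes \<Omega> :: "'a::euclidean_space set"
  assumes \<Omega>: "open \<Omega>" "bounded \<Omega>" and \<theta>: "norm \<theta> = 1" and r: "H1_rep \<Omega> u U G" and g: "omni_trace \<Omega> u g"
  shows "AE x in lborel. x \<in> \<Omega> \<longrightarrow> g (Phi_dir \<Omega> \<theta> x) = trace_at_exit \<Omega> U G \<theta> x"
proof -
  interpret directional_weak_derivative \<Omega> \<theta> U "gradient_along G \<theta>"
    by (rule H1_rep_directional[OF \<Omega> \<theta> r])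
  have "\<theta> \<in> sphere 0 1" using \<theta> by simp
  then have "\<exists>h\<in>gamma_dir \<Omega> \<theta> u. AE z in mu_dir \<Omega> \<theta>. h z = g z"
    using g unfolding omni_trace_def by blast
  then obtain h where h: "directional_trace \<Omega> \<theta> u h" "AE z in mu_dir \<Omega> \<theta>. h z = g z"
    unfolding gamma_dir_def by blast
  have "AE x in lborel. x \<in> \<Omega> \<longrightarrow> h (Phi_dir \<Omega> \<theta> x) = exit_value x"
    using r h by (intro directional_trace_imp_exit_value) (auto simp: H1_rep_def)
  with AE_mu_dir_imp_AE[OF \<Omega> \<theta> h(2)] show ?thesis by eventually_elim auto
qed

text \<open>
  Whether the trace vanishes can be read off the exit values, whatever trace has been chosen. An
  arbitrary trace may be nonmeasurable, so to return to the boundary measure it is first replaced by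
  its measurable companion from \<open>L2_omni\<close>.
\<close>

lemma omni_trace_vanishes_iff:
  fixes \<Omega> :: "'a::euclidean_space set"
  assumes \<Omega>: "open \<Omega>" "bounded \<Omega>" and r: "H1_rep \<Omega> u U G" and g: "omni_trace \<Omega> u g"
  shows "eq_omni \<Omega> g (\<lambda>_. 0) \<longleftrightarrow>
    (\<forall>\<theta>. norm \<theta> = 1 \<longrightarrow> (AE x in lborel. x \<in> \<Omega> \<longrightarrow> trace_at_exit \<Omega> U G \<theta> x = 0))"
proof (intro iffI allI impI)
  fix \<theta> :: 'a assume "eq_omni \<Omega> g (\<lambda>_. 0)" and \<theta>: "norm \<theta> = 1"
  then have "AE z in mu_dir \<Omega> \<theta>. g z = 0" by (simp add: eq_omni_def)
  from AE_mu_dir_imp_AE[OF \<Omega> \<theta> this] omni_trace_imp_exit_value[OF \<Omega> \<theta> r g]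
  show "AE x in lborel. x \<in> \<Omega> \<longrightarrow> trace_at_exit \<Omega> U G \<theta> x = 0" by eventually_elim auto
next
  assume 0: "\<forall>\<theta>. norm \<theta> = 1 \<longrightarrow> (AE x in lborel. x \<in> \<Omega> \<longrightarrow> trace_at_exit \<Omega> U G \<theta> x = 0)"
  show "eq_omni \<Omega> g (\<lambda>_. 0)"
    unfolding eq_omni_def
  proof
    fix \<theta> :: 'a assume \<theta>s: "\<theta> \<in> sphere 0 1"
    then have \<theta>: "norm \<theta> = 1" by simp
    have "\<exists>k\<in>L2 (mu_dir \<Omega> \<theta>). AE z in mu_dir \<Omega> \<theta>. g z = k z"
      using g \<theta>s unfolding omni_trace_def L2_omni_def by blast
    then obtain k where k: "k \<in> borel_measurable (mu_dir \<Omega> \<theta>)" "AE z in mu_dir \<Omega> \<theta>. g z = k z"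
      by (auto simp: L2_def)
    have [measurable]: "k \<in> borel_measurable (restrict_space borel (frontier \<Omega>))"
      using k(1) by (simp add: mu_dir_def)
    have "AE x in lborel. x \<in> \<Omega> \<longrightarrow> k (Phi_dir \<Omega> \<theta> x) = 0"
      using AE_mu_dir_imp_AE[OF \<Omega> \<theta> k(2)] omni_trace_imp_exit_value[OF \<Omega> \<theta> r g] 0[rule_format, OF \<theta>]
      by eventually_elim auto
    then have "AE x in lebesgue_on \<Omega>. k (Phi_dir \<Omega> \<theta> x) = 0"
      using \<Omega> by (simp add: AE_lebesgue_on_iff)
    then have "AE z in mu_dir \<Omega> \<theta>. k z = 0"
      unfolding mu_dir_def by (subst AE_distr_iff[OF measurable_Phi_dir[OF \<Omega> \<theta>]]) measurable
    with k(2) show "AE z in mu_dir \<Omega> \<theta>. g z = 0" by eventually_elim simp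
  qed
qed

lemma omni_trace_tr:
  assumes "u \<in> H1_tr \<Omega>"
  shows "omni_trace \<Omega> u (tr \<Omega> u)"
proof -
  have "\<exists>g. omni_trace \<Omega> u g" using assms by (simp add: H1_tr_def)
  then show ?thesis unfolding tr_def by (rule someI_ex)
qed

lemma H1_closure_sequence:
  assumes "u \<in> H1_closure \<Omega> S"
  obtains v where "\<And>n. v n \<in> S" "\<And>n. H1_norm \<Omega> (\<lambda>x. u x - v n x) < (1 / 2) ^ n"
proof -
  have "\<forall>n. \<exists>v. v \<in> S \<and> H1_norm \<Omega> (\<lambda>x. u x - v x) < (1 / 2 :: real) ^ n"
  proof
    fix n :: nat
    have "(1 / 2 :: real) ^ n > 0" by simp
    then show "\<exists>v. v \<in> S \<and> H1_norm \<Omega> (\<lambda>x. u x - v x) < (1 / 2 :: real) ^ n"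
      using assms unfolding H1_closure_def by blast
  qed
  from choice[OF this] show ?thesis using that by blast
qed

text \<open>
  The pointwise limit of the approximating continuous functions on the boundary is a trace.
\<close>

lemma H1_tilde_subset_H1_tr:
  fixes \<Omega> :: "'a::euclidean_space set"
  assumes \<Omega>: "open \<Omega>" "bounded \<Omega>"
  shows "H1_tilde \<Omega> \<subseteq> H1_tr \<Omega>"
proof
  fix u assume u: "u \<in> H1_tilde \<Omega>"
  then have uH: "u \<in> H1 \<Omega>" by (simp add: H1_tilde_def H1_closure_def)
  obtain U G where r: "H1_rep \<Omega> u U G" by (rule H1_rep_exists[OF \<Omega>(1) uH])
  obtain v where v: "\<And>n. v n \<in> {v \<in> H1 \<Omega>. continuous_on (closure \<Omega>) v}"
    "\<And>n. H1_norm \<Omega> (\<lambda>x. u x - v n x) < (1 / 2) ^ n"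
    by (rule H1_closure_sequence[OF u[unfolded H1_tilde_def]]) (rule that)
  define g where "g z = lim (\<lambda>n. v n z)" for z
  have "omni_trace \<Omega> u g"
  proof (rule exit_value_imp_omni_trace[OF \<Omega> r])
    have "v n \<in> borel_measurable (restrict_space borel (frontier \<Omega>))" for n
      using v(1)[of n] by (intro borel_measurable_continuous_on_restrict)
        (auto intro: continuous_on_subset simp: frontier_def)
    then show "g \<in> borel_measurable (restrict_space borel (frontier \<Omega>))"
      unfolding g_def[abs_def] by (rule borel_measurable_lim_metric)
    fix \<theta> :: 'a assume \<theta>: "norm \<theta> = 1"
    have "AE x in lborel. x \<in> \<Omega> \<longrightarrow> (\<lambda>n. v n (Phi_dir \<Omega> \<theta> x)) \<longlonglongrightarrow> trace_at_exit \<Omega> U G \<theta> x"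
      using v by (intro approximation_converges_at_exit[OF \<Omega> \<theta> r]) auto
    then show "AE x in lborel. x \<in> \<Omega> \<longrightarrow> g (Phi_dir \<Omega> \<theta> x) = trace_at_exit \<Omega> U G \<theta> x"
      by eventually_elim (auto simp: g_def limI)
  qed
  with uH show "u \<in> H1_tr \<Omega>" by (auto simp: H1_tr_def)
qed

lemma Cc_infinity_H1_rep:
  fixes \<Omega> :: "'a::euclidean_space set"
  assumes \<Omega>: "open \<Omega>" "bounded \<Omega>" and \<phi>: "\<phi> \<in> Cc_infinity \<Omega>"
  shows "H1_rep \<Omega> \<phi> \<phi> (\<lambda>b x. frechet_derivative \<phi> (at x) b)"
proof -
  have der0: "frechet_derivative \<phi> (at x) b = 0" if "x \<notin> \<Omega>" for x b
    using \<phi> that by (intro Cc_infinity_derivative_eq_0[OF \<phi>]) (auto simp: Cc_infinity_def)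
  have L\<phi>: "\<phi> \<in> L2_ext \<Omega>"
  proof -
    obtain B where "\<And>x. \<bar>\<phi> x\<bar> \<le> B" using Cc_infinity_bounded[OF \<phi>] by metis
    then show ?thesis by (intro bounded_imp_L2_ext[of _ B] Cc_infinity_borel(1)[OF \<phi>] Cc_infinity_eq_0[OF \<phi>] \<Omega> borel_open)
  qed
  have LD: "(\<lambda>x. frechet_derivative \<phi> (at x) b) \<in> L2_ext \<Omega>" for b
  proof -
    obtain B where "\<And>x. \<bar>frechet_derivative \<phi> (at x) b\<bar> \<le> B" using Cc_infinity_bounded[OF \<phi>] by metis
    then show ?thesis by (intro bounded_imp_L2_ext[of _ B] Cc_infinity_borel(2)[OF \<phi>] der0 \<Omega> borel_open)
  qed
  have "has_weak_deriv \<Omega> b \<phi> (\<lambda>x. frechet_derivative \<phi> (at x) b)" for b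
    unfolding has_weak_deriv_iff_lborel[OF \<Omega>(1) L\<phi> LD]
  proof
    fix \<psi> assume \<psi>: "\<psi> \<in> Cc_infinity \<Omega>"
    show "(\<integral>x. \<phi> x * frechet_derivative \<psi> (at x) b \<partial>lborel) = - (\<integral>x. frechet_derivative \<phi> (at x) b * \<psi> x \<partial>lborel)"
    proof (rule increment_imp_weak_derivative[OF \<Omega>(1) _ _ _ \<psi>])
      show "integrable lborel \<phi>" "integrable lborel (\<lambda>x. frechet_derivative \<phi> (at x) b)"
        using L2_ext_integrable[OF \<Omega>(2)] L\<phi> LD by auto
      fix n
      let ?h = "1 / real (Suc n)"
      have "\<phi> (x + ?h *\<^sub>R b) - \<phi> x = seg_integral b (\<lambda>x. frechet_derivative \<phi> (at x) b) ?h x" for x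
      proof -
        have lin: "linear (frechet_derivative \<phi> (at z))" for z
          using Cc_infinity_differentiable[OF \<phi>] has_derivative_linear by blast
        have "seg_integral b (\<lambda>x. frechet_derivative \<phi> (at x) (- b)) ?h x = \<phi> x - \<phi> (x + ?h *\<^sub>R b)"
          using Cc_infinity_increment[OF \<phi>, of ?h "- b" x] by simp
        moreover have "seg_integral b (\<lambda>x. frechet_derivative \<phi> (at x) (- b)) ?h x = - seg_integral b (\<lambda>x. frechet_derivative \<phi> (at x) b) ?h x"
          unfolding seg_integral_def Bochner_Integration.integral_minus[symmetric]
          by (intro Bochner_Integration.integral_cong refl) (auto simp: linear_neg[OF lin])
        ultimately show ?thesis by simp
      qed
      then show "AE x in lborel. (\<forall>t\<in>{0..?h}. x + t *\<^sub>R b \<in> \<Omega>) \<longrightarrow>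
          \<phi> (x + ?h *\<^sub>R b) - \<phi> x = seg_integral b (\<lambda>x. frechet_derivative \<phi> (at x) b) ?h x" by simp
    qed
  qed
  then show ?thesis
    using L\<phi> LD borel_imp_lebesgue_on[OF Cc_infinity_borel(1)[OF \<phi>]] by (simp add: H1_rep_def)
qed

text \<open>
  Test functions vanish at all exit points, so do their limits.
\<close>

lemma H1_0_subset_H1_tr_0:
  fixes \<Omega> :: "'a::euclidean_space set"
  assumes \<Omega>: "open \<Omega>" "bounded \<Omega>"
  shows "H1_0 \<Omega> \<subseteq> H1_tr_0 \<Omega>"
proof
  fix u assume u: "u \<in> H1_0 \<Omega>"
  then have uH: "u \<in> H1 \<Omega>" by (simp add: H1_0_def H1_closure_def)
  obtain U G where r: "H1_rep \<Omega> u U G" by (rule H1_rep_exists[OF \<Omega>(1) uH])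
  obtain v where v: "\<And>n. v n \<in> Cc_infinity \<Omega>" "\<And>n. H1_norm \<Omega> (\<lambda>x. u x - v n x) < (1 / 2) ^ n"
    by (rule H1_closure_sequence[OF u[unfolded H1_0_def]]) (rule that)
  have vH: "v n \<in> H1 \<Omega>" for n by (rule H1_rep_imp_H1[OF \<Omega> Cc_infinity_H1_rep[OF \<Omega> v(1)]])
  have 0: "AE x in lborel. x \<in> \<Omega> \<longrightarrow> trace_at_exit \<Omega> U G \<theta> x = 0" if \<theta>: "norm \<theta> = 1" for \<theta>
  proof -
    have "AE x in lborel. x \<in> \<Omega> \<longrightarrow> (\<lambda>n. v n (Phi_dir \<Omega> \<theta> x)) \<longlonglongrightarrow> trace_at_exit \<Omega> U G \<theta> x"
      by (intro approximation_converges_at_exit[OF \<Omega> \<theta> r] vH v Cc_infinity_continuous[OF v(1)])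
    then show ?thesis
      by eventually_elim
        (auto simp: Cc_infinity_eq_0[OF v(1) exit_not_in[OF \<Omega> \<theta>]] LIMSEQ_const_iff)
  qed
  have "omni_trace \<Omega> u (\<lambda>_. 0)"
    by (rule exit_value_imp_omni_trace[OF \<Omega> r]) (use 0 in \<open>auto elim: eventually_mono\<close>)
  with uH have utr: "u \<in> H1_tr \<Omega>" by (auto simp: H1_tr_def)
  moreover have "eq_omni \<Omega> (tr \<Omega> u) (\<lambda>_. 0)"
    using omni_trace_vanishes_iff[OF \<Omega> r omni_trace_tr[OF utr]] 0 by blast
  ultimately show "u \<in> H1_tr_0 \<Omega>" by (simp add: H1_tr_0_def)
qed

section \<open>Extension by zero\<close>

lemma seg_integral_reverse:
  fixes \<theta> :: "'a::euclidean_space"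
  shows "seg_integral (- \<theta>) V h x = seg_integral \<theta> V h (x - h *\<^sub>R \<theta>)"
proof -
  have "seg_integral \<theta> V h (x - h *\<^sub>R \<theta>) = \<bar>-1\<bar> *\<^sub>R (\<integral>t. (if 0 \<le> h + -1 * t \<and> h + -1 * t \<le> h then V (x - h *\<^sub>R \<theta> + (h + -1 * t) *\<^sub>R \<theta>) else 0) \<partial>lborel)"
    unfolding seg_integral_def by (rule lborel_integral_real_affine) simp
  also have "\<dots> = seg_integral (- \<theta>) V h x"
    unfolding seg_integral_def by (auto intro!: Bochner_Integration.integral_cong simp: algebra_simps)
  finally show ?thesis by simp
qed

lemma seg_integral_uminus: "seg_integral \<theta> (\<lambda>x. - V x) h x = - seg_integral \<theta> V h x"
  unfolding seg_integral_def Bochner_Integration.integral_minus[symmetric]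
  by (intro Bochner_Integration.integral_cong refl) auto

text \<open>
  The integral over finite subfamilies vanishes, and dominated convergence gives the union.
\<close>

lemma integral_zero_on_countable_union:
  fixes V :: "'b \<Rightarrow> real"
  assumes cnt: "countable \<C>" and disj: "pairwise disjnt \<C>" and sets: "\<C> \<subseteq> sets M" and V: "integrable M V"
    and 0: "\<And>C. C \<in> \<C> \<Longrightarrow> (\<integral>t. indicator C t * V t \<partial>M) = 0"
  shows "(\<integral>t. indicator (\<Union>\<C>) t * V t \<partial>M) = 0"
proof (cases "\<C> = {}")
  case False
  have int: "integrable M (\<lambda>t. indicator C t * V t)" if "C \<in> sets M" for C
    using integrable_mult_indicator[OF that V] by simp
  let ?F = "\<lambda>n. from_nat_into \<C> ` {..<n}"
  have F: "finite (?F n)" "?F n \<subseteq> \<C>" for n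
    using from_nat_into[OF False] by auto
  have "(\<integral>t. indicator (\<Union>(?F n)) t * V t \<partial>M) = 0" for n
  proof -
    have "indicator (\<Union>(?F n)) t = (\<Sum>C\<in>?F n. indicator C t :: real)" for t
      using indicator_UN_disjoint[of "?F n" "\<lambda>C. C" t] F[of n] disj
      by (auto simp: disjoint_family_on_def pairwise_def disjnt_def subset_iff)
    then have "(\<integral>t. indicator (\<Union>(?F n)) t * V t \<partial>M) = (\<integral>t. (\<Sum>C\<in>?F n. indicator C t * V t) \<partial>M)"
      by (simp only: sum_distrib_right)
    also have "\<dots> = (\<Sum>C\<in>?F n. \<integral>t. indicator C t * V t \<partial>M)"
      using F[of n] sets by (intro Bochner_Integration.integral_sum int) auto
    also have "\<dots> = 0" using F(2)[of n] 0 by (intro sum.neutral) blast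
    finally show ?thesis .
  qed
  moreover have "(\<lambda>n. \<integral>t. indicator (\<Union>(?F n)) t * V t \<partial>M) \<longlonglongrightarrow> (\<integral>t. indicator (\<Union>\<C>) t * V t \<partial>M)"
  proof (rule integral_dominated_convergence[where w="\<lambda>t. \<bar>V t\<bar>"])
    have "(\<lambda>n. indicator (\<Union>(?F n)) t :: real) \<longlonglongrightarrow> indicator (\<Union>\<C>) t" for t
    proof (rule tendsto_eventually)
      show "\<forall>\<^sub>F n in sequentially. (indicator (\<Union>(?F n)) t :: real) = indicator (\<Union>\<C>) t"
      proof (cases "t \<in> \<Union>\<C>")
        case True
        then obtain C k where C: "C \<in> \<C>" "t \<in> C" "from_nat_into \<C> k = C"
          using from_nat_into_surj[OF cnt] by blast
        show ?thesis
          using eventually_gt_at_top[of k] by eventually_elim (use C True in \<open>auto simp: indicator_def\<close>)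
      next
        case False
        then show ?thesis using F(2) by (intro always_eventually allI) (auto simp: indicator_def)
      qed
    qed
    then show "AE t in M. (\<lambda>n. indicator (\<Union>(?F n)) t * V t) \<longlonglongrightarrow> indicator (\<Union>\<C>) t * V t"
      by (intro AE_I2 tendsto_mult tendsto_const)
    have [measurable]: "V \<in> borel_measurable M" using V by auto
    have "\<Union>\<C> \<in> sets M" using cnt sets by (rule sets.countable_Union)
    then show "(\<lambda>t. indicator (\<Union>\<C>) t * V t) \<in> borel_measurable M" by measurable
    have "\<Union>(?F n) \<in> sets M" for n using F[of n] sets by (intro sets.finite_Union) auto
    then show "(\<lambda>t. indicator (\<Union>(?F n)) t * V t) \<in> borel_measurable M" for n by measurable
    show "integrable M (\<lambda>t. \<bar>V t\<bar>)" using V by simp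
    show "AE t in M. norm (indicator (\<Union>(?F n)) t * V t) \<le> \<bar>V t\<bar>" for n
      by (intro AE_I2) (simp add: indicator_def)
  qed
  ultimately show ?thesis by (simp add: LIMSEQ_const_iff)
qed simp

text \<open>
  If the continuous representative vanishes at both ends of every component, then \<open>V\<close> has integral
  \<open>0\<close> over each component, hence over the part of the slice to the left of any point outside the
  slice. So \<open>U s\<close> is the integral of \<open>V\<close> over \<open>{..s}\<close> for almost all real \<open>s\<close>, inside the slice or
  not, and the increment formula holds across the boundary. The second assumption is the vanishing of
  the exit value in direction \<open>-\<theta>\<close>, in which the derivative is \<open>-V\<close>.
\<close>

lemma (in directional_weak_derivative) zero_extension_increment_on_line:
  assumes y: "good_line y"
    and ae: "AE s in lborel. s *\<^sub>R \<theta> + y \<in> \<Omega> \<longrightarrow> exit_value (s *\<^sub>R \<theta> + y) = 0"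
    and ae': "AE s in lborel. s *\<^sub>R \<theta> + y \<in> \<Omega> \<longrightarrow>
      U (s *\<^sub>R \<theta> + y) = seg_integral (- \<theta>) V (delta_dir \<Omega> (- \<theta>) (s *\<^sub>R \<theta> + y)) (s *\<^sub>R \<theta> + y)"
    and h: "0 \<le> h"
  shows "AE s in lborel. U ((s + h) *\<^sub>R \<theta> + y) - U (s *\<^sub>R \<theta> + y) = seg_integral \<theta> V h (s *\<^sub>R \<theta> + y)"
proof -
  let ?S = "line_slice \<Omega> \<theta> y" and ?U = "\<lambda>s. U (s *\<^sub>R \<theta> + y)" and ?V = "\<lambda>s. V (s *\<^sub>R \<theta> + y)"
  have V1: "integrable lborel ?V" using y by (simp add: good_line_def)
  have [measurable]: "?V \<in> borel_measurable borel" using V1 by auto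
  have off: "?U s = 0" "?V s = 0" if "s \<notin> ?S" for s
    using y that by (auto simp: good_line_def L2_ext_def)
  note S = open_line_slice[OF \<Omega>(1), of \<theta> y]
  have \<theta>': "norm (- \<theta>) = 1" using \<theta> by simp
  have int: "integrable lborel (\<lambda>t. indicator A t * ?V t)" if "A \<in> sets borel" for A
    using integrable_mult_indicator[OF _ V1, of A] that by simp
  have seg_integral_interval: "seg_integral 1 ?V (b - a) a = (\<integral>t. indicator {a..b} t * ?V t \<partial>lborel)" for a b
  proof -
    have "seg_integral 1 ?V (b - a) a = (\<integral>t. indicator {a..b} (t + a) * ?V (t + a) \<partial>lborel)"
      unfolding seg_integral_def by (intro Bochner_Integration.integral_cong refl) (auto simp: indicator_def add.commute)
    also have "\<dots> = (\<integral>t. indicator {a..b} t * ?V t \<partial>lborel)"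
      by (rule integral_lborel_shift) measurable
    finally show ?thesis .
  qed
  have on_comp: "AE s in lborel. s \<in> {\<alpha><..<\<beta>} \<longrightarrow> ?U s + seg_integral 1 ?V (\<beta> - s) s = 0 \<and> ?U s = seg_integral 1 ?V (s - \<alpha>) \<alpha>"
    if I: "{\<alpha><..<\<beta>} \<in> components ?S" for \<alpha> \<beta>
    using ae ae'
  proof eventually_elim
    case (elim s)
    note E = open_interval_component_endpoints[OF S I]
    show ?case
    proof (intro impI conjI)
      assume s: "s \<in> {\<alpha><..<\<beta>}"
      then have in_: "s *\<^sub>R \<theta> + y \<in> \<Omega>" using E(2) by (auto simp: line_slice_def subset_iff)
      show "?U s + seg_integral 1 ?V (\<beta> - s) s = 0"
        using elim(1) in_ by (simp add: exit_value_on_component[OF I s])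
      have "delta_dir \<Omega> (- \<theta>) (s *\<^sub>R \<theta> + y) = s - \<alpha>"
      proof (rule delta_dir_eqI[OF \<Omega> \<theta>'])
        show "s *\<^sub>R \<theta> + y + (s - \<alpha>) *\<^sub>R (- \<theta>) \<notin> \<Omega>"
          using E(3) by (simp add: line_slice_def algebra_simps)
        fix t assume t: "0 \<le> t" "t < s - \<alpha>"
        then have "s - t \<in> ?S" using E(2) s by (auto simp: subset_iff)
        then show "s *\<^sub>R \<theta> + y + t *\<^sub>R (- \<theta>) \<in> \<Omega>" by (simp add: line_slice_def algebra_simps)
      qed (use s in auto)
      then have "?U s = seg_integral (- \<theta>) V (s - \<alpha>) (s *\<^sub>R \<theta> + y)" using elim(2) in_ by simp
      also have "\<dots> = seg_integral \<theta> V (s - \<alpha>) (\<alpha> *\<^sub>R \<theta> + y)"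
        unfolding seg_integral_reverse by (simp add: algebra_simps)
      also have "\<dots> = seg_integral 1 ?V (s - \<alpha>) \<alpha>"
        unfolding seg_integral_def by (simp add: algebra_simps cong: if_cong)
      finally show "?U s = seg_integral 1 ?V (s - \<alpha>) \<alpha>" .
    qed
  qed
  have comp0: "(\<integral>t. indicator C t * ?V t \<partial>lborel) = 0" if C: "C \<in> components ?S" for C
  proof -
    obtain r where r: "r \<in> C" using in_components_nonempty[OF C] by blast
    then have "r *\<^sub>R \<theta> + y \<in> \<Omega>" using in_components_subset[OF C] by (auto simp: line_slice_def)
    from component_exists[OF \<Omega> \<theta> this] obtain \<alpha> \<beta> where I: "{\<alpha><..<\<beta>} \<in> components ?S" "r \<in> {\<alpha><..<\<beta>}" by blast
    have CI: "C = {\<alpha><..<\<beta>}" using r I(2) components_nonoverlap[OF C I(1)] by blast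
    obtain s where s: "s \<in> {\<alpha><..<\<beta>}" "?U s + seg_integral 1 ?V (\<beta> - s) s = 0" "?U s = seg_integral 1 ?V (s - \<alpha>) \<alpha>"
      using AE_exists_in_interval[OF on_comp[OF I(1)], of \<alpha> \<beta>] I(2) by force
    have "seg_integral 1 ?V ((s - \<alpha>) + (\<beta> - s)) \<alpha> = seg_integral 1 ?V (s - \<alpha>) \<alpha> + seg_integral 1 ?V (\<beta> - s) (\<alpha> + (s - \<alpha>) *\<^sub>R 1)"
      using s(1) integrable_lborel_shift[OF V1, of \<alpha>] by (intro seg_integral_add) (auto simp: add.commute)
    then have "seg_integral 1 ?V (\<beta> - \<alpha>) \<alpha> = 0" using s(2,3) by simp
    then have "(\<integral>t. indicator {\<alpha>..\<beta>} t * ?V t \<partial>lborel) = 0" by (simp only: seg_integral_interval)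
    moreover have "(\<integral>t. indicator {\<alpha>..\<beta>} t * ?V t \<partial>lborel) = (\<integral>t. indicator {\<alpha><..<\<beta>} t * ?V t \<partial>lborel)"
      using off(2) open_interval_component_endpoints(3,4)[OF S I(1)]
      by (intro Bochner_Integration.integral_cong refl) (auto simp: indicator_def order_le_less)
    ultimately show ?thesis by (simp only: CI)
  qed
  have left0: "(\<integral>t. indicator {..p} t * ?V t \<partial>lborel) = 0" if p: "p \<notin> ?S" for p
  proof -
    let ?C = "{C \<in> components ?S. C \<subseteq> {..p}}"
    have "(\<integral>t. indicator (\<Union>?C) t * ?V t \<partial>lborel) = 0"
    proof (rule integral_zero_on_countable_union[OF _ _ _ V1])
      show "countable ?C" by (rule countable_subset[OF _ countable_components_open[OF S]]) auto
      show "pairwise disjnt ?C" using pairwise_disjoint_components[of ?S] by (simp add: pairwise_def disjnt_def)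
      show "?C \<subseteq> sets lborel" using open_components[OF S] by auto
    qed (use comp0 in auto)
    moreover have "indicator (\<Union>?C) t * ?V t = indicator {..p} t * ?V t" for t
    proof (cases "t \<in> ?S \<and> t \<le> p")
      case True
      let ?D = "connected_component_set ?S t"
      have "?D \<in> components ?S" "t \<in> ?D"
        using True by (auto simp: components_iff intro: connected_component_refl)
      moreover have "?D \<subseteq> {..p}"
      proof (rule ccontr)
        assume "\<not> ?D \<subseteq> {..p}"
        then obtain q where q: "q \<in> ?D" "\<not> q \<le> p" by blast
        have "{t..q} \<subseteq> ?D" by (rule connected_contains_Icc[OF connected_connected_component \<open>t \<in> ?D\<close> q(1)])
        moreover have "p \<in> {t..q}" using True q by auto
        ultimately have "p \<in> ?D" by (rule subsetD)
        then show False using p connected_component_subset by blast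
      qed
      ultimately have "t \<in> \<Union>?C" by blast
      then show ?thesis using True by simp
    next
      case False
      then show ?thesis using off(2)[of t] by (cases "t \<in> ?S") (auto simp: indicator_def)
    qed
    ultimately show ?thesis by simp
  qed
  have split: "(\<integral>t. indicator {..q} t * ?V t \<partial>lborel) = (\<integral>t. indicator {..p} t * ?V t \<partial>lborel) + seg_integral 1 ?V (q - p) p"
    if "p \<le> q" for p q
  proof -
    have "(\<integral>t. indicator {..q} t * ?V t \<partial>lborel) = (\<integral>t. indicator {..p} t * ?V t + indicator {p..q} t * ?V t \<partial>lborel)"
    proof (rule integral_cong_AE)
      show "AE t in lborel. indicator {..q} t * ?V t = indicator {..p} t * ?V t + indicator {p..q} t * ?V t"
        using AE_lborel_singleton[of p] by eventually_elim (use that in \<open>auto simp: indicator_def\<close>)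
    qed measurable
    then show ?thesis by (simp add: seg_integral_interval Bochner_Integration.integral_add[OF int int])
  qed
  have "AE s in lborel. s *\<^sub>R \<theta> + y \<in> \<Omega> \<longrightarrow> ?U s = (\<integral>t. indicator {..s} t * ?V t \<partial>lborel)"
  proof (rule AE_on_components_imp_AE_slice[OF \<Omega> \<theta>])
    fix \<alpha> \<beta> assume I: "{\<alpha><..<\<beta>} \<in> components ?S"
    note E = open_interval_component_endpoints[OF S I]
    show "AE s in lborel. s \<in> {\<alpha><..<\<beta>} \<longrightarrow> ?U s = (\<integral>t. indicator {..s} t * ?V t \<partial>lborel)"
      using on_comp[OF I] by eventually_elim (use split[of \<alpha>] left0[OF E(3)] in auto)
  qed
  then have U_eq: "AE s in lborel. ?U s = (\<integral>t. indicator {..s} t * ?V t \<partial>lborel)"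
    by eventually_elim (use off(1) left0 in \<open>auto simp: line_slice_def\<close>)
  show ?thesis
    using U_eq AE_lborel_shift[OF U_eq, of h]
  proof eventually_elim
    case (elim s)
    have "seg_integral 1 ?V h s = seg_integral \<theta> V h (s *\<^sub>R \<theta> + y)"
      unfolding seg_integral_def by (simp add: algebra_simps cong: if_cong)
    then show ?case using elim split[of s "s + h"] h by simp
  qed
qed

lemma (in directional_weak_derivative) zero_extension_increment:
  assumes ae: "AE x in lborel. x \<in> \<Omega> \<longrightarrow> exit_value x = 0"
    and ae': "AE x in lborel. x \<in> \<Omega> \<longrightarrow> U x = seg_integral (- \<theta>) V (delta_dir \<Omega> (- \<theta>) x) x"
    and h: "0 \<le> h"
  shows "AE x in lborel. U (x + h *\<^sub>R \<theta>) - U x = seg_integral \<theta> V h x"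
proof (rule AE_lines_imp_AE_lborel[OF \<theta>])
  show "Measurable.pred borel (\<lambda>x. U (x + h *\<^sub>R \<theta>) - U x = seg_integral \<theta> V h x)" by measurable
  show "AE y in lborel_hyperplane \<theta>. AE s in lborel.
      U (s *\<^sub>R \<theta> + y + h *\<^sub>R \<theta>) - U (s *\<^sub>R \<theta> + y) = seg_integral \<theta> V h (s *\<^sub>R \<theta> + y)"
    using AE_good_line AE_lborel_imp_AE_lines[OF \<theta> ae] AE_lborel_imp_AE_lines[OF \<theta> ae']
  proof eventually_elim
    case (elim y)
    have eq: "(s + h) *\<^sub>R \<theta> + y = s *\<^sub>R \<theta> + y + h *\<^sub>R \<theta>" for s by (simp add: algebra_simps)
    show ?case
      using zero_extension_increment_on_line[OF elim h] by (simp only: eq)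
  qed
qed

text \<open>
  The directions \<open>b\<close> and \<open>-b\<close> together control both ends of every component.
\<close>

lemma vanishing_trace_increment:
  fixes \<Omega> :: "'a::euclidean_space set"
  assumes \<Omega>: "open \<Omega>" "bounded \<Omega>" and r: "H1_rep \<Omega> u U G"
    and 0: "\<And>\<theta>. norm \<theta> = 1 \<Longrightarrow> AE x in lborel. x \<in> \<Omega> \<longrightarrow> trace_at_exit \<Omega> U G \<theta> x = 0"
    and b: "b \<in> Basis" and h: "0 \<le> h"
  shows "AE x in lborel. U (x + h *\<^sub>R b) - U x = seg_integral b (G b) h x"
proof -
  have nb: "norm b = 1" "norm (- b) = 1" using b by auto
  have "gradient_along G b x = (\<Sum>i\<in>Basis. if i = b then G b x else 0)" for x
    using b by (intro sum.cong) (auto simp: inner_Basis)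
  then have Gb: "gradient_along G b = G b" "gradient_along G (- b) = (\<lambda>x. - G b x)"
    using b by (auto simp: fun_eq_iff sum_negf)
  interpret A: directional_weak_derivative \<Omega> b U "G b"
    using H1_rep_directional[OF \<Omega> nb(1) r] by (simp only: Gb)
  interpret B: directional_weak_derivative \<Omega> "- b" U "\<lambda>x. - G b x"
    using H1_rep_directional[OF \<Omega> nb(2) r] by (simp only: Gb)
  have B0: "AE x in lborel. x \<in> \<Omega> \<longrightarrow> B.exit_value x = 0" using 0[OF nb(2)] by (simp only: Gb)
  show ?thesis
  proof (rule A.zero_extension_increment[OF _ _ h])
    show "AE x in lborel. x \<in> \<Omega> \<longrightarrow> A.exit_value x = 0" using 0[OF nb(1)] by (simp only: Gb)
    show "AE x in lborel. x \<in> \<Omega> \<longrightarrow> U x = seg_integral (- b) (G b) (delta_dir \<Omega> (- b) x) x"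
      using B0 by eventually_elim (auto simp: B.exit_value_def seg_integral_uminus)
  qed
qed

section \<open>Averages over small cubes\<close>

definition small_cube :: "nat \<Rightarrow> 'a::euclidean_space set" where
  "small_cube n = cbox 0 ((1 / real (Suc n)) *\<^sub>R One)"

text \<open>
  The mean over the cube with corner \<open>x\<close>. The variable \<open>x\<close> stands in the window and not in \<open>F\<close>: the
  mean is the integral of \<open>F\<close> against a bounded weight, as in \<open>integrable_weighted_segment\<close>.
\<close>

definition cube_average :: "nat \<Rightarrow> ('a::euclidean_space \<Rightarrow> real) \<Rightarrow> 'a \<Rightarrow> real" where
  "cube_average n F x = (\<integral>w. F w * indicator (small_cube n) (w - x) \<partial>lborel) / measure lborel (small_cube n :: 'a set)"

lemma small_cube_borel [measurable, simp]: "small_cube n \<in> sets borel"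
  by (simp add: small_cube_def)

lemma emeasure_small_cube: "emeasure lborel (small_cube n :: 'a::euclidean_space set) = ennreal (measure lborel (small_cube n :: 'a set))"
  unfolding small_cube_def by (rule emeasure_eq_ennreal_measure) (simp add: less_top[symmetric])

lemma measure_small_cube_pos: "measure lborel (small_cube n :: 'a::euclidean_space set) > 0"
  unfolding small_cube_def by (subst measure_lborel_cbox_eq) (auto intro!: prod_pos)

lemma small_cube_norm:
  fixes z :: "'a::euclidean_space"
  assumes "z \<in> small_cube n"
  shows "norm z \<le> DIM('a) / real (Suc n)"
proof -
  have "norm z \<le> (\<Sum>b\<in>Basis. \<bar>z \<bullet> b\<bar>)" by (rule norm_le_l1)
  also have "\<dots> \<le> (\<Sum>b\<in>(Basis::'a set). 1 / real (Suc n))"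
    using assms by (intro sum_mono) (auto simp: small_cube_def mem_box simp del: of_nat_Suc)
  finally show ?thesis by simp
qed

lemma indicator_translate_measure:
  fixes x :: "'a::euclidean_space"
  shows "(\<integral>w. indicator (small_cube n) (w - x) \<partial>lborel) = measure lborel (small_cube n :: 'a set)"
proof -
  have "(\<integral>w. indicator (small_cube n) (w - x) \<partial>lborel) = (\<integral>w. indicator (small_cube n) w \<partial>(lborel :: 'a measure) :: real)"
    using integral_lborel_shift[of "indicator (small_cube n)" "- x"] by simp
  then show ?thesis by simp
qed

lemma emeasure_reflected_small_cube:
  fixes w :: "'a::euclidean_space"
  shows "(\<integral>\<^sup>+x. indicator (small_cube n) (w - x) \<partial>lborel) = emeasure lborel (small_cube n :: 'a set)"
  using nn_integral_lborel_reflect[of "indicator (small_cube n)" w] by simp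

lemma borel_measurable_cube_average [measurable]:
  assumes [measurable]: "F \<in> borel_measurable borel"
  shows "cube_average n F \<in> borel_measurable borel"
  unfolding cube_average_def[abs_def] by measurable

lemma cube_window_integrable:
  fixes F :: "'a::euclidean_space \<Rightarrow> real"
  assumes "integrable lborel F"
  shows "integrable lborel (\<lambda>w. F w * indicator (small_cube n) (w - x))"
  by (rule integrable_mult_bounded[OF assms, of _ 1]) (auto simp: indicator_def)

text \<open>
  The average is a convolution, so by Fubini it preserves the integral.
\<close>

lemma integrable_cube_average:
  fixes F :: "'a::euclidean_space \<Rightarrow> real"
  assumes F: "integrable lborel F"
  shows "integrable lborel (cube_average n F)" "(\<integral>x. cube_average n F x \<partial>lborel) = (\<integral>x. F x \<partial>lborel)"
proof -
  let ?Q = "small_cube n :: 'a set" and ?m = "measure lborel (small_cube n :: 'a set)"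
  have [measurable]: "F \<in> borel_measurable borel" using F by auto
  have refl: "(\<integral>x. indicator ?Q (w - x) \<partial>lborel) = ?m" for w
    by (subst integral_eq_nn_integral)
      (auto simp: ennreal_indicator emeasure_reflected_small_cube emeasure_small_cube)
  have int: "integrable (lborel \<Otimes>\<^sub>M lborel) (\<lambda>(w, x). F w * indicator ?Q (w - x))"
  proof (rule lborel_pair.Fubini_integrable)
    show "(\<lambda>(w, x). F w * indicator ?Q (w - x)) \<in> borel_measurable (lborel \<Otimes>\<^sub>M lborel)" by measurable
    have i: "integrable lborel (\<lambda>x. indicator ?Q (w - x) :: real)" for w
      by (rule integrableI_bounded) (auto simp: ennreal_indicator emeasure_reflected_small_cube emeasure_small_cube)
    then show "AE w in lborel. integrable lborel (\<lambda>x. case (w, x) of (w, x) \<Rightarrow> F w * indicator ?Q (w - x))"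
      by (intro AE_I2) simp
    have "(\<integral>x. norm (case (w, x) of (w, x) \<Rightarrow> F w * indicator ?Q (w - x)) \<partial>lborel) = \<bar>F w\<bar> * ?m" for w
      using refl[of w] by (simp add: abs_mult)
    then show "integrable lborel (\<lambda>w. \<integral>x. norm (case (w, x) of (w, x) \<Rightarrow> F w * indicator ?Q (w - x)) \<partial>lborel)"
      using F by simp
  qed
  have "integrable lborel (\<lambda>x. \<integral>w. F w * indicator ?Q (w - x) \<partial>lborel)"
    by (rule lborel_pair.integrable_snd[OF int])
  then show "integrable lborel (cube_average n F)"
    unfolding cube_average_def[abs_def] by (intro integrable_divide_zero)
  have "(\<integral>x. (\<integral>w. F w * indicator ?Q (w - x) \<partial>lborel) \<partial>lborel) = (\<integral>w. (\<integral>x. F w * indicator ?Q (w - x) \<partial>lborel) \<partial>lborel)"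
    by (rule lborel_pair.Fubini_integral[OF int])
  also have "\<dots> = (\<integral>w. F w \<partial>lborel) * ?m"
    using refl by simp
  finally show "(\<integral>x. cube_average n F x \<partial>lborel) = (\<integral>x. F x \<partial>lborel)"
    using measure_small_cube_pos[of n, where 'a='a] by (simp add: cube_average_def)
qed

text \<open>
  Averaging does not increase the norm: the square of a mean is at most the mean of the square.
\<close>

lemma cube_average_square_le:
  fixes F :: "'a::euclidean_space \<Rightarrow> real"
  assumes [measurable]: "F \<in> borel_measurable borel" and F2: "integrable lborel (\<lambda>x. (F x)\<^sup>2)"
  shows "integrable lborel (\<lambda>x. (cube_average n F x)\<^sup>2)"
    "(\<integral>x. (cube_average n F x)\<^sup>2 \<partial>lborel) \<le> (\<integral>x. (F x)\<^sup>2 \<partial>lborel)"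
proof -
  let ?Q = "small_cube n :: 'a set" and ?m = "measure lborel (small_cube n :: 'a set)"
  have m: "?m > 0" by (rule measure_small_cube_pos)
  have pt: "(cube_average n F x)\<^sup>2 \<le> cube_average n (\<lambda>w. (F w)\<^sup>2) x" for x
  proof -
    let ?A = "{w. w - x \<in> ?Q}"
    have A: "?A \<in> sets borel" by measurable
    have ind: "indicator ?Q (w - x) = (indicator ?A w :: real)" for w by (simp add: indicator_def)
    have mA: "emeasure lborel ?A = ennreal ?m"
    proof -
      have "emeasure lborel ?A = (\<integral>\<^sup>+w. indicator ?A w \<partial>lborel)"
        using A by simp
      also have "\<dots> = (\<integral>\<^sup>+w. indicator ?Q (w + - x) \<partial>lborel)"
        by (intro nn_integral_cong) (simp add: indicator_def)
      also have "\<dots> = (\<integral>\<^sup>+w. indicator ?Q w \<partial>lborel)" by (rule nn_integral_lborel_shift) simp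
      finally show ?thesis by (simp add: emeasure_small_cube)
    qed
    have "integrable lborel (\<lambda>w. indicator ?A w * (F w)\<^sup>2)"
      using integrable_mult_indicator[OF _ F2, of ?A] A by simp
    from square_set_integral_le(2)[OF A _ _ this] mA
    have "(\<integral>w. indicator ?A w * F w \<partial>lborel)\<^sup>2 \<le> ?m * (\<integral>w. indicator ?A w * (F w)\<^sup>2 \<partial>lborel)"
      using m by (simp add: measure_def)
    then have "(\<integral>w. indicator ?A w * F w \<partial>lborel)\<^sup>2 / ?m\<^sup>2 \<le> ?m * (\<integral>w. indicator ?A w * (F w)\<^sup>2 \<partial>lborel) / ?m\<^sup>2"
      by (rule divide_right_mono) simp
    then show ?thesis
      using m by (simp add: cube_average_def ind mult.commute power_divide power2_eq_square)
  qed
  note I = integrable_cube_average[OF F2, of n]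
  show i: "integrable lborel (\<lambda>x. (cube_average n F x)\<^sup>2)"
    using I(1)
  proof (rule Bochner_Integration.integrable_bound)
    have "0 \<le> cube_average n (\<lambda>w. (F w)\<^sup>2) x" for x using pt[of x] by (rule order_trans[rotated]) simp
    then show "AE x in lborel. norm ((cube_average n F x)\<^sup>2) \<le> norm (cube_average n (\<lambda>w. (F w)\<^sup>2) x)"
      using pt by (intro AE_I2) simp
  qed measurable
  show "(\<integral>x. (cube_average n F x)\<^sup>2 \<partial>lborel) \<le> (\<integral>x. (F x)\<^sup>2 \<partial>lborel)"
    using integral_mono[OF i I(1) pt] I(2) by simp
qed

lemma cube_average_diff:
  fixes F G :: "'a::euclidean_space \<Rightarrow> real"
  assumes "integrable lborel F" "integrable lborel G"
  shows "cube_average n (\<lambda>x. F x - G x) x = cube_average n F x - cube_average n G x"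
  using cube_window_integrable[OF assms(1), of n x] cube_window_integrable[OF assms(2), of n x]
  by (simp add: cube_average_def left_diff_distrib diff_divide_distrib)

text \<open>
  When the cube moves, its indicator converges off the boundary of the limiting cube, which is null.
\<close>

lemma continuous_cube_average:
  fixes F :: "'a::euclidean_space \<Rightarrow> real"
  assumes F: "integrable lborel F"
  shows "continuous_on UNIV (cube_average n F)"
proof -
  let ?Q = "small_cube n :: 'a set"
  have [measurable]: "F \<in> borel_measurable borel" using F by auto
  have "negligible (frontier ?Q)"
    unfolding small_cube_def by (rule negligible_convex_frontier[OF convex_box(1)])
  then have "AE w in lborel. w \<notin> frontier ?Q"
    by (metis AE_completion_iff AE_not_in negligible_iff_null_sets)
  from AE_lborel_shift[OF this, of "- x" for x]
  have fr: "AE w in lborel. w - x \<notin> frontier ?Q" for x by simp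
  have "(\<lambda>k. \<integral>w. F w * indicator ?Q (w - \<sigma> k) \<partial>lborel) \<longlonglongrightarrow> (\<integral>w. F w * indicator ?Q (w - x) \<partial>lborel)"
    if \<sigma>: "\<sigma> \<longlonglongrightarrow> x" for \<sigma> x
  proof (rule integral_dominated_convergence[where w="\<lambda>w. \<bar>F w\<bar>"])
    show "AE w in lborel. (\<lambda>k. F w * indicator ?Q (w - \<sigma> k)) \<longlonglongrightarrow> F w * indicator ?Q (w - x)"
      using fr[of x]
    proof eventually_elim
      case (elim w)
      have lim: "(\<lambda>k. w - \<sigma> k) \<longlonglongrightarrow> w - x" by (intro tendsto_intros \<sigma>)
      have "(\<lambda>k. indicator ?Q (w - \<sigma> k) :: real) \<longlonglongrightarrow> indicator ?Q (w - x)"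
      proof (cases "w - x \<in> ?Q")
        case True
        then have "w - x \<in> interior ?Q" using elim closure_subset by (auto simp: frontier_def)
        then have "eventually (\<lambda>k. w - \<sigma> k \<in> interior ?Q) sequentially"
          by (intro topological_tendstoD[OF lim]) auto
        then show ?thesis
          by (intro tendsto_eventually) (auto elim!: eventually_mono simp: indicator_def True dest: subsetD[OF interior_subset])
      next
        case False
        have "open (- ?Q)" unfolding small_cube_def using closed_cbox by auto
        then have "eventually (\<lambda>k. w - \<sigma> k \<in> - ?Q) sequentially"
          using False by (intro topological_tendstoD[OF lim]) auto
        then show ?thesis
          by (intro tendsto_eventually) (auto elim!: eventually_mono simp: indicator_def False)
      qed
      then show ?case by (intro tendsto_mult tendsto_const)
    qed
    show "AE w in lborel. norm (F w * indicator ?Q (w - \<sigma> k)) \<le> \<bar>F w\<bar>" for k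
      by (intro AE_I2) (simp add: indicator_def)
  qed (use F in auto)
  then have "(\<lambda>k. cube_average n F (\<sigma> k)) \<longlonglongrightarrow> cube_average n F x" if "\<sigma> \<longlonglongrightarrow> x" for \<sigma> x
    using that measure_small_cube_pos[of n, where 'a='a] unfolding cube_average_def
    by (intro tendsto_divide tendsto_const) auto
  then show ?thesis
    unfolding continuous_on_sequentially by (auto simp: comp_def)
qed

text \<open>
  Averaging commutes with translations, so the increment formula, known almost everywhere for \<open>U\<close>,
  holds everywhere for the averages. In this way differentiability is transferred without
  differentiating a convolution.
\<close>

lemma cube_average_increment:
  fixes U V :: "'a::euclidean_space \<Rightarrow> real"
  assumes U: "integrable lborel U" and V: "integrable lborel V"
    and inc: "AE x in lborel. U (x + h *\<^sub>R \<theta>) - U x = seg_integral \<theta> V h x"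
  shows "cube_average n U (x + h *\<^sub>R \<theta>) - cube_average n U x = seg_integral \<theta> (cube_average n V) h x"
proof -
  let ?\<kappa> = "\<lambda>w. indicator (small_cube n) (w - x) :: real"
  let ?m = "measure lborel (small_cube n :: 'a set)"
  have [measurable]: "U \<in> borel_measurable borel" "V \<in> borel_measurable borel" using U V by auto
  have "(\<integral>w. U w * indicator (small_cube n) (w - (x + h *\<^sub>R \<theta>)) \<partial>lborel) = (\<integral>w. U (w + h *\<^sub>R \<theta>) * ?\<kappa> w \<partial>lborel)"
    using integral_lborel_shift[of "\<lambda>w. U w * indicator (small_cube n) (w - (x + h *\<^sub>R \<theta>))" "h *\<^sub>R \<theta>"]
    by (simp add: algebra_simps)
  moreover have "(\<integral>w. U (w + h *\<^sub>R \<theta>) * ?\<kappa> w \<partial>lborel) - (\<integral>w. U w * ?\<kappa> w \<partial>lborel)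
    = (\<integral>w. U (w + h *\<^sub>R \<theta>) * ?\<kappa> w - U w * ?\<kappa> w \<partial>lborel)"
    by (intro Bochner_Integration.integral_diff[symmetric] cube_window_integrable integrable_lborel_shift U)
  moreover have "(\<integral>w. U (w + h *\<^sub>R \<theta>) * ?\<kappa> w - U w * ?\<kappa> w \<partial>lborel) = (\<integral>w. seg_integral \<theta> V h w * ?\<kappa> w \<partial>lborel)"
    using inc by (intro integral_cong_AE) (auto elim!: eventually_mono simp: left_diff_distrib[symmetric])
  moreover have "(\<integral>w. seg_integral \<theta> V h w * ?\<kappa> w \<partial>lborel)
    = (\<integral>t. (if 0 \<le> t \<and> t \<le> h then (\<integral>w. V w * ?\<kappa> (w - t *\<^sub>R \<theta>) \<partial>lborel) else 0) \<partial>lborel)"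
    by (rule integrable_weighted_segment(3)[OF V, of _ 1]) (auto simp: indicator_def)
  moreover have "(\<lambda>t. if 0 \<le> t \<and> t \<le> h then (\<integral>w. V w * ?\<kappa> (w - t *\<^sub>R \<theta>) \<partial>lborel) else 0)
    = (\<lambda>t. (if 0 \<le> t \<and> t \<le> h then cube_average n V (x + t *\<^sub>R \<theta>) else 0) * ?m)"
    using measure_small_cube_pos[of n, where 'a='a] by (auto simp: cube_average_def algebra_simps fun_eq_iff)
  ultimately show ?thesis
    using measure_small_cube_pos[of n, where 'a='a]
    by (simp add: cube_average_def[of n U] diff_divide_distrib[symmetric] seg_integral_def)
qed

text \<open>
  Truncate, approximate the truncation almost everywhere by continuous functions, clip these at the
  same height and cut them off: everything converges boundedly on a bounded set.
\<close>

lemma L2_approx_continuous: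
  fixes F :: "'a::euclidean_space \<Rightarrow> real"
  assumes F: "F \<in> L2_ext \<Omega>" and \<Omega>: "bounded \<Omega>" and e: "e > 0"
  obtains G where "continuous_on UNIV G" "bounded {x. G x \<noteq> 0}" "(\<integral>x. (F x - G x)\<^sup>2 \<partial>lborel) < e"
proof -
  have [measurable]: "F \<in> borel_measurable borel" and F2: "integrable lborel (\<lambda>x. (F x)\<^sup>2)"
    using F by (auto simp: L2_ext_def)

  define cut where "cut M x = max (- real M) (min (real M) (F x))" for M x
  have [measurable]: "cut M \<in> borel_measurable borel" for M unfolding cut_def[abs_def] by measurable
  have "(\<lambda>M. \<integral>x. (F x - cut M x)\<^sup>2 \<partial>lborel) \<longlonglongrightarrow> (\<integral>x. 0 \<partial>(lborel::'a measure))"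
  proof (rule integral_dominated_convergence[where w="\<lambda>x. (F x)\<^sup>2"])
    show "AE x in lborel. (\<lambda>M. (F x - cut M x)\<^sup>2) \<longlonglongrightarrow> 0"
    proof (intro AE_I2 tendsto_eventually)
      fix x
      obtain k :: nat where k: "\<bar>F x\<bar> \<le> real k" using real_arch_simple by blast
      show "\<forall>\<^sub>F M in sequentially. (F x - cut M x)\<^sup>2 = 0"
        using eventually_ge_at_top[of k]
      proof eventually_elim
        case (elim M)
        then have "\<bar>F x\<bar> \<le> real M" using k by linarith
        then have "cut M x = F x" by (simp add: cut_def abs_le_iff max_absorb2 min_absorb2)
        then show ?case by simp
      qed
    qed
    show "AE x in lborel. norm ((F x - cut M x)\<^sup>2) \<le> (F x)\<^sup>2" for M
    proof (intro AE_I2)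
      fix x
      have "\<bar>F x - cut M x\<bar> \<le> \<bar>F x\<bar>" by (auto simp: cut_def)
      then have "(F x - cut M x)\<^sup>2 \<le> (F x)\<^sup>2" by (simp only: abs_le_square_iff)
      then show "norm ((F x - cut M x)\<^sup>2) \<le> (F x)\<^sup>2" by simp
    qed
  qed (use F2 in auto)
  then have "eventually (\<lambda>M. (\<integral>x. (F x - cut M x)\<^sup>2 \<partial>lborel) < e / 4) sequentially"
    using e by (intro order_tendstoD(2)) auto
  then obtain M where M: "(\<integral>x. (F x - cut M x)\<^sup>2 \<partial>lborel) < e / 4"
    by (auto simp: eventually_sequentially)
  obtain R where R: "R > 0" "\<Omega> \<subseteq> cball 0 R"
    using \<Omega> by (meson bounded_subset_ballD ball_subset_cball order_trans)
  have cutb: "\<bar>cut M x\<bar> \<le> real M" for x by (auto simp: cut_def)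
  have cut0: "cut M x = 0" if "x \<notin> cball 0 R" for x
  proof -
    have "x \<notin> \<Omega>" using R(2) that by blast
    then have "F x = 0" using F by (simp add: L2_ext_def)
    then show ?thesis by (simp add: cut_def)
  qed
  have "cut M \<in> borel_measurable lebesgue" by (rule measurable_completion) simp
  then have "cut M measurable_on UNIV"
    using lebesgue_measurable_imp_measurable_on[of "cut M" UNIV] by (simp add: lebesgue_on_UNIV_eq)
  then obtain N g where N: "negligible N" and g: "\<And>n. continuous_on UNIV (g n)"
    "\<And>x. x \<notin> N \<Longrightarrow> (\<lambda>n. g n x) \<longlonglongrightarrow> cut M x"
    by (auto simp: measurable_on_def)
  define \<kappa> where "\<kappa> x = max 0 (min 1 (R + 1 - norm x))" for x :: 'a
  define G where "G n x = \<kappa> x * max (- real M) (min (real M) (g n x))" for n x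
  have Gcont: "continuous_on UNIV (G n)" for n
    unfolding G_def[abs_def] \<kappa>_def[abs_def] by (intro continuous_intros g)
  have [measurable]: "G n \<in> borel_measurable borel" for n using Gcont by (rule borel_measurable_continuous_onI)
  have \<kappa>: "0 \<le> \<kappa> x" "\<kappa> x \<le> 1" "norm x \<le> R \<Longrightarrow> \<kappa> x = 1" "norm x > R + 1 \<Longrightarrow> \<kappa> x = 0" for x
    by (auto simp: \<kappa>_def)
  have Gb: "\<bar>G n x\<bar> \<le> real M" for n x
  proof -
    have "\<bar>G n x\<bar> \<le> 1 * real M" unfolding G_def abs_mult using \<kappa>[of x] by (intro mult_mono) auto
    then show ?thesis by simp
  qed
  have G0: "G n x = 0" if "x \<notin> cball 0 (R + 1)" for n x
    using that \<kappa>(4)[of x] by (simp add: G_def)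
  have "(\<lambda>n. \<integral>x. (cut M x - G n x)\<^sup>2 \<partial>lborel) \<longlonglongrightarrow> (\<integral>x. 0 \<partial>(lborel::'a measure))"
  proof (rule integral_dominated_convergence[where w="\<lambda>x. (2 * real M)\<^sup>2 * indicator (cball 0 (R + 1)) x"])
    have "AE x in lborel. x \<notin> N"
      using N by (metis AE_completion_iff AE_not_in negligible_iff_null_sets)
    then show "AE x in lborel. (\<lambda>n. (cut M x - G n x)\<^sup>2) \<longlonglongrightarrow> 0"
    proof eventually_elim
      case (elim x)
      have "(\<lambda>n. G n x) \<longlonglongrightarrow> \<kappa> x * max (- real M) (min (real M) (cut M x))"
        unfolding G_def by (intro tendsto_intros g(2) elim)
      moreover have "\<kappa> x * max (- real M) (min (real M) (cut M x)) = cut M x"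
        using cutb[of x] cut0[of x] \<kappa>(3)[of x] by (cases "x \<in> cball 0 R") (auto simp: max_def min_def)
      ultimately have "(\<lambda>n. (cut M x - G n x)\<^sup>2) \<longlonglongrightarrow> (cut M x - cut M x)\<^sup>2"
        by (intro tendsto_intros) simp
      then show ?case by simp
    qed
    show "integrable lborel (\<lambda>x::'a. (2 * real M)\<^sup>2 * indicator (cball 0 (R + 1)) x)"
      by (intro integrable_indicator_bounded) auto
    show "AE x in lborel. norm ((cut M x - G n x)\<^sup>2) \<le> (2 * real M)\<^sup>2 * indicator (cball 0 (R + 1)) x" for n
    proof (intro AE_I2)
      fix x
      have "\<bar>cut M x - G n x\<bar> \<le> \<bar>2 * real M\<bar>" using cutb[of x] Gb[of n x] by linarith
      then have "(cut M x - G n x)\<^sup>2 \<le> (2 * real M)\<^sup>2" by (simp only: abs_le_square_iff)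
      then show "norm ((cut M x - G n x)\<^sup>2) \<le> (2 * real M)\<^sup>2 * indicator (cball 0 (R + 1)) x"
        using cut0[of x] G0[of x n] R by (cases "x \<in> cball 0 (R + 1)") (auto simp: indicator_def)
    qed
  qed auto
  then have "eventually (\<lambda>n. (\<integral>x. (cut M x - G n x)\<^sup>2 \<partial>lborel) < e / 4) sequentially"
    using e by (intro order_tendstoD(2)) auto
  then obtain n where n: "(\<integral>x. (cut M x - G n x)\<^sup>2 \<partial>lborel) < e / 4"
    by (auto simp: eventually_sequentially)
  have "cut M \<in> L2_ext (cball 0 R)" "G n \<in> L2_ext (cball 0 (R + 1))"
    by (intro bounded_imp_L2_ext[of _ "real M"] cutb cut0 Gb G0; simp)+
  then have L: "F \<in> L2_ext UNIV" "cut M \<in> L2_ext UNIV" "G n \<in> L2_ext UNIV"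
    using F by (auto simp: L2_ext_def)
  have "(\<integral>x. (F x - G n x)\<^sup>2 \<partial>lborel) \<le> (\<integral>x. 2 * (F x - cut M x)\<^sup>2 + 2 * (cut M x - G n x)\<^sup>2 \<partial>lborel)"
  proof (rule integral_mono)
    from square_add_le[of "F x - cut M x" "cut M x - G n x" for x]
    show "(F x - G n x)\<^sup>2 \<le> 2 * (F x - cut M x)\<^sup>2 + 2 * (cut M x - G n x)\<^sup>2" for x by simp
  qed (use L2_ext_diff[OF L(1,2)] L2_ext_diff[OF L(2,3)] L2_ext_diff[OF L(1,3)] in \<open>auto simp: L2_ext_def\<close>)
  also have "\<dots> = 2 * (\<integral>x. (F x - cut M x)\<^sup>2 \<partial>lborel) + 2 * (\<integral>x. (cut M x - G n x)\<^sup>2 \<partial>lborel)"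
    using L2_ext_diff[OF L(1,2)] L2_ext_diff[OF L(2,3)] by (auto simp: L2_ext_def)
  also have "\<dots> < e" using M n by linarith
  finally have less: "(\<integral>x. (F x - G n x)\<^sup>2 \<partial>lborel) < e" .
  have "{x. G n x \<noteq> 0} \<subseteq> cball 0 (R + 1)" using G0 by blast
  then have "bounded {x. G n x \<noteq> 0}" by (rule bounded_subset[OF bounded_cball])
  then show ?thesis by (rule that[OF Gcont _ less])
qed

lemma cube_average_tendsto_L2_continuous:
  fixes G :: "'a::euclidean_space \<Rightarrow> real"
  assumes G: "continuous_on UNIV G" and bd: "bounded {x. G x \<noteq> 0}"
  shows "G \<in> L2_ext UNIV" "integrable lborel G" "(\<lambda>n. \<integral>x. (cube_average n G x - G x)\<^sup>2 \<partial>lborel) \<longlonglongrightarrow> 0"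
proof -
  have [measurable]: "G \<in> borel_measurable borel" using G by (rule borel_measurable_continuous_onI)
  obtain R where R: "R > 0" "{x. G x \<noteq> 0} \<subseteq> cball 0 R"
    using bd by (meson bounded_subset_ballD ball_subset_cball order_trans)
  have G0: "G x = 0" if "x \<notin> cball 0 R" for x using R that by blast
  obtain B where B: "B > 0" "\<And>x. \<bar>G x\<bar> \<le> B"
    using continuous_compact_support_bounded[OF G compact_cball[of 0 R] G0] by blast
  have "G \<in> L2_ext (cball 0 R)" by (rule bounded_imp_L2_ext[OF _ B(2) G0]) auto
  from L2_ext_integrable[OF bounded_cball this] show iG: "integrable lborel G" .
  show "G \<in> L2_ext UNIV" using \<open>G \<in> L2_ext (cball 0 R)\<close> by (simp add: L2_ext_def)
  let ?m = "\<lambda>n. measure lborel (small_cube n :: 'a set)"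
  have osc: "\<bar>cube_average n G x - G x\<bar> \<le> \<eta>"
    if \<eta>: "\<And>w. w - x \<in> small_cube n \<Longrightarrow> \<bar>G w - G x\<bar> \<le> \<eta>" for n x \<eta>
  proof -
    have ind: "integrable lborel (\<lambda>w. c * indicator (small_cube n) (w - x))" for c :: real
    proof -
      have "integrable lborel (\<lambda>w. indicator (small_cube n) (w + - x) :: real)"
        by (rule integrable_lborel_shift, rule integrable_real_indicator) (simp_all add: emeasure_small_cube)
      then show ?thesis by (intro integrable_mult_right) simp
    qed
    have "(\<integral>w. G w * indicator (small_cube n) (w - x) \<partial>lborel) - ?m n * G x
      = (\<integral>w. G w * indicator (small_cube n) (w - x) \<partial>lborel) - (\<integral>w. G x * indicator (small_cube n) (w - x) \<partial>lborel)"
      by (simp add: indicator_translate_measure)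
    also have "\<dots> = (\<integral>w. G w * indicator (small_cube n) (w - x) - G x * indicator (small_cube n) (w - x) \<partial>lborel)"
      by (intro Bochner_Integration.integral_diff[symmetric] cube_window_integrable iG ind)
    finally have "\<bar>(\<integral>w. G w * indicator (small_cube n) (w - x) \<partial>lborel) - ?m n * G x\<bar>
      \<le> (\<integral>w. \<bar>G w * indicator (small_cube n) (w - x) - G x * indicator (small_cube n) (w - x)\<bar> \<partial>lborel)"
      by (simp only: integral_abs_bound)
    also have "\<dots> \<le> (\<integral>w. \<eta> * indicator (small_cube n) (w - x) \<partial>lborel)"
      by (intro integral_mono integrable_abs Bochner_Integration.integrable_diff cube_window_integrable iG ind)
        (auto simp: indicator_def \<eta>)
    also have "\<dots> = \<eta> * ?m n" by (simp add: indicator_translate_measure)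
    finally have "\<bar>(\<integral>w. G w * indicator (small_cube n) (w - x) \<partial>lborel) - ?m n * G x\<bar> \<le> \<eta> * ?m n" .
    moreover have "cube_average n G x - G x = ((\<integral>w. G w * indicator (small_cube n) (w - x) \<partial>lborel) - ?m n * G x) / ?m n"
      using measure_small_cube_pos[of n, where 'a='a] by (simp add: cube_average_def field_simps)
    ultimately show ?thesis
      using measure_small_cube_pos[of n, where 'a='a] by (simp add: abs_divide pos_divide_le_eq)
  qed
  have near: "norm z \<le> DIM('a)" if "z \<in> small_cube n" for z :: 'a and n
  proof -
    have "real DIM('a) / real (Suc n) \<le> real DIM('a) / 1" by (intro divide_left_mono) auto
    then show ?thesis using small_cube_norm[OF that] by linarith
  qed
  let ?R = "R + real DIM('a)"
  have "(\<lambda>n. \<integral>x. (cube_average n G x - G x)\<^sup>2 \<partial>lborel) \<longlonglongrightarrow> (\<integral>x. 0 \<partial>(lborel::'a measure))"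
  proof (rule integral_dominated_convergence[where w="\<lambda>x. (2 * B)\<^sup>2 * indicator (cball 0 ?R) x"])
    show "AE x in lborel. (\<lambda>n. (cube_average n G x - G x)\<^sup>2) \<longlonglongrightarrow> 0"
    proof (intro AE_I2)
      fix x
      have "(\<lambda>n. cube_average n G x - G x) \<longlonglongrightarrow> 0"
      proof (rule LIMSEQ_I)
        fix r :: real assume r: "r > 0"
        have "isCont G x" using G by (simp add: continuous_on_eq_continuous_at)
        then obtain d where d: "d > 0" "\<And>w. norm (w - x) < d \<Longrightarrow> \<bar>G w - G x\<bar> < r / 2"
          using r unfolding continuous_at_eps_delta dist_norm real_norm_def by (metis half_gt_zero)
        have "(\<lambda>n. real DIM('a) * inverse (real (Suc n))) \<longlonglongrightarrow> real DIM('a) * 0"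
          by (intro tendsto_mult tendsto_const LIMSEQ_inverse_real_of_nat)
        then have "eventually (\<lambda>n. real DIM('a) * inverse (real (Suc n)) < d) sequentially"
          using d(1) by (intro order_tendstoD(2)) auto
        then obtain n0 where n0: "\<And>n. n \<ge> n0 \<Longrightarrow> real DIM('a) * inverse (real (Suc n)) < d"
          unfolding eventually_sequentially by blast
        have "\<bar>cube_average n G x - G x\<bar> \<le> r / 2" if "n \<ge> n0" for n
        proof (rule osc)
          fix w assume "w - x \<in> small_cube n"
          from small_cube_norm[OF this] n0[OF that] have "norm (w - x) < d" by (simp add: divide_inverse)
          then show "\<bar>G w - G x\<bar> \<le> r / 2" using d(2) by (simp add: less_imp_le)
        qed
        then show "\<exists>n0. \<forall>n\<ge>n0. norm (cube_average n G x - G x - 0) < r"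
          using r by (intro exI[of _ n0] allI impI) (fastforce intro: le_less_trans)
      qed
      from tendsto_power[OF this, of 2] show "(\<lambda>n. (cube_average n G x - G x)\<^sup>2) \<longlonglongrightarrow> 0" by simp
    qed
    show "AE x in lborel. norm ((cube_average n G x - G x)\<^sup>2) \<le> (2 * B)\<^sup>2 * indicator (cball 0 ?R) x" for n
    proof (intro AE_I2)
      fix x
      show "norm ((cube_average n G x - G x)\<^sup>2) \<le> (2 * B)\<^sup>2 * indicator (cball 0 ?R) x"
      proof (cases "x \<in> cball 0 ?R")
        case True
        have "\<bar>cube_average n G x - G x\<bar> \<le> 2 * B"
        proof (rule osc)
          show "\<bar>G w - G x\<bar> \<le> 2 * B" for w using B(2)[of w] B(2)[of x] by linarith
        qed
        then have "\<bar>cube_average n G x - G x\<bar> \<le> \<bar>2 * B\<bar>" using B(1) by simp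
        then have "(cube_average n G x - G x)\<^sup>2 \<le> (2 * B)\<^sup>2" by (simp only: abs_le_square_iff)
        with True show ?thesis by simp
      next
        case False
        have "\<bar>cube_average n G x - G x\<bar> \<le> 0"
        proof (rule osc)
          fix w assume w: "w - x \<in> small_cube n"
          have "norm x \<le> norm w + norm (w - x)" using norm_triangle_ineq4[of w "w - x"] by simp
          then have "norm w > R" using near[OF w] False by simp
          then show "\<bar>G w - G x\<bar> \<le> 0" using G0[of w] G0[of x] False by simp
        qed
        then show ?thesis by simp
      qed
    qed
    show "integrable lborel (\<lambda>x::'a. (2 * B)\<^sup>2 * indicator (cball 0 ?R) x)"
      by (intro integrable_indicator_bounded) auto
  qed auto
  then show "(\<lambda>n. \<integral>x. (cube_average n G x - G x)\<^sup>2 \<partial>lborel) \<longlonglongrightarrow> 0" by simp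
qed

text \<open>
  Replace the function by a continuous one of bounded support; since averaging is a contraction, the
  error is controlled by the error of this replacement.
\<close>

lemma cube_average_tendsto_L2:
  fixes F :: "'a::euclidean_space \<Rightarrow> real"
  assumes F: "F \<in> L2_ext \<Omega>" and \<Omega>: "bounded \<Omega>"
  shows "(\<lambda>n. \<integral>x. (F x - cube_average n F x)\<^sup>2 \<partial>lborel) \<longlonglongrightarrow> 0"
proof (rule LIMSEQ_I)
  fix e :: real assume e: "e > 0"
  have [measurable]: "F \<in> borel_measurable borel" using F by (auto simp: L2_ext_def)
  have FU: "F \<in> L2_ext UNIV" using F by (simp add: L2_ext_def)
  have iF: "integrable lborel F" by (rule L2_ext_integrable[OF \<Omega> F])
  obtain G where G: "continuous_on UNIV G" "bounded {x. G x \<noteq> 0}" "(\<integral>x. (F x - G x)\<^sup>2 \<partial>lborel) < e / 12"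
    by (rule L2_approx_continuous[OF F \<Omega>, of "e / 12"]) (use e that in auto)
  note G' = cube_average_tendsto_L2_continuous[OF G(1,2)]
  have [measurable]: "G \<in> borel_measurable borel" using G(1) by (rule borel_measurable_continuous_onI)
  have "eventually (\<lambda>n. (\<integral>x. (cube_average n G x - G x)\<^sup>2 \<partial>lborel) < e / 6) sequentially"
    using e by (intro order_tendstoD(2)[OF G'(3)]) auto
  then obtain n0 where n0: "\<And>n. n \<ge> n0 \<Longrightarrow> (\<integral>x. (cube_average n G x - G x)\<^sup>2 \<partial>lborel) < e / 6"
    unfolding eventually_sequentially by blast
  have "(\<integral>x. (F x - cube_average n F x)\<^sup>2 \<partial>lborel) < e" if n: "n \<ge> n0" for n
  proof -
    have avg: "cube_average n f \<in> L2_ext UNIV" if "f \<in> L2_ext UNIV" for f :: "'a \<Rightarrow> real"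
      using that cube_average_square_le(1)[of f n] borel_measurable_cube_average[of f n] by (simp add: L2_ext_def)
    have D: "(\<lambda>x. F x - G x) \<in> L2_ext UNIV" by (rule L2_ext_diff[OF FU G'(1)])
    have i1: "integrable lborel (\<lambda>x. (F x - G x)\<^sup>2)" using D by (simp add: L2_ext_def)
    have i2: "integrable lborel (\<lambda>x. (cube_average n G x - G x)\<^sup>2)"
      using L2_ext_diff[OF avg[OF G'(1)] G'(1)] by (simp add: L2_ext_def)
    have i3: "integrable lborel (\<lambda>x. (cube_average n (\<lambda>x. F x - G x) x)\<^sup>2)"
      using avg[OF D] by (simp add: L2_ext_def)
    have i0: "integrable lborel (\<lambda>x. (F x - cube_average n F x)\<^sup>2)"
      using L2_ext_diff[OF FU avg[OF FU]] by (simp add: L2_ext_def)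
    have "(\<integral>x. (F x - cube_average n F x)\<^sup>2 \<partial>lborel)
      \<le> (\<integral>x. 3 * (F x - G x)\<^sup>2 + 3 * (cube_average n G x - G x)\<^sup>2 + 3 * (cube_average n (\<lambda>x. F x - G x) x)\<^sup>2 \<partial>lborel)"
    proof (rule integral_mono[OF i0])
      have *: "(a - b - c)\<^sup>2 \<le> 3 * a\<^sup>2 + 3 * b\<^sup>2 + 3 * c\<^sup>2" for a b c :: real
      proof -
        have "3 * a\<^sup>2 + 3 * b\<^sup>2 + 3 * c\<^sup>2 - (a - b - c)\<^sup>2 = (a + b)\<^sup>2 + (a + c)\<^sup>2 + (b - c)\<^sup>2"
          by (simp add: power2_eq_square algebra_simps)
        then show ?thesis
          using zero_le_power2[of "a + b"] zero_le_power2[of "a + c"] zero_le_power2[of "b - c"] by linarith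
      qed
      show "(F x - cube_average n F x)\<^sup>2
        \<le> 3 * (F x - G x)\<^sup>2 + 3 * (cube_average n G x - G x)\<^sup>2 + 3 * (cube_average n (\<lambda>x. F x - G x) x)\<^sup>2" for x
        using *[of "F x - G x" "cube_average n G x - G x" "cube_average n (\<lambda>x. F x - G x) x"]
        by (simp add: cube_average_diff[OF iF G'(2)])
    qed (intro Bochner_Integration.integrable_add integrable_mult_right i1 i2 i3)
    also have "\<dots> = 3 * (\<integral>x. (F x - G x)\<^sup>2 \<partial>lborel) + 3 * (\<integral>x. (cube_average n G x - G x)\<^sup>2 \<partial>lborel)
      + 3 * (\<integral>x. (cube_average n (\<lambda>x. F x - G x) x)\<^sup>2 \<partial>lborel)"
      using i1 i2 i3 by simp
    also have "\<dots> < e"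
      using G(3) n0[OF n] cube_average_square_le(2)[OF _ i1, of n] by simp
    finally show ?thesis .
  qed
  then show "\<exists>n0. \<forall>n\<ge>n0. norm ((\<integral>x. (F x - cube_average n F x)\<^sup>2 \<partial>lborel) - 0) < e"
    by (intro exI[of _ n0]) simp
qed

section \<open>Functions with vanishing trace\<close>

text \<open>
  The averages over small cubes of the extension by zero are continuous on the whole space, have the
  averages of the derivatives as derivatives, and converge in norm.
\<close>

lemma H1_tr_0_subset_H1_tilde:
  fixes \<Omega> :: "'a::euclidean_space set"
  assumes \<Omega>: "open \<Omega>" "bounded \<Omega>"
  shows "H1_tr_0 \<Omega> \<subseteq> H1_tilde \<Omega>"
proof
  fix u assume u: "u \<in> H1_tr_0 \<Omega>"
  then have utr: "u \<in> H1_tr \<Omega>" and tr0: "eq_omni \<Omega> (tr \<Omega> u) (\<lambda>_. 0)" by (auto simp: H1_tr_0_def)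
  then have uH: "u \<in> H1 \<Omega>" by (simp add: H1_tr_def)
  obtain U G where r: "H1_rep \<Omega> u U G" by (rule H1_rep_exists[OF \<Omega>(1) uH])
  then have U: "U \<in> L2_ext \<Omega>" and G: "\<And>b. b \<in> Basis \<Longrightarrow> G b \<in> L2_ext \<Omega>" by (auto simp: H1_rep_def)
  have iU: "integrable lborel U" and iG: "\<And>b. b \<in> Basis \<Longrightarrow> integrable lborel (G b)"
    using L2_ext_integrable[OF \<Omega>(2)] U G by auto
  have 0: "AE x in lborel. x \<in> \<Omega> \<longrightarrow> trace_at_exit \<Omega> U G \<theta> x = 0" if "norm \<theta> = 1" for \<theta>
    using omni_trace_vanishes_iff[OF \<Omega> r omni_trace_tr[OF utr]] tr0 that by blast
  define W where "W n x = indicator \<Omega> x * cube_average n U x" for n x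
  define H where "H n b x = indicator \<Omega> x * cube_average n (G b) x" for n b x
  have ext: "(\<lambda>x. indicator \<Omega> x * cube_average n F x) \<in> L2_ext \<Omega>" if F: "F \<in> L2_ext \<Omega>" for F n
  proof -
    have [measurable]: "F \<in> borel_measurable borel" "\<Omega> \<in> sets borel" and F2: "integrable lborel (\<lambda>x. (F x)\<^sup>2)"
      using F \<Omega> by (auto simp: L2_ext_def)
    have "integrable lborel (\<lambda>x. indicator \<Omega> x *\<^sub>R (cube_average n F x)\<^sup>2)"
      by (intro integrable_mult_indicator cube_average_square_le(1) F2) auto
    moreover have "(\<lambda>x. indicator \<Omega> x *\<^sub>R (cube_average n F x)\<^sup>2) = (\<lambda>x. (indicator \<Omega> x * cube_average n F x)\<^sup>2)"
      by (simp add: fun_eq_iff indicator_def)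
    ultimately show ?thesis by (simp add: L2_ext_def)
  qed
  have rn: "H1_rep \<Omega> (cube_average n U) (W n) (H n)" for n
  proof -
    have "has_weak_deriv \<Omega> b (W n) (H n b)" if b: "b \<in> Basis" for b
      unfolding W_def[abs_def] H_def[abs_def]
      unfolding has_weak_deriv_iff_lborel[OF \<Omega>(1) ext[OF U] ext[OF G[OF b]]]
    proof
      fix \<phi> assume \<phi>: "\<phi> \<in> Cc_infinity \<Omega>"
      have "(\<integral>x. cube_average n U x * frechet_derivative \<phi> (at x) b \<partial>lborel) = - (\<integral>x. cube_average n (G b) x * \<phi> x \<partial>lborel)"
      proof (rule increment_imp_weak_derivative[OF \<Omega>(1) _ _ _ \<phi>])
        show "integrable lborel (cube_average n U)" by (rule integrable_cube_average(1)[OF iU])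
        show "integrable lborel (cube_average n (G b))" by (rule integrable_cube_average(1)[OF iG[OF b]])
        fix k
        have "AE x in lborel. U (x + (1 / real (Suc k)) *\<^sub>R b) - U x = seg_integral b (G b) (1 / real (Suc k)) x"
          by (rule vanishing_trace_increment[OF \<Omega> r 0 b]) auto
        from cube_average_increment[OF iU iG[OF b] this]
        show "AE x in lborel. (\<forall>t\<in>{0..1 / real (Suc k)}. x + t *\<^sub>R b \<in> \<Omega>) \<longrightarrow>
          cube_average n U (x + (1 / real (Suc k)) *\<^sub>R b) - cube_average n U x = seg_integral b (cube_average n (G b)) (1 / real (Suc k)) x"
          by simp
      qed
      moreover have off: "indicator \<Omega> x * c * \<phi> x = c * \<phi> x" "indicator \<Omega> x * c * frechet_derivative \<phi> (at x) b = c * frechet_derivative \<phi> (at x) b" for x c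
        using Cc_infinity_eq_0[OF \<phi>, of x] Cc_infinity_derivative_eq_0[OF \<phi>, of x b] \<phi>
        by (cases "x \<in> \<Omega>"; auto simp: Cc_infinity_def)+
      ultimately show "(\<integral>x. indicator \<Omega> x * cube_average n U x * frechet_derivative \<phi> (at x) b \<partial>lborel)
        = - (\<integral>x. indicator \<Omega> x * cube_average n (G b) x * \<phi> x \<partial>lborel)" by (simp only: off)
    qed
    moreover have "cube_average n U \<in> borel_measurable (lebesgue_on \<Omega>)"
      using U by (intro borel_imp_lebesgue_on borel_measurable_cube_average) (simp add: L2_ext_def)
    ultimately show ?thesis
      using ext[OF U, of n] ext[OF G, of _ n] by (simp add: H1_rep_def W_def[abs_def] H_def[abs_def])
  qed
  have le: "(\<integral>x. (F x - indicator \<Omega> x * cube_average n F x)\<^sup>2 \<partial>lborel) \<le> (\<integral>x. (F x - cube_average n F x)\<^sup>2 \<partial>lborel)"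
    if F: "F \<in> L2_ext \<Omega>" for F n
  proof (rule integral_mono)
    have F': "F \<in> L2_ext UNIV" "cube_average n F \<in> L2_ext UNIV"
      using F cube_average_square_le(1)[of F n] borel_measurable_cube_average[of F n] by (auto simp: L2_ext_def)
    show "integrable lborel (\<lambda>x. (F x - indicator \<Omega> x * cube_average n F x)\<^sup>2)"
      using L2_ext_diff[OF F ext[OF F, of n]] by (simp add: L2_ext_def)
    show "integrable lborel (\<lambda>x. (F x - cube_average n F x)\<^sup>2)"
      using L2_ext_diff[OF F'] by (simp add: L2_ext_def)
    show "(F x - indicator \<Omega> x * cube_average n F x)\<^sup>2 \<le> (F x - cube_average n F x)\<^sup>2" for x
      using F by (cases "x \<in> \<Omega>") (auto simp: L2_ext_def)
  qed
  let ?err = "\<lambda>n. (\<integral>x. (U x - cube_average n U x)\<^sup>2 \<partial>lborel) + (\<Sum>b\<in>Basis. \<integral>x. (G b x - cube_average n (G b) x)\<^sup>2 \<partial>lborel)"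
  have norm_le: "(H1_norm \<Omega> (\<lambda>x. u x - cube_average n U x))\<^sup>2 \<le> ?err n" for n
    unfolding H1_rep_norm[OF \<Omega> H1_rep_diff[OF \<Omega> r rn]]
    unfolding W_def H_def by (intro add_mono sum_mono le U G)
  have err: "?err \<longlonglongrightarrow> 0 + (\<Sum>b\<in>(Basis::'a set). 0)"
    by (intro tendsto_add tendsto_sum cube_average_tendsto_L2[OF _ \<Omega>(2)] U G)
  show "u \<in> H1_tilde \<Omega>"
    unfolding H1_tilde_def H1_closure_def
  proof (intro CollectI conjI uH allI impI)
    fix e :: real assume e: "e > 0"
    have "eventually (\<lambda>n. ?err n < e\<^sup>2) sequentially"
      using e by (intro order_tendstoD(2)[OF err]) auto
    then obtain n where "?err n < e\<^sup>2" by (auto simp: eventually_sequentially)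
    with norm_le[of n] have "(H1_norm \<Omega> (\<lambda>x. u x - cube_average n U x))\<^sup>2 < e\<^sup>2" by linarith
    then have "H1_norm \<Omega> (\<lambda>x. u x - cube_average n U x) < e"
      using e by (intro power2_less_imp_less[of _ e]) auto
    moreover have "continuous_on (closure \<Omega>) (cube_average n U)"
      by (rule continuous_on_subset[OF continuous_cube_average[OF iU]]) simp
    ultimately show "\<exists>v\<in>{v \<in> H1 \<Omega>. continuous_on (closure \<Omega>) v}. H1_norm \<Omega> (\<lambda>x. u x - v x) < e"
      using H1_rep_imp_H1[OF \<Omega> rn] by blast
  qed
qed

theorem corollary3p4:
  fixes \<Omega> :: "(real ^ 'n) set"
  assumes "open \<Omega>" and "bounded \<Omega>"
  shows "H1_0 \<Omega> \<subseteq> H1_tr_0 \<Omega> \<and> H1_tr_0 \<Omega> \<subseteq> H1_tilde \<Omega> \<and> H1_tilde \<Omega> \<subseteq> H1_tr \<Omega>"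
  using H1_0_subset_H1_tr_0[OF assms] H1_tr_0_subset_H1_tilde[OF assms] H1_tilde_subset_H1_tr[OF assms]
  by blast

end
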